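(* Let $\{X_i\}_{i\ge1}$ and $\{Y_i\}_{i\ge1}$ be strictly stationary $m$-dependent sequences of random vectors in $\mathbb{R}^d$, where $X_1$ and $Y_1$ have densities $p_X$ and $p_Y$, and let $(k,l)\in\{(2,0),(1,1)\}$. Assume that $p_X,p_Y\in L_3(\mathbb{R}^d)$ and that the sequence $\{(X_i,Y_i)\}_{i\ge1}$ of random vectors in $\mathbb{R}^{2d}$ is strictly stationary and $m$-dependent. Let $\epsilon=\epsilon(n)>0$ with $\epsilon(n)\to0$ as $n\to\infty$, and let $\tilde Q_{k,l,n}$, $q_{k,l}$ and $\sigma^2_{k,l}$ be as defined in the context. Then: (i) If $n\epsilon^d\to\infty$, then $\tilde Q_{k,l,n}\to q_{k,l}$ in mean square as $n\to\infty$, i.e. $\mathrm{E}(\tilde Q_{k,l,n}-q_{k,l})^2\to0$. (ii) If $p_X,p_Y\in H_2^{(\alpha)}(K)$ with $0<\alpha\le d/2$, and $\epsilon\sim c\,n^{-1/(2\alpha+d)}$ for some $c>0$, then $$\mathrm{E}(\tilde Q_{k,l,n}-q_{k,l})^2=O\big(n^{-4\alpha/(2\alpha+d)}\big)\quad\text{as } n\to\infty.$$ (iii) If $d=1$, $p_X,p_Y\in H_2^{(\alpha)}(K)$ with $\alpha>1/2$, and $\epsilon\sim L(n)n^{-1/2}$, where $L(n)$, $n\ge1$, is a slowly varying function with $L(n)\to\infty$ as $n\to\infty$, then $$\mathrm{E}(\tilde Q_{k,l,n}-q_{k,l})^2=4\sigma^2_{k,l}\,n^{-1}+o(n^{-1})\quad\text{as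 } n\to\infty.$$
   Context: A sequence $\{W_i\}_{i\ge1}$ of random vectors is $m$-dependent ($m\ge0$ an integer) if $\{W_1,\ldots,W_b\}$ and $\{W_{b+k},\ldots,W_{b+k+l}\}$, $b,k,l=1,2,\ldots$, are independent sets whenever $k>m$. Dependence between the sequences $\{X_i\}$ and $\{Y_i\}$ is allowed. The functionals are $q_{2,0}=\int_{\mathbb{R}^d}p_X(x)^2\,dx$ and $q_{1,1}=\int_{\mathbb{R}^d}p_X(x)p_Y(x)\,dx$. Let $d(x,y)=|x-y|$ be the Euclidean distance in $\mathbb{R}^d$, $I(A)$ the indicator of the event $A$, $B_\epsilon(x)=\{y\in\mathbb{R}^d: d(x,y)\le\epsilon\}$, and let $b_\epsilon(d)=b_1(d)\epsilon^d$ be the volume (Lebesgue measure) of an $\epsilon$-ball in $\mathbb{R}^d$. The estimators based on $\{X_1,\ldots,X_n\}$ and $\{Y_1,\ldots,Y_n\}$ are $\tilde Q_{k,l,n}=Q_{k,l,n}/b_\epsilon(d)$ with $$Q_{2,0,n}=\frac{1}{\binom n2}\sum_{1\le i<j\le n}I(d(X_i,X_j)\le\epsilon),\qquad Q_{1,1,n}=\frac1{n^2}\sum_{i=1}^n\sum_{j=1}^nI(d(X_i,Y_j)\le\epsilon),$$ where $\epsilon=\epsilon(n)$. With $g(X_i,Y_i)=\frac12\big(p_Y(X_i)+p_X(Y_i)\big)$, define $$\sigma_{2,0}^2=\mathrm{Var}(p_X(X_1))+2\sum_{h=1}^m\mathrm{Cov}\big(p_X(X_1),p_X(X_{1+h})\big),$$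 $$\sigma_{1,1}^2=\mathrm{Var}(g(X_1,Y_1))+2\sum_{h=1}^m\mathrm{Cov}\big(g(X_1,Y_1),g(X_{1+h},Y_{1+h})\big).$$ For $0<\alpha\le1$ and $K>0$, $H_2^{(\alpha)}(K)$ is the class of functions $p\in L_2(\mathbb{R}^d)$ such that $\left(\int_{\mathbb{R}^d}(p(x-h)-p(x))^2dx\right)^{1/2}\le K|h|^\alpha$ for all $h\in B_1(0)$. $a_n\sim b_n$ means $a_n/b_n\to1$ as $n\to\infty$. *)

theory Defs
  imports "HOL-Probability.Probability" "HOL-Library.Landau_Symbols"
begin

text \<open>
  Sequences are indexed by \<open>i \<ge> 1\<close>. They are represented by functions on \<open>nat\<close> whose value at
  \<open>0\<close> is irrelevant: it is neither constrained nor used.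
\<close>

definition strictly_stationary ::
  "'w measure \<Rightarrow> (nat \<Rightarrow> 'w \<Rightarrow> 'b::topological_space) \<Rightarrow> bool" where
  "strictly_stationary M W \<longleftrightarrow>
     (\<forall>J h. finite J \<and> J \<subseteq> {1..} \<longrightarrow>
        distr M (\<Pi>\<^sub>M j\<in>J. borel) (\<lambda>\<omega>. \<lambda>j\<in>J. W (j + h) \<omega>) =
        distr M (\<Pi>\<^sub>M j\<in>J. borel) (\<lambda>\<omega>. \<lambda>j\<in>J. W j \<omega>))"

definition m_dependent ::
  "'w measure \<Rightarrow> nat \<Rightarrow> (nat \<Rightarrow> 'w \<Rightarrow> 'b::topological_space) \<Rightarrow> bool" where
  "m_dependent M m W \<longleftrightarrow>
     (\<forall>b\<ge>1. \<forall>k\<ge>1. \<forall>l\<ge>1. m < k \<longrightarrow>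
        prob_space.indep_var M
          (\<Pi>\<^sub>M i\<in>{1..b}. borel) (\<lambda>\<omega>. \<lambda>i\<in>{1..b}. W i \<omega>)
          (\<Pi>\<^sub>M i\<in>{b+k..b+k+l}. borel) (\<lambda>\<omega>. \<lambda>i\<in>{b+k..b+k+l}. W i \<omega>))"

definition is_density ::
  "'w measure \<Rightarrow> ('w \<Rightarrow> 'a::euclidean_space) \<Rightarrow> ('a \<Rightarrow> real) \<Rightarrow> bool" where
  "is_density M X p \<longleftrightarrow> (\<forall>x. 0 \<le> p x) \<and> distributed M lborel X (\<lambda>x. ennreal (p x))"

definition Lp_fun :: "nat \<Rightarrow> ('a::euclidean_space \<Rightarrow> real) set" where
  "Lp_fun r = {p \<in> borel_measurable borel. integrable lborel (\<lambda>x. \<bar>p x\<bar> ^ r)}"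

definition H2_class :: "real \<Rightarrow> real \<Rightarrow> ('a::euclidean_space \<Rightarrow> real) set" where
  "H2_class \<alpha> K = {p \<in> Lp_fun 2.
     \<forall>h\<in>cball 0 1. sqrt (\<integral>x. (p (x - h) - p x)\<^sup>2 \<partial>lborel) \<le> K * norm h powr \<alpha>}"

definition q20 :: "('a::euclidean_space \<Rightarrow> real) \<Rightarrow> real" where
  "q20 pX = (\<integral>x. (pX x)\<^sup>2 \<partial>lborel)"

definition q11 :: "('a::euclidean_space \<Rightarrow> real) \<Rightarrow> ('a \<Rightarrow> real) \<Rightarrow> real" where
  "q11 pX pY = (\<integral>x. pX x * pY x \<partial>lborel)"

definition Q20 ::
  "(nat \<Rightarrow> 'w \<Rightarrow> 'a::euclidean_space) \<Rightarrow> real \<Rightarrow> nat \<Rightarrow> 'w \<Rightarrow> real" where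
  "Q20 X e n \<omega> = 1 / real (n choose 2) *
     (\<Sum>(i, j)\<in>{(i, j). 1 \<le> i \<and> i < j \<and> j \<le> n}. of_bool (dist (X i \<omega>) (X j \<omega>) \<le> e))"

definition Q11 ::
  "(nat \<Rightarrow> 'w \<Rightarrow> 'a::euclidean_space) \<Rightarrow> (nat \<Rightarrow> 'w \<Rightarrow> 'a) \<Rightarrow> real \<Rightarrow> nat \<Rightarrow> 'w \<Rightarrow> real" where
  "Q11 X Y e n \<omega> = 1 / (real n)\<^sup>2 *
     (\<Sum>i=1..n. \<Sum>j=1..n. of_bool (dist (X i \<omega>) (Y j \<omega>) \<le> e))"

definition covar :: "'w measure \<Rightarrow> ('w \<Rightarrow> real) \<Rightarrow> ('w \<Rightarrow> real) \<Rightarrow> real" where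
  "covar M U V = (\<integral>\<omega>. (U \<omega> - (\<integral>\<omega>. U \<omega> \<partial>M)) * (V \<omega> - (\<integral>\<omega>. V \<omega> \<partial>M)) \<partial>M)"

definition sigma20_sq ::
  "'w measure \<Rightarrow> nat \<Rightarrow> (nat \<Rightarrow> 'w \<Rightarrow> 'a::euclidean_space) \<Rightarrow> ('a \<Rightarrow> real) \<Rightarrow> real" where
  "sigma20_sq M m X pX =
     prob_space.variance M (\<lambda>\<omega>. pX (X 1 \<omega>)) +
     2 * (\<Sum>h=1..m. covar M (\<lambda>\<omega>. pX (X 1 \<omega>)) (\<lambda>\<omega>. pX (X (1 + h) \<omega>)))"

definition g_fun :: "('a \<Rightarrow> real) \<Rightarrow> ('a \<Rightarrow> real) \<Rightarrow> 'a \<Rightarrow> 'a \<Rightarrow> real" where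
  "g_fun pX pY x y = (1 / 2) * (pY x + pX y)"

definition sigma11_sq ::
  "'w measure \<Rightarrow> nat \<Rightarrow> (nat \<Rightarrow> 'w \<Rightarrow> 'a::euclidean_space) \<Rightarrow> (nat \<Rightarrow> 'w \<Rightarrow> 'a)
     \<Rightarrow> ('a \<Rightarrow> real) \<Rightarrow> ('a \<Rightarrow> real) \<Rightarrow> real" where
  "sigma11_sq M m X Y pX pY =
     prob_space.variance M (\<lambda>\<omega>. g_fun pX pY (X 1 \<omega>) (Y 1 \<omega>)) +
     2 * (\<Sum>h=1..m. covar M (\<lambda>\<omega>. g_fun pX pY (X 1 \<omega>) (Y 1 \<omega>))
                              (\<lambda>\<omega>. g_fun pX pY (X (1 + h) \<omega>) (Y (1 + h) \<omega>)))"

text \<open>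
  The index \<open>(k, l)\<close> only takes the values \<open>(2, 0)\<close> and \<open>(1, 1)\<close>; in the following definitions the
  \<open>else\<close> branch is the case \<open>(1, 1)\<close>.
\<close>

definition q_kl ::
  "nat \<times> nat \<Rightarrow> ('a::euclidean_space \<Rightarrow> real) \<Rightarrow> ('a \<Rightarrow> real) \<Rightarrow> real" where
  "q_kl kl pX pY = (if kl = (2, 0) then q20 pX else q11 pX pY)"

definition Q_kl ::
  "nat \<times> nat \<Rightarrow> (nat \<Rightarrow> 'w \<Rightarrow> 'a::euclidean_space) \<Rightarrow> (nat \<Rightarrow> 'w \<Rightarrow> 'a)
     \<Rightarrow> real \<Rightarrow> nat \<Rightarrow> 'w \<Rightarrow> real" where
  "Q_kl kl X Y e n \<omega> = (if kl = (2, 0) then Q20 X e n \<omega> else Q11 X Y e n \<omega>)"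

definition Q_tilde ::
  "nat \<times> nat \<Rightarrow> (nat \<Rightarrow> 'w \<Rightarrow> 'a::euclidean_space) \<Rightarrow> (nat \<Rightarrow> 'w \<Rightarrow> 'a)
     \<Rightarrow> real \<Rightarrow> nat \<Rightarrow> 'w \<Rightarrow> real" where
  "Q_tilde kl X Y e n \<omega> = Q_kl kl X Y e n \<omega> / measure lborel (cball (0::'a) e)"

definition sigma_sq ::
  "nat \<times> nat \<Rightarrow> 'w measure \<Rightarrow> nat \<Rightarrow> (nat \<Rightarrow> 'w \<Rightarrow> 'a::euclidean_space) \<Rightarrow> (nat \<Rightarrow> 'w \<Rightarrow> 'a)
     \<Rightarrow> ('a \<Rightarrow> real) \<Rightarrow> ('a \<Rightarrow> real) \<Rightarrow> real" where
  "sigma_sq kl M m X Y pX pY =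
     (if kl = (2, 0) then sigma20_sq M m X pX else sigma11_sq M m X Y pX pY)"

definition mean_sq_error ::
  "nat \<times> nat \<Rightarrow> 'w measure \<Rightarrow> (nat \<Rightarrow> 'w \<Rightarrow> 'a::euclidean_space) \<Rightarrow> (nat \<Rightarrow> 'w \<Rightarrow> 'a)
     \<Rightarrow> ('a \<Rightarrow> real) \<Rightarrow> ('a \<Rightarrow> real) \<Rightarrow> real \<Rightarrow> nat \<Rightarrow> real" where
  "mean_sq_error kl M X Y pX pY e n =
     (\<integral>\<omega>. (Q_tilde kl X Y e n \<omega> - q_kl kl pX pY)\<^sup>2 \<partial>M)"

text \<open>
  Slow variation of \<open>L(n)\<close>, \<open>n \<ge> 1\<close>, in the sense of Karamata, for a function of an integer argument
  (Bojanic and Seneta). By their theorem this holds iff \<open>x \<mapsto> L(\<lfloor>x\<rfloor>)\<close> is a slowly varying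
  (measurable) function on \<open>[1, \<infinity>)\<close>, equivalently iff \<open>L\<close> is the restriction to the integers of such
  a function.
\<close>

definition slowly_varying :: "(nat \<Rightarrow> real) \<Rightarrow> bool" where
  "slowly_varying L \<longleftrightarrow>
     (\<forall>n\<ge>1. 0 < L n) \<and>
     (\<forall>t>0. (\<lambda>n. L (nat \<lfloor>t * real n\<rfloor>) / L n) \<longlonglongrightarrow> 1)"

end

theory Submission
  imports Defs "HOL-Real_Asymp.Real_Asymp"
begin

text \<open>
  Both estimators are averages, over pairs of indices, of the bounded kernel
  \<open>h (x, y) = I (d (x, y) \<le> \<epsilon>) / b\<close> with \<open>b\<close> the volume of an \<open>\<epsilon>\<close>-ball.  With \<open>Z\<^sub>i = (X\<^sub>i, Y\<^sub>i)\<close> they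
  are, up to the diagonal, \<open>V = n\<^sup>-\<^sup>2 \<Sum>\<^sub>i \<Sum>\<^sub>j H (Z\<^sub>i, Z\<^sub>j)\<close>: for \<open>(k, l) = (1, 1)\<close> the kernel compares
  \<open>X\<^sub>i\<close> with \<open>Y\<^sub>j\<close> and \<open>V\<close> is the estimator; for \<open>(2, 0)\<close> it compares \<open>X\<^sub>i\<close> with \<open>X\<^sub>j\<close> and the estimator is
  \<open>n / (n - 1) (V - 1 / (n b))\<close>.  The Hoeffding decomposition splits \<open>V\<close> into
  \<open>\<theta> + (2 / n) \<Sum>\<^sub>i G (Z\<^sub>i) + n\<^sup>-\<^sup>2 \<Sum>\<^sub>i \<Sum>\<^sub>j r (Z\<^sub>i, Z\<^sub>j)\<close>, and the three terms are treated separately.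

  The degenerate part is small.  Integrated over either argument \<open>r\<close> vanishes, so the product
  \<open>r (Z\<^sub>i, Z\<^sub>j) r (Z\<^sub>k, Z\<^sub>l)\<close> has mean zero as soon as one of \<open>i, j\<close> is more than \<open>m\<close> away from the other
  three indices (\<open>r_cross_eq_0\<close>).  Only \<open>O (n\<^sup>2)\<close> quadruples with \<open>|i - j| > m\<close> and \<open>|k - l| > m\<close> survive;
  the \<open>O (n)\<close> pairs with \<open>|i - j| \<le> m\<close>, about whose joint law nothing is known, are bounded trivially.
  Since \<open>|r| \<le> 4 / b\<close> the second moment of this part is \<open>O (1 / (n b)\<^sup>2)\<close>
  (\<open>degenerate_second_moment\<close>).

  The linear part is a sum of an \<open>m\<close>-dependent sequence, so its second moment is
  \<open>4 s / n + O (n\<^sup>-\<^sup>2)\<close>, where \<open>s\<close> is the long-run variance of \<open>G\<close> (\<open>second_moment_sum_approx\<close>).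
  Here \<open>G\<close> is built from the averages of the densities over \<open>\<epsilon>\<close>-balls.  The cubes of the densities being
  integrable, \<open>s\<close> stays bounded; and because translations are continuous in the mean of order three, \<open>G\<close> converges in mean square and
  \<open>s\<close> tends to \<open>\<sigma>\<^sup>2\<close> (\<open>long_run_variance_tendsto\<close>).

  The bias \<open>\<theta> - q\<close> is an average over \<open>|h| \<le> \<epsilon>\<close> of \<open>-(1/2) \<integral> \<Delta>\<^sub>h p\<^sub>X \<Delta>\<^sub>h p\<^sub>Y\<close>, where
  \<open>\<Delta>\<^sub>h p (x) = p (x + h) - p (x)\<close>; the average of \<open>h\<close> and \<open>-h\<close> is what makes both differences appear.
  Hence it tends to zero, and is \<open>O (\<epsilon>\<^sup>2\<^sup>\<alpha>)\<close> for densities in the smoothness class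
  (\<open>smoothing_bias_le\<close>).

  Altogether, up to a mixed term handled by Cauchy-Schwarz, the mean square error is \<open>4 s / n\<close> plus terms
  controlled by \<open>(\<theta> - q)\<^sup>2\<close>, \<open>1 / (n \<epsilon>\<^sup>d)\<^sup>2\<close> and \<open>1 / n\<^sup>2\<close>, and the three claims follow by inserting the bandwidth (\<open>consistency\<close>, \<open>smooth_rate\<close>,
  \<open>parametric_rate\<close>).
\<close>

section \<open>Square-integrable functions\<close>

lemma square_diff_le: "(a - b)\<^sup>2 \<le> 2 * a\<^sup>2 + 2 * b\<^sup>2" for a b :: real
  using zero_le_power2[of "a + b"] by (simp add: power2_eq_square algebra_simps)

text \<open>
  The quadratic \<open>t \<mapsto> \<integral> (f - t g)\<^sup>2\<close> is nonnegative, so its discriminant is not positive.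
\<close>

lemma Cauchy_Schwarz_integral:
  fixes f g :: "'w \<Rightarrow> real"
  assumes [measurable]: "f \<in> borel_measurable M" "g \<in> borel_measurable M"
    and f2: "integrable M (\<lambda>x. (f x)\<^sup>2)" and g2: "integrable M (\<lambda>x. (g x)\<^sup>2)"
  shows "integrable M (\<lambda>x. f x * g x)"
    and "\<bar>\<integral>x. f x * g x \<partial>M\<bar> \<le> sqrt (\<integral>x. (f x)\<^sup>2 \<partial>M) * sqrt (\<integral>x. (g x)\<^sup>2 \<partial>M)"
proof -
  have "\<bar>f x * g x\<bar> \<le> (f x)\<^sup>2 + (g x)\<^sup>2" for x
  proof -
    have "2 * \<bar>f x * g x\<bar> \<le> (f x)\<^sup>2 + (g x)\<^sup>2"
      using sum_squares_bound[of "\<bar>f x\<bar>" "\<bar>g x\<bar>"] by (simp add: abs_mult)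
    then show ?thesis using abs_ge_zero[of "f x * g x"] by linarith
  qed
  then show fg: "integrable M (\<lambda>x. f x * g x)"
    by (intro Bochner_Integration.integrable_bound[OF Bochner_Integration.integrable_add[OF f2 g2]]) auto
  define a b c where "a = (\<integral>x. (f x)\<^sup>2 \<partial>M)" and "b = (\<integral>x. f x * g x \<partial>M)" and "c = (\<integral>x. (g x)\<^sup>2 \<partial>M)"
  have a: "0 \<le> a" and c: "0 \<le> c" by (simp_all add: a_def c_def)
  have quad: "0 \<le> a - 2 * t * b + t\<^sup>2 * c" for t
  proof -
    have "0 \<le> (\<integral>x. (f x - t * g x)\<^sup>2 \<partial>M)" by simp
    also have "\<dots> = (\<integral>x. (f x)\<^sup>2 - 2 * t * (f x * g x) + t\<^sup>2 * (g x)\<^sup>2 \<partial>M)"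
      by (intro Bochner_Integration.integral_cong) (auto simp: power2_eq_square algebra_simps)
    also have "\<dots> = a - 2 * t * b + t\<^sup>2 * c" using f2 g2 fg by (simp add: a_def b_def c_def)
    finally show ?thesis .
  qed
  have "b\<^sup>2 \<le> a * c"
  proof (cases "c = 0")
    case True
    have "b = 0"
    proof (rule ccontr)
      assume "b \<noteq> 0"
      then show False using quad[of "(a + 1) / (2 * b)"] True by simp
    qed
    then show ?thesis using True by simp
  next
    case False
    then show ?thesis using quad[of "b / c"] c by (simp add: field_simps power2_eq_square)
  qed
  then have "sqrt (b\<^sup>2) \<le> sqrt (a * c)" by (rule real_sqrt_le_mono)
  then show "\<bar>\<integral>x. f x * g x \<partial>M\<bar> \<le> sqrt (\<integral>x. (f x)\<^sup>2 \<partial>M) * sqrt (\<integral>x. (g x)\<^sup>2 \<partial>M)"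
    by (simp add: real_sqrt_mult a_def b_def c_def)
qed

lemma integrable_square_diff:
  fixes a b :: "'w \<Rightarrow> real"
  assumes [measurable]: "a \<in> borel_measurable M" "b \<in> borel_measurable M"
    and "integrable M (\<lambda>x. (a x)\<^sup>2)" "integrable M (\<lambda>x. (b x)\<^sup>2)"
  shows "integrable M (\<lambda>x. (a x - b x)\<^sup>2)"
  by (rule Bochner_Integration.integrable_bound[of _ "\<lambda>x. 2 * (a x)\<^sup>2 + 2 * (b x)\<^sup>2"])
     (use assms square_diff_le in auto)

lemma integrable_square_add:
  fixes a b :: "'w \<Rightarrow> real"
  assumes [measurable]: "a \<in> borel_measurable M" "b \<in> borel_measurable M"
    and "integrable M (\<lambda>x. (a x)\<^sup>2)" "integrable M (\<lambda>x. (b x)\<^sup>2)"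
  shows "integrable M (\<lambda>x. (a x + b x)\<^sup>2)"
  using integrable_square_diff[of a M "\<lambda>x. - b x"] assms by simp

text \<open>
  Continuity of the inner product in mean square; it carries convergence of the scores over to
  their autocovariances.
\<close>

lemma integral_mult_tendsto_of_L2:
  fixes A B :: "'e \<Rightarrow> 'w \<Rightarrow> real" and a b :: "'w \<Rightarrow> real"
  assumes meas [measurable]: "\<And>e. A e \<in> borel_measurable M" "\<And>e. B e \<in> borel_measurable M"
      "a \<in> borel_measurable M" "b \<in> borel_measurable M"
    and int: "\<And>e. integrable M (\<lambda>x. (A e x)\<^sup>2)" "\<And>e. integrable M (\<lambda>x. (B e x)\<^sup>2)"
      "integrable M (\<lambda>x. (a x)\<^sup>2)" "integrable M (\<lambda>x. (b x)\<^sup>2)"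
    and lim: "((\<lambda>e. \<integral>x. (A e x - a x)\<^sup>2 \<partial>M) \<longlongrightarrow> 0) F" "((\<lambda>e. \<integral>x. (B e x - b x)\<^sup>2 \<partial>M) \<longlongrightarrow> 0) F"
  shows "((\<lambda>e. \<integral>x. A e x * B e x \<partial>M) \<longlongrightarrow> (\<integral>x. a x * b x \<partial>M)) F"
proof -
  define \<alpha> where "\<alpha> e = (\<integral>x. (A e x - a x)\<^sup>2 \<partial>M)" for e
  define \<beta> where "\<beta> e = (\<integral>x. (B e x - b x)\<^sup>2 \<partial>M)" for e
  define a2 b2 where "a2 = (\<integral>x. (a x)\<^sup>2 \<partial>M)" and "b2 = (\<integral>x. (b x)\<^sup>2 \<partial>M)"
  have dA: "integrable M (\<lambda>x. (A e x - a x)\<^sup>2)" and dB: "integrable M (\<lambda>x. (B e x - b x)\<^sup>2)" for e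
    by (intro integrable_square_diff meas int)+
  have bound: "\<bar>(\<integral>x. A e x * B e x \<partial>M) - (\<integral>x. a x * b x \<partial>M)\<bar>
      \<le> sqrt (\<alpha> e) * sqrt (\<beta> e) + sqrt a2 * sqrt (\<beta> e) + sqrt (\<alpha> e) * sqrt b2" for e
  proof -
    note 1 = Cauchy_Schwarz_integral[OF _ _ dA[of e] dB[of e]]
    note 2 = Cauchy_Schwarz_integral[OF _ _ int(3) dB[of e]]
    note 3 = Cauchy_Schwarz_integral[OF _ _ dA[of e] int(4)]
    note ab = Cauchy_Schwarz_integral(1)[OF _ _ int(3) int(4)]
    have "(\<integral>x. A e x * B e x \<partial>M)
        = (\<integral>x. (A e x - a x) * (B e x - b x) + a x * (B e x - b x) + (A e x - a x) * b x + a x * b x \<partial>M)"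
      by (intro Bochner_Integration.integral_cong) (auto simp: algebra_simps)
    also have "\<dots> = (\<integral>x. (A e x - a x) * (B e x - b x) \<partial>M) + (\<integral>x. a x * (B e x - b x) \<partial>M)
        + (\<integral>x. (A e x - a x) * b x \<partial>M) + (\<integral>x. a x * b x \<partial>M)"
      using 1(1) 2(1) 3(1) ab by (simp add: meas)
    finally show ?thesis
      using 1(2) 2(2) 3(2) by (simp add: meas \<alpha>_def \<beta>_def a2_def b2_def)
  qed
  have "((\<lambda>e. sqrt (\<alpha> e) * sqrt (\<beta> e) + sqrt a2 * sqrt (\<beta> e) + sqrt (\<alpha> e) * sqrt b2)
      \<longlongrightarrow> sqrt 0 * sqrt 0 + sqrt a2 * sqrt 0 + sqrt 0 * sqrt b2) F"
    using lim unfolding \<alpha>_def \<beta>_def by (intro tendsto_intros)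
  then have "((\<lambda>e. sqrt (\<alpha> e) * sqrt (\<beta> e) + sqrt a2 * sqrt (\<beta> e) + sqrt (\<alpha> e) * sqrt b2) \<longlongrightarrow> 0) F"
    by simp
  then have "((\<lambda>e. (\<integral>x. A e x * B e x \<partial>M) - (\<integral>x. a x * b x \<partial>M)) \<longlongrightarrow> 0) F"
    by (rule Lim_null_comparison[rotated]) (use bound in auto)
  then show ?thesis by (simp add: LIM_zero_iff)
qed

text \<open>
  Jensen for the square.  Stated with a nonnegative integral on the right it also covers functions
  whose square, or which themselves, are not integrable.
\<close>

lemma (in prob_space) nn_jensen_square:
  assumes [measurable]: "f \<in> borel_measurable M"
  shows "ennreal ((\<integral>x. f x \<partial>M)\<^sup>2) \<le> (\<integral>\<^sup>+x. ennreal ((f x)\<^sup>2) \<partial>M)"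
proof (cases "integrable M f \<and> (\<integral>\<^sup>+x. ennreal ((f x)\<^sup>2) \<partial>M) \<noteq> \<infinity>")
  case True
  then have i2: "integrable M (\<lambda>x. (f x)\<^sup>2)" by (intro integrableI_nonneg) (auto simp: top.not_eq_extremum)
  have "0 \<le> variance f" by simp
  also have "\<dots> = expectation (\<lambda>x. (f x)\<^sup>2) - (expectation f)\<^sup>2"
    using True i2 by (intro variance_eq) auto
  finally show ?thesis using i2 by (simp add: nn_integral_eq_integral ennreal_leI)
next
  case False
  then show ?thesis by (auto simp: not_integrable_integral_eq)
qed

lemma integrable_and_integral_le:
  fixes h :: "'w \<Rightarrow> real"
  assumes [measurable]: "h \<in> borel_measurable M" and nn: "\<And>x. 0 \<le> h x" and c: "0 \<le> c"
    and le: "(\<integral>\<^sup>+x. ennreal (h x) \<partial>M) \<le> ennreal c"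
  shows "integrable M h" "(\<integral>x. h x \<partial>M) \<le> c"
proof -
  show i: "integrable M h"
    using nn le by (intro integrableI_nonneg) (auto intro: order.strict_trans1)
  then have "ennreal (\<integral>x. h x \<partial>M) \<le> ennreal c"
    using nn le by (simp add: nn_integral_eq_integral)
  then show "(\<integral>x. h x \<partial>M) \<le> c" using c by (simp add: ennreal_le_iff)
qed

section \<open>Continuity of translations\<close>

lemma integrable_lborel_translate:
  fixes f :: "'a::euclidean_space \<Rightarrow> real"
  assumes "integrable lborel f"
  shows "integrable lborel (\<lambda>x. f (x - h))"
proof -
  have "integrable (distr lborel borel (\<lambda>x. -h + x)) f"
    by (subst lborel_distr_plus) (rule assms)
  then show ?thesis
    by (subst (asm) integrable_distr_eq) (use assms in auto)
qed

lemma integral_lborel_translate: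
  fixes f :: "'a::euclidean_space \<Rightarrow> real"
  assumes [measurable]: "f \<in> borel_measurable borel"
  shows "(\<integral>x. f (x - h) \<partial>lborel) = (\<integral>x. f x \<partial>lborel)"
proof -
  have "(\<integral>x. f x \<partial>lborel) = (\<integral>x. f x \<partial>distr lborel borel (\<lambda>x. -h + x))"
    using lborel_distr_plus[of "-h"] assms by (simp del: add_uminus_conv_diff uminus_add_conv_diff)
  then show ?thesis
    by (subst (asm) integral_distr) auto
qed

text \<open>
  The modulus of continuity of translations in the mean.
\<close>

definition L1_modulus :: "('a::euclidean_space \<Rightarrow> real) \<Rightarrow> 'a \<Rightarrow> real" where
  "L1_modulus f h = (\<integral>x. \<bar>f (x - h) - f x\<bar> \<partial>lborel)"

lemma L1_modulus_nonneg: "0 \<le> L1_modulus f h"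
  by (simp add: L1_modulus_def)

lemma L1_modulus_perturb:
  assumes f: "integrable lborel f" and g: "integrable lborel g"
  shows "L1_modulus f h \<le> L1_modulus g h + 2 * (\<integral>x. \<bar>f x - g x\<bar> \<partial>lborel)"
proof -
  note [measurable] = borel_measurable_integrable[OF f, simplified] borel_measurable_integrable[OF g, simplified]
  note tr = integrable_lborel_translate[OF f, of h] integrable_lborel_translate[OF g, of h]
  have d: "integrable lborel (\<lambda>x. \<bar>f x - g x\<bar>)" using f g by auto
  have "L1_modulus f h \<le> (\<integral>x. \<bar>g (x - h) - g x\<bar> + (\<bar>f (x - h) - g (x - h)\<bar> + \<bar>f x - g x\<bar>) \<partial>lborel)"
    unfolding L1_modulus_def
    using f g tr by (intro integral_mono integrable_abs Bochner_Integration.integrable_diff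
      Bochner_Integration.integrable_add) auto
  also have "\<dots> = L1_modulus g h + ((\<integral>x. \<bar>f (x - h) - g (x - h)\<bar> \<partial>lborel) + (\<integral>x. \<bar>f x - g x\<bar> \<partial>lborel))"
    unfolding L1_modulus_def using f g tr by simp
  also have "(\<integral>x. \<bar>f (x - h) - g (x - h)\<bar> \<partial>lborel) = (\<integral>x. \<bar>f x - g x\<bar> \<partial>lborel)"
    by (rule integral_lborel_translate[where f="\<lambda>x. \<bar>f x - g x\<bar>"]) measurable
  finally show ?thesis by simp
qed

text \<open>
  The set of functions on which translations are continuous is closed in the mean, because
  translation is an isometry.  This reduces the general case to indicators of open sets.
\<close>

lemma L1_modulus_limit:
  assumes f: "integrable lborel f" 
    and approx: "\<And>e. 0 < e \<Longrightarrow> \<exists>g. integrable lborel g \<and> (L1_modulus g \<longlongrightarrow> 0) (nhds 0) \<and> (\<integral>x. \<bar>f x - g x\<bar> \<partial>lborel) < e"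
  shows "(L1_modulus f \<longlongrightarrow> 0) (nhds 0)"
proof (rule tendstoI)
  fix e :: real assume "0 < e"
  then obtain g where g: "integrable lborel g" "(L1_modulus g \<longlongrightarrow> 0) (nhds 0)"
    "(\<integral>x. \<bar>f x - g x\<bar> \<partial>lborel) < e / 4" using approx[of "e/4"] by auto
  have "eventually (\<lambda>h. dist (L1_modulus g h) 0 < e / 2) (nhds 0)"
    using g(2) \<open>0 < e\<close> by (intro tendstoD) auto
  then show "eventually (\<lambda>h. dist (L1_modulus f h) 0 < e) (nhds 0)"
  proof eventually_elim
    case (elim h)
    then show ?case using L1_modulus_perturb[OF f g(1), of h] g(3) L1_modulus_nonneg[of f h] by simp
  qed
qed

text \<open>
  A set and its translate have the same measure, so the symmetric difference is twice the part of
  \<open>U\<close> that leaves \<open>U\<close>.  For open \<open>U\<close> that part shrinks pointwise to nothing.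
\<close>

lemma L1_modulus_open:
  assumes U: "open U" "emeasure lborel U < \<infinity>"
  shows "(L1_modulus (indicator U) \<longlongrightarrow> 0) (nhds (0::'a::euclidean_space))"
proof -
  have [measurable]: "U \<in> sets borel" using U by auto
  have iU: "integrable lborel (indicator U :: 'a \<Rightarrow> real)" using U by simp
  have eq: "L1_modulus (indicator U) h = 2 * (\<integral>x. indicator U x * (1 - indicator U (x - h)) \<partial>lborel)" for h :: 'a
  proof -
    have i2: "integrable lborel (\<lambda>x. indicator U (x - h) :: real)"
      using integrable_lborel_translate[OF iU] .
    have i3: "integrable lborel (\<lambda>x. indicator U x * indicator U (x - h) :: real)"
      by (rule Bochner_Integration.integrable_bound[OF iU]) (auto simp: indicator_def)
    have "\<bar>indicator U (x - h) - indicator U x\<bar> =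
      indicator U (x - h) + indicator U x - 2 * (indicator U x * indicator U (x - h) :: real)" for x
      by (auto simp: indicator_def)
    then have "L1_modulus (indicator U) h = (\<integral>x. indicator U (x - h) \<partial>lborel) + (\<integral>x. indicator U x \<partial>lborel)
      - 2 * (\<integral>x. indicator U x * indicator U (x - h) \<partial>lborel)"
      unfolding L1_modulus_def using iU i2 i3 by simp
    also have "(\<integral>x. indicator U (x - h) \<partial>lborel) = (\<integral>x. indicator U x \<partial>lborel :: real)"
      by (rule integral_lborel_translate) measurable
    finally show ?thesis using iU i3 by (simp add: algebra_simps)
  qed
  have "L1_modulus (indicator U) \<midarrow>0\<rightarrow> (0::real)"
    unfolding tendsto_at_iff_sequentially comp_def
  proof (intro allI impI)
    fix X :: "nat \<Rightarrow> 'a" assume "X \<longlonglongrightarrow> 0"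
    have "(\<lambda>i. \<integral>x. indicator U x * (1 - indicator U (x - X i)) \<partial>lborel :: real) \<longlonglongrightarrow> (\<integral>x. 0 \<partial>(lborel::'a measure))"
    proof (rule integral_dominated_convergence[where w="indicator U"])
      show "AE x in lborel. (\<lambda>i. indicator U x * (1 - indicator U (x - X i)) :: real) \<longlonglongrightarrow> 0"
      proof (rule AE_I2)
        fix x
        show "(\<lambda>i. indicator U x * (1 - indicator U (x - X i)) :: real) \<longlonglongrightarrow> 0"
        proof (cases "x \<in> U")
          case True
          have "(\<lambda>i. x - X i) \<longlonglongrightarrow> x" using tendsto_diff[OF tendsto_const \<open>X \<longlonglongrightarrow> 0\<close>, of x] by simp
          then have "eventually (\<lambda>i. x - X i \<in> U) sequentially"
            using U(1) True by (rule topological_tendstoD)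
          then have "eventually (\<lambda>i. indicator U x * (1 - indicator U (x - X i)) = (0::real)) sequentially"
            by eventually_elim simp
          then show ?thesis by (rule tendsto_eventually)
        qed simp
      qed
    qed (use iU in \<open>auto simp: indicator_def\<close>)
    from tendsto_mult_left[OF this, of 2]
    show "(\<lambda>i. L1_modulus (indicator U) (X i)) \<longlonglongrightarrow> 0" unfolding eq by simp
  qed
  moreover have "L1_modulus (indicator U) (0::'a) = 0" by (simp add: L1_modulus_def)
  ultimately show ?thesis by (metis tendsto_at_iff_tendsto_nhds)
qed

lemma L1_modulus_scale: "L1_modulus (\<lambda>x. f x * c) h = L1_modulus f h * \<bar>c\<bar>"
  by (simp add: L1_modulus_def left_diff_distrib[symmetric] abs_mult)

text \<open>
  Outer regularity approximates the set by an open one.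
\<close>

lemma L1_modulus_borel_set:
  fixes A :: "'a::euclidean_space set"
  assumes [measurable]: "A \<in> sets borel" and fin: "emeasure lborel A < \<infinity>"
  shows "(L1_modulus (indicator A) \<longlongrightarrow> 0) (nhds (0::'a))"
proof (rule L1_modulus_limit)
  show "integrable lborel (indicator A :: 'a \<Rightarrow> real)" using fin by simp
  fix e :: real assume "0 < e"
  obtain U where U: "open U" "A \<subseteq> U" "emeasure lborel (U - A) < e"
    using outer_regular_lborel[OF assms(1) \<open>0 < e\<close>] by blast
  have [measurable]: "U \<in> sets borel" using U by auto
  have "emeasure lborel U \<le> emeasure lborel A + emeasure lborel (U - A)"
    using emeasure_subadditive[of A lborel "U - A"] U(2) by (simp add: Un_absorb1)
  also have "\<dots> < \<infinity>"
    using fin order.strict_trans[OF U(3) ennreal_less_top] by simp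
  finally have finU: "emeasure lborel U < \<infinity>" .
  have "(\<integral>x. \<bar>indicator A x - indicator U x\<bar> \<partial>lborel) = (\<integral>x. indicator (U - A) x \<partial>lborel :: real)"
    using U(2) by (intro Bochner_Integration.integral_cong) (auto simp: indicator_def)
  also have "\<dots> = measure lborel (U - A)" by simp
  also have "\<dots> < e"
    using enn2real_less_iff[OF order.strict_trans[OF U(3) ennreal_less_top]] U(3) \<open>0 < e\<close>
    by (simp add: measure_def)
  finally show "\<exists>g. integrable lborel g \<and> (L1_modulus g \<longlongrightarrow> 0) (nhds 0) \<and> (\<integral>x. \<bar>indicator A x - g x\<bar> \<partial>lborel) < e"
    using L1_modulus_open[OF U(1) finU] finU by (intro exI[of _ "indicator U"]) auto
qed

proposition L1_modulus_tendsto_0: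
  fixes f :: "'a::euclidean_space \<Rightarrow> real"
  assumes "integrable lborel f"
  shows "(L1_modulus f \<longlongrightarrow> 0) (nhds 0)"
  using assms
proof (induct rule: integrable_induct)
  case (base A c)
  then have "(L1_modulus (indicator A) \<longlongrightarrow> 0) (nhds (0::'a))" by (intro L1_modulus_borel_set) auto
  from tendsto_mult_right[OF this, of "\<bar>c\<bar>"] show ?case
    by (simp add: L1_modulus_scale)
next
  case (add f g)
  note i = integrable_lborel_translate[OF add(1)] integrable_lborel_translate[OF add(3)]
  have "L1_modulus (\<lambda>x. f x + g x) h \<le> L1_modulus f h + L1_modulus g h" for h
  proof -
    have "L1_modulus (\<lambda>x. f x + g x) h \<le> (\<integral>x. \<bar>f (x - h) - f x\<bar> + \<bar>g (x - h) - g x\<bar> \<partial>lborel)"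
      unfolding L1_modulus_def using add(1,3) i by (intro integral_mono) auto
    also have "\<dots> = L1_modulus f h + L1_modulus g h"
      unfolding L1_modulus_def using add(1,3) i by simp
    finally show ?thesis .
  qed
  then have "eventually (\<lambda>h. L1_modulus (\<lambda>x. f x + g x) h \<le> L1_modulus f h + L1_modulus g h) (nhds 0)"
    by (rule always_eventually[OF allI])
  moreover have "((\<lambda>h. L1_modulus f h + L1_modulus g h) \<longlongrightarrow> 0) (nhds 0)"
    using tendsto_add[OF add(2) add(4)] by simp
  ultimately show ?case
    by (rule tendsto_sandwich[OF always_eventually[OF allI[OF L1_modulus_nonneg]] _ tendsto_const])
next
  case (lim f s)
  show ?case
  proof (rule L1_modulus_limit[OF lim(5)])
    fix e :: real assume "0 < e"
    have "(\<lambda>i. \<integral>x. \<bar>f x - s i x\<bar> \<partial>lborel) \<longlonglongrightarrow> (\<integral>x. 0 \<partial>(lborel::'a measure))"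
    proof (rule integral_dominated_convergence[where w="\<lambda>x. 3 * \<bar>f x\<bar>"])
      show "AE x in lborel. (\<lambda>i. \<bar>f x - s i x\<bar>) \<longlonglongrightarrow> 0"
      proof (rule AE_I2)
        fix x :: 'a
        have "(\<lambda>i. \<bar>f x - s i x\<bar>) \<longlonglongrightarrow> \<bar>f x - f x\<bar>"
          by (intro tendsto_rabs tendsto_diff tendsto_const lim(3)) simp
        then show "(\<lambda>i. \<bar>f x - s i x\<bar>) \<longlonglongrightarrow> 0" by simp
      qed
      show "AE x in lborel. norm \<bar>f x - s i x\<bar> \<le> 3 * \<bar>f x\<bar>" for i
      proof (rule AE_I2)
        fix x show "norm \<bar>f x - s i x\<bar> \<le> 3 * \<bar>f x\<bar>" using lim(4)[of x i] by simp
      qed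
    qed (use lim(1,5) in auto)
    then have "eventually (\<lambda>i. dist (\<integral>x. \<bar>f x - s i x\<bar> \<partial>lborel) 0 < e) sequentially"
      using \<open>0 < e\<close> by (intro tendstoD) simp
    then obtain i where "dist (\<integral>x. \<bar>f x - s i x\<bar> \<partial>lborel) 0 < e" 
      by (auto dest: eventually_happens)
    then show "\<exists>g. integrable lborel g \<and> (L1_modulus g \<longlongrightarrow> 0) (nhds 0) \<and> (\<integral>x. \<bar>f x - g x\<bar> \<partial>lborel) < e"
      using lim(1,2) by (intro exI[of _ "s i"]) auto
  qed
qed

text \<open>
  Superadditivity of the power function on the nonnegative reals.
\<close>

lemma abs_diff_power_le:
  fixes a b :: real
  assumes "0 \<le> a" "0 \<le> b" "1 \<le> r"
  shows "\<bar>a - b\<bar> ^ r \<le> \<bar>a ^ r - b ^ r\<bar>"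
proof -
  have super: "x ^ r + y ^ r \<le> (x + y) ^ r" if "0 \<le> x" "0 \<le> y" for x y :: real
    using \<open>1 \<le> r\<close>
  proof (induction r rule: dec_induct)
    case (step n)
    have "x ^ Suc n + y ^ Suc n \<le> (x ^ n + y ^ n) * (x + y)"
      using that by (simp add: algebra_simps)
    also have "\<dots> \<le> (x + y) ^ n * (x + y)"
      using step that by (intro mult_right_mono) auto
    finally show ?case by (simp add: mult.commute)
  qed simp
  show ?thesis
  proof (cases "a \<le> b")
    case True
    then show ?thesis using super[of "b - a" a] assms power_mono[of a b r] by simp
  next
    case False
    then show ?thesis using super[of "a - b" b] assms power_mono[of b a r] by simp
  qed
qed

text \<open>
  By \<open>abs_diff_power_le\<close> the \<open>r\<close>-th mean of a difference of translates of \<open>f\<close> is at most the first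
  mean for \<open>f ^ r\<close>, so the case \<open>r = 1\<close> is enough.
\<close>

proposition Lr_translation_continuous:
  fixes f :: "'a::euclidean_space \<Rightarrow> real"
  assumes [measurable]: "f \<in> borel_measurable borel" and nn: "\<And>x. 0 \<le> f x"
    and r: "1 \<le> r" and int: "integrable lborel (\<lambda>x. f x ^ r)"
  shows "((\<lambda>h. \<integral>x. \<bar>f (x - h) - f x\<bar> ^ r \<partial>lborel) \<longlongrightarrow> 0) (nhds 0)"
proof (rule tendsto_sandwich[OF _ _ tendsto_const L1_modulus_tendsto_0[OF int]])
  show "\<forall>\<^sub>F h in nhds 0. (\<integral>x. \<bar>f (x - h) - f x\<bar> ^ r \<partial>lborel) \<le> L1_modulus (\<lambda>x. f x ^ r) h"
    unfolding L1_modulus_def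
    using abs_diff_power_le[OF nn nn r] integrable_lborel_translate[OF int] int
    by (intro always_eventually allI integral_mono') auto
qed auto

section \<open>Averages over small balls\<close>

text \<open>
  The uniform distribution on the ball, written as a density so that integrals against it turn
  directly into integrals of the counting kernel against Lebesgue measure.
\<close>

definition ball_unif :: "real \<Rightarrow> 'a::euclidean_space measure" where
  "ball_unif e = density lborel (\<lambda>h. ennreal (of_bool (norm h \<le> e) / measure lborel (cball (0::'a) e)))"

definition ball_avg :: "real \<Rightarrow> ('a::euclidean_space \<Rightarrow> real) \<Rightarrow> 'a \<Rightarrow> real" where
  "ball_avg e f x = (\<integral>h. f (x + h) \<partial>ball_unif e)"

lemma sets_ball_unif [simp, measurable_cong]: "sets (ball_unif e) = sets borel"
  by (simp add: ball_unif_def)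

lemma space_ball_unif [simp]: "space (ball_unif e) = UNIV"
  by (simp add: ball_unif_def)

lemma AE_ball_unif: "AE h in ball_unif e. norm h \<le> e"
  unfolding ball_unif_def by (subst AE_density) (auto simp: of_bool_def)

lemma prob_space_ball_unif:
  assumes "0 < e"
  shows "prob_space (ball_unif e :: 'a::euclidean_space measure)"
proof
  let ?b = "measure lborel (cball (0::'a) e)"
  have b: "0 < ?b" using assms by (simp add: content_cball_pos)
  have "emeasure (ball_unif e :: 'a measure) UNIV = (\<integral>\<^sup>+h. ennreal (1 / ?b) * indicator (cball (0::'a) e) h \<partial>lborel)"
    unfolding ball_unif_def
    by (subst emeasure_density) (auto intro!: nn_integral_cong simp: indicator_def)
  also have "\<dots> = ennreal (1 / ?b) * emeasure lborel (cball (0::'a) e)"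
    by (subst nn_integral_cmult_indicator) auto
  also have "\<dots> = ennreal (1 / ?b) * ennreal ?b"
    using emeasure_lborel_cball_finite[of "0::'a" e] by (subst emeasure_eq_ennreal_measure) auto
  also have "\<dots> = ennreal (1 / ?b * ?b)" using b by (subst ennreal_mult) auto
  also have "1 / ?b * ?b = 1" using b by simp
  finally show "emeasure (ball_unif e :: 'a measure) (space (ball_unif e)) = 1" by simp
qed

lemma integral_ball_unif:
  fixes f :: "'a::euclidean_space \<Rightarrow> real"
  assumes [measurable]: "f \<in> borel_measurable borel"
  shows "(\<integral>h. f h \<partial>ball_unif e) = (\<integral>h. of_bool (norm h \<le> e) / measure lborel (cball (0::'a) e) * f h \<partial>lborel)"
  unfolding ball_unif_def by (rule integral_real_density) auto

lemma integrable_ball_unif: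
  fixes f :: "'a::euclidean_space \<Rightarrow> real"
  assumes int: "integrable lborel f"
  shows "integrable (ball_unif e) f"
proof -
  note [measurable] = borel_measurable_integrable[OF int, simplified]
  let ?b = "measure lborel (cball (0::'a) e)"
  have "integrable lborel (\<lambda>h. of_bool (norm h \<le> e) / ?b * f h)"
    by (rule Bochner_Integration.integrable_bound[OF integrable_mult_right[OF int, of "1 / ?b"]])
       (auto simp: of_bool_def)
  then show ?thesis unfolding ball_unif_def by (subst integrable_real_density) auto
qed

lemma ball_avg_eq_kernel:
  fixes f :: "'a::euclidean_space \<Rightarrow> real"
  assumes [measurable]: "f \<in> borel_measurable borel"
  shows "ball_avg e f x = (\<integral>y. f y * (of_bool (dist x y \<le> e) / measure lborel (cball (0::'a) e)) \<partial>lborel)"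
proof -
  let ?k = "\<lambda>y. f y * (of_bool (dist x y \<le> e) / measure lborel (cball (0::'a) e))"
  have "ball_avg e f x = (\<integral>h. ?k (h - (- x)) \<partial>lborel)"
    unfolding ball_avg_def by (subst integral_ball_unif) (auto simp: dist_norm add.commute mult.commute)
  also have "\<dots> = (\<integral>y. ?k y \<partial>lborel)" by (rule integral_lborel_translate) measurable
  finally show ?thesis .
qed

lemma ball_avg_measurable [measurable]:
  fixes f :: "'a::euclidean_space \<Rightarrow> real"
  assumes [measurable]: "f \<in> borel_measurable borel" and "0 < e"
  shows "ball_avg e f \<in> borel_measurable borel"
proof -
  interpret U: prob_space "ball_unif e :: 'a measure" using \<open>0 < e\<close> by (rule prob_space_ball_unif)
  show ?thesis unfolding ball_avg_def[abs_def] by measurable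
qed

lemma nn_integral_ball_unif_le:
  fixes f :: "'a::euclidean_space \<Rightarrow> ennreal"
  assumes "0 < e" and le: "\<And>h. norm h \<le> e \<Longrightarrow> f h \<le> c"
  shows "(\<integral>\<^sup>+h. f h \<partial>ball_unif e) \<le> c"
proof -
  interpret U: prob_space "ball_unif e :: 'a measure" using \<open>0 < e\<close> by (rule prob_space_ball_unif)
  have "(\<integral>\<^sup>+h. f h \<partial>ball_unif e) \<le> (\<integral>\<^sup>+h. c \<partial>(ball_unif e :: 'a measure))"
    by (intro nn_integral_mono_AE eventually_mono[OF AE_ball_unif] le)
  then show ?thesis by (simp add: U.emeasure_space_1[simplified])
qed

text \<open>
  Jensen inside, then Tonelli: a bound that holds for every single shift passes to the average over
  shifts.
\<close>

lemma weighted_square_of_ball_average_le: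
  fixes f :: "'a::euclidean_space \<Rightarrow> real" and k :: "'a \<Rightarrow> 'a \<Rightarrow> real"
  assumes [measurable]: "f \<in> borel_measurable borel" "case_prod k \<in> borel_measurable (borel \<Otimes>\<^sub>M borel)"
    and nn: "\<And>x. 0 \<le> f x" and e: "0 < e"
    and le: "\<And>h. norm h \<le> e \<Longrightarrow> (\<integral>\<^sup>+x. ennreal (f x * (k x h)\<^sup>2) \<partial>lborel) \<le> c"
  shows "(\<integral>\<^sup>+x. ennreal (f x * (\<integral>h. k x h \<partial>ball_unif e)\<^sup>2) \<partial>lborel) \<le> c"
proof -
  interpret U: prob_space "ball_unif e :: 'a measure" using e by (rule prob_space_ball_unif)
  interpret P: pair_sigma_finite lborel "ball_unif e :: 'a measure" ..
  have "(\<integral>\<^sup>+x. ennreal (f x * (\<integral>h. k x h \<partial>ball_unif e)\<^sup>2) \<partial>lborel)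
      \<le> (\<integral>\<^sup>+x. (\<integral>\<^sup>+h. ennreal (f x * (k x h)\<^sup>2) \<partial>ball_unif e) \<partial>lborel)"
  proof (rule nn_integral_mono)
    fix x :: 'a
    have "ennreal (f x * (\<integral>h. k x h \<partial>ball_unif e)\<^sup>2) \<le> ennreal (f x) * (\<integral>\<^sup>+h. ennreal ((k x h)\<^sup>2) \<partial>ball_unif e)"
      using nn by (subst ennreal_mult) (auto intro!: mult_left_mono U.nn_jensen_square)
    also have "\<dots> = (\<integral>\<^sup>+h. ennreal (f x * (k x h)\<^sup>2) \<partial>ball_unif e)"
      using nn by (subst nn_integral_cmult[symmetric]) (auto simp: ennreal_mult)
    finally show "ennreal (f x * (\<integral>h. k x h \<partial>ball_unif e)\<^sup>2) \<le> \<dots>" .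
  qed
  also have "\<dots> = (\<integral>\<^sup>+h. (\<integral>\<^sup>+x. ennreal (f x * (k x h)\<^sup>2) \<partial>lborel) \<partial>ball_unif e)"
    by (rule P.Fubini'[symmetric]) measurable
  also have "\<dots> \<le> c" using e le by (rule nn_integral_ball_unif_le)
  finally show ?thesis .
qed

text \<open>
  A Young inequality in which the first cube gets an arbitrarily small weight.  Below, \<open>x\<close> is the
  fixed density and \<open>y\<close> the difference that becomes small.
\<close>

lemma mult_square_le_cubes:
  fixes x y \<eta> :: real
  assumes "0 \<le> x" "0 \<le> y" "0 < \<eta>" "\<eta> \<le> 1"
  shows "x * y\<^sup>2 \<le> \<eta> * x ^ 3 + y ^ 3 / \<eta>"
proof (cases "x \<le> y / \<eta>")
  case True
  have "x * y\<^sup>2 \<le> y / \<eta> * y\<^sup>2" using True by (intro mult_right_mono) auto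
  also have "\<dots> = y ^ 3 / \<eta>" by (simp add: power2_eq_square power3_eq_cube)
  finally show ?thesis using assms by (simp add: add_increasing)
next
  case False
  then have y: "y \<le> \<eta> * x" using assms by (simp add: field_simps)
  have "x * y\<^sup>2 \<le> x * (\<eta> * x)\<^sup>2" using y assms by (intro mult_left_mono power_mono) auto
  also have "\<dots> = \<eta>\<^sup>2 * x ^ 3" by (simp add: power2_eq_square power3_eq_cube)
  also have "\<dots> \<le> \<eta> * x ^ 3" using assms by (intro mult_right_mono) (auto simp: power2_eq_square mult_left_le_one_le)
  finally show ?thesis using assms by (simp add: add_increasing2)
qed

lemma nn_integral_mult_square_le_cubes:
  fixes f g :: "'a::euclidean_space \<Rightarrow> real"
  assumes [measurable]: "f \<in> borel_measurable borel" "g \<in> borel_measurable borel"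
    and nn: "\<And>x. 0 \<le> f x" and \<eta>: "0 < \<eta>" "\<eta> \<le> 1"
    and f3: "integrable lborel (\<lambda>x. f x ^ 3)" and g3: "integrable lborel (\<lambda>x. \<bar>g x\<bar> ^ 3)"
  shows "(\<integral>\<^sup>+x. ennreal (f x * (g x)\<^sup>2) \<partial>lborel)
    \<le> ennreal (\<eta> * (\<integral>x. f x ^ 3 \<partial>lborel) + (\<integral>x. \<bar>g x\<bar> ^ 3 \<partial>lborel) / \<eta>)"
proof -
  have "(\<integral>\<^sup>+x. ennreal (f x * (g x)\<^sup>2) \<partial>lborel) \<le> (\<integral>\<^sup>+x. ennreal (\<eta> * f x ^ 3 + \<bar>g x\<bar> ^ 3 / \<eta>) \<partial>lborel)"
    using mult_square_le_cubes[OF nn abs_ge_zero \<eta>] by (intro nn_integral_mono ennreal_leI) simp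
  also have "\<dots> = ennreal (\<integral>x. \<eta> * f x ^ 3 + \<bar>g x\<bar> ^ 3 / \<eta> \<partial>lborel)"
    using f3 g3 nn \<eta> by (intro nn_integral_eq_integral) auto
  finally show ?thesis using f3 g3 by simp
qed

lemma nn_integral_ball_avg_square_le:
  fixes f g :: "'a::euclidean_space \<Rightarrow> real"
  assumes [measurable]: "f \<in> borel_measurable borel" "g \<in> borel_measurable borel"
    and nn: "\<And>x. 0 \<le> f x" "\<And>x. 0 \<le> g x" and e: "0 < e"
    and f3: "integrable lborel (\<lambda>x. f x ^ 3)" and g3: "integrable lborel (\<lambda>x. g x ^ 3)"
  shows "(\<integral>\<^sup>+x. ennreal (f x * (ball_avg e g x)\<^sup>2) \<partial>lborel)
    \<le> ennreal ((\<integral>x. f x ^ 3 \<partial>lborel) + (\<integral>x. g x ^ 3 \<partial>lborel))"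
  unfolding ball_avg_def
proof (rule weighted_square_of_ball_average_le)
  fix h :: 'a
  have "integrable lborel (\<lambda>x. \<bar>g (x + h)\<bar> ^ 3)"
    using integrable_lborel_translate[OF g3, of "-h"] nn by simp
  moreover have "(\<integral>x. \<bar>g (x + h)\<bar> ^ 3 \<partial>lborel) = (\<integral>x. g x ^ 3 \<partial>lborel)"
    using integral_lborel_translate[of "\<lambda>x. g x ^ 3" "-h"] nn by simp
  ultimately show "(\<integral>\<^sup>+x. ennreal (f x * (g (x + h))\<^sup>2) \<partial>lborel)
    \<le> ennreal ((\<integral>x. f x ^ 3 \<partial>lborel) + (\<integral>x. g x ^ 3 \<partial>lborel))"
    using nn_integral_mult_square_le_cubes[of f "\<lambda>x. g (x + h)" 1] nn f3 by simp
qed (use nn e in auto)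

text \<open>
  Young's inequality splits the integrand into a small multiple of the cube of \<open>f\<close> and a large multiple
  of the third mean of a difference of translates of \<open>g\<close>, which vanishes with the shift.
\<close>

lemma nn_integral_ball_avg_diff_square_tendsto_0:
  fixes f g :: "'a::euclidean_space \<Rightarrow> real"
  assumes [measurable]: "f \<in> borel_measurable borel" "g \<in> borel_measurable borel"
    and nn: "\<And>x. 0 \<le> f x" "\<And>x. 0 \<le> g x" and g1: "integrable lborel g"
    and f3: "integrable lborel (\<lambda>x. f x ^ 3)" and g3: "integrable lborel (\<lambda>x. g x ^ 3)"
    and \<delta>: "0 < \<delta>"
  shows "\<exists>r>0. \<forall>e. 0 < e \<and> e < r \<longrightarrow>
    (\<integral>\<^sup>+x. ennreal (f x * (ball_avg e g x - g x)\<^sup>2) \<partial>lborel) \<le> ennreal \<delta>"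
proof -
  define I where "I = (\<integral>x. f x ^ 3 \<partial>lborel)"
  have I: "0 \<le> I" unfolding I_def using nn by (intro integral_nonneg_AE) auto
  \<comment> \<open>the weight for which the cube of \<open>f\<close> contributes at most half of \<open>\<delta>\<close>\<close>
  define \<eta> where "\<eta> = min 1 (\<delta> / (2 * (I + 1)))"
  have \<eta>: "0 < \<eta>" "\<eta> \<le> 1" "\<eta> * I \<le> \<delta> / 2"
  proof -
    have "\<eta> * I \<le> \<delta> / (2 * (I + 1)) * I" using I by (intro mult_right_mono) (auto simp: \<eta>_def)
    also have "\<dots> \<le> \<delta> / 2" using I \<delta> by (simp add: field_simps)
    finally show "\<eta> * I \<le> \<delta> / 2" .
  qed (use I \<delta> in \<open>auto simp: \<eta>_def\<close>)
  have "((\<lambda>h. \<integral>x. \<bar>g (x - h) - g x\<bar> ^ 3 \<partial>lborel) \<longlongrightarrow> 0) (nhds 0)"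
    using g3 nn by (intro Lr_translation_continuous) auto
  then have "eventually (\<lambda>h. dist (\<integral>x. \<bar>g (x - h) - g x\<bar> ^ 3 \<partial>lborel) 0 < \<eta> * \<delta> / 2) (nhds 0)"
    using \<eta> \<delta> by (intro tendstoD) auto
  then obtain r where r: "r > 0" "\<And>h. norm h < r \<Longrightarrow> dist (\<integral>x. \<bar>g (x - h) - g x\<bar> ^ 3 \<partial>lborel) 0 < \<eta> * \<delta> / 2"
    by (auto simp: eventually_nhds_metric)
  show ?thesis
  proof (intro exI[of _ r] conjI allI impI)
    fix e :: real assume e: "0 < e \<and> e < r"
    interpret U: prob_space "ball_unif e :: 'a measure" using e by (intro prob_space_ball_unif) auto
    have "ball_avg e g x - g x = (\<integral>h. g (x + h) - g x \<partial>ball_unif e)" for x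
    proof -
      have "integrable (ball_unif e) (\<lambda>h. g (x + h))"
        using integrable_ball_unif[OF integrable_lborel_translate[OF g1, of "-x"]] by (simp add: add.commute)
      then show ?thesis unfolding ball_avg_def by (simp add: U.prob_space[simplified])
    qed
    moreover have "(\<integral>\<^sup>+x. ennreal (f x * (\<integral>h. g (x + h) - g x \<partial>ball_unif e)\<^sup>2) \<partial>lborel) \<le> ennreal \<delta>"
    proof (rule weighted_square_of_ball_average_le)
      fix h :: 'a assume "norm h \<le> e"
      then have h: "(\<integral>x. \<bar>g (x + h) - g x\<bar> ^ 3 \<partial>lborel) < \<eta> * \<delta> / 2"
        using r(2)[of "-h"] e by simp
      have "integrable lborel (\<lambda>x. \<bar>g (x + h)^3 - g x^3\<bar>)"
        using integrable_lborel_translate[OF g3, of "-h"] g3 by simp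
      then have "integrable lborel (\<lambda>x. \<bar>g (x + h) - g x\<bar> ^ 3)"
        by (rule Bochner_Integration.integrable_bound)
           (use nn in \<open>auto intro!: AE_I2 abs_diff_power_le simp: power_abs\<close>)
      then have "(\<integral>\<^sup>+x. ennreal (f x * (g (x + h) - g x)\<^sup>2) \<partial>lborel)
        \<le> ennreal (\<eta> * I + (\<integral>x. \<bar>g (x + h) - g x\<bar> ^ 3 \<partial>lborel) / \<eta>)"
        unfolding I_def using nn \<eta> f3 by (intro nn_integral_mult_square_le_cubes) auto
      also have "\<dots> \<le> ennreal \<delta>"
      proof (rule ennreal_leI)
        have "(\<integral>x. \<bar>g (x + h) - g x\<bar> ^ 3 \<partial>lborel) / \<eta> \<le> \<delta> / 2"
          using h \<eta> by (simp add: field_simps)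
        then show "\<eta> * I + (\<integral>x. \<bar>g (x + h) - g x\<bar> ^ 3 \<partial>lborel) / \<eta> \<le> \<delta>" using \<eta>(3) by linarith
      qed
      finally show "(\<integral>\<^sup>+x. ennreal (f x * (g (x + h) - g x)\<^sup>2) \<partial>lborel) \<le> ennreal \<delta>" .
    qed (use nn e in auto)
    ultimately show "(\<integral>\<^sup>+x. ennreal (f x * (ball_avg e g x - g x)\<^sup>2) \<partial>lborel) \<le> ennreal \<delta>"
      by simp
  qed (use r in auto)
qed

lemma integrable_mult_translate:
  fixes f g :: "'a::euclidean_space \<Rightarrow> real"
  assumes [measurable]: "f \<in> borel_measurable borel" "g \<in> borel_measurable borel"
    and f2: "integrable lborel (\<lambda>x. (f x)\<^sup>2)" and g2: "integrable lborel (\<lambda>x. (g x)\<^sup>2)"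
  shows "integrable lborel (\<lambda>x. f x * g (x + h))"
    and "(\<integral>x. \<bar>f x * g (x + h)\<bar> \<partial>lborel) \<le> ((\<integral>x. (f x)\<^sup>2 \<partial>lborel) + (\<integral>x. (g x)\<^sup>2 \<partial>lborel)) / 2"
proof -
  have g2': "integrable lborel (\<lambda>x. (g (x + h))\<^sup>2)"
    using integrable_lborel_translate[OF g2, of "-h"] by simp
  have le: "\<bar>f x * g (x + h)\<bar> \<le> ((f x)\<^sup>2 + (g (x + h))\<^sup>2) / 2" for x
    using sum_squares_bound[of "\<bar>f x\<bar>" "\<bar>g (x + h)\<bar>"] by (simp add: abs_mult)
  show i: "integrable lborel (\<lambda>x. f x * g (x + h))"
    by (rule Bochner_Integration.integrable_bound[of _ "\<lambda>x. ((f x)\<^sup>2 + (g (x + h))\<^sup>2) / 2"])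
       (use f2 g2' le in auto)
  have "(\<integral>x. \<bar>f x * g (x + h)\<bar> \<partial>lborel) \<le> (\<integral>x. ((f x)\<^sup>2 + (g (x + h))\<^sup>2) / 2 \<partial>lborel)"
    using i f2 g2' le by (intro integral_mono) auto
  also have "\<dots> = ((\<integral>x. (f x)\<^sup>2 \<partial>lborel) + (\<integral>x. (g (x - (-h)))\<^sup>2 \<partial>lborel)) / 2"
    using f2 g2' by simp
  also have "(\<integral>x. (g (x - (-h)))\<^sup>2 \<partial>lborel) = (\<integral>x. (g x)\<^sup>2 \<partial>lborel)"
    by (rule integral_lborel_translate) measurable
  finally show "(\<integral>x. \<bar>f x * g (x + h)\<bar> \<partial>lborel) \<le> ((\<integral>x. (f x)\<^sup>2 \<partial>lborel) + (\<integral>x. (g x)\<^sup>2 \<partial>lborel)) / 2" .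
qed

text \<open>
  The averaging over the ball is exchanged with the integration over space.
\<close>

lemma integral_mult_ball_avg:
  fixes f g :: "'a::euclidean_space \<Rightarrow> real"
  assumes [measurable]: "f \<in> borel_measurable borel" "g \<in> borel_measurable borel"
    and f2: "integrable lborel (\<lambda>x. (f x)\<^sup>2)" and g2: "integrable lborel (\<lambda>x. (g x)\<^sup>2)"
    and e: "0 < e"
  shows "integrable (ball_unif e) (\<lambda>h. \<integral>x. f x * g (x + h) \<partial>lborel)"
    and "(\<integral>x. f x * ball_avg e g x \<partial>lborel) = (\<integral>h. (\<integral>x. f x * g (x + h) \<partial>lborel) \<partial>ball_unif e)"
proof -
  interpret U: prob_space "ball_unif e :: 'a measure" using e by (rule prob_space_ball_unif)
  interpret P: pair_sigma_finite "ball_unif e :: 'a measure" lborel ..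
  have int: "integrable (ball_unif e \<Otimes>\<^sub>M lborel) (\<lambda>(h, x). f x * g (x + h))"
  proof (rule P.Fubini_integrable)
    show "integrable (ball_unif e) (\<lambda>h. \<integral>x. norm (case (h, x) of (h, x) \<Rightarrow> f x * g (x + h)) \<partial>lborel)"
      using integrable_mult_translate[OF assms(1-4)]
      by (intro U.integrable_const_bound[where B="((\<integral>x. (f x)\<^sup>2 \<partial>lborel) + (\<integral>x. (g x)\<^sup>2 \<partial>lborel)) / 2"]) auto
  qed (use integrable_mult_translate[OF assms(1-4)] in auto)
  show "integrable (ball_unif e) (\<lambda>h. \<integral>x. f x * g (x + h) \<partial>lborel)"
    using P.integrable_fst[OF int] .
  have "(\<integral>h. (\<integral>x. f x * g (x + h) \<partial>lborel) \<partial>ball_unif e) = (\<integral>x. (\<integral>h. f x * g (x + h) \<partial>ball_unif e) \<partial>lborel)"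
    by (rule P.Fubini_integral[OF int, symmetric])
  then show "(\<integral>x. f x * ball_avg e g x \<partial>lborel) = (\<integral>h. (\<integral>x. f x * g (x + h) \<partial>lborel) \<partial>ball_unif e)"
    by (simp add: ball_avg_def)
qed

text \<open>
  Write \<open>\<Phi>\<close> and \<open>\<Gamma>\<close> for the two cross-correlations of \<open>f\<close> and \<open>g\<close>.  Then
  \<open>\<Phi> h + \<Gamma> h - 2 q = - \<integral> \<Delta>\<^sub>h f \<Delta>\<^sub>h g\<close>, which is of second order in the smoothness.  The two
  expressions for the smoothed functional in the last assumption allow \<open>\<Phi>\<close> and \<open>\<Gamma>\<close> to be averaged
  together; a single one of them would only give a first-order bound.
\<close>

proposition smoothing_bias_le:
  fixes f g :: "'a::euclidean_space \<Rightarrow> real"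
  assumes [measurable]: "f \<in> borel_measurable borel" "g \<in> borel_measurable borel"
    and f2: "integrable lborel (\<lambda>x. (f x)\<^sup>2)" and g2: "integrable lborel (\<lambda>x. (g x)\<^sup>2)"
    and e: "0 < e"
    and fd: "\<And>h. norm h \<le> e \<Longrightarrow> (\<integral>x. (f (x - h) - f x)\<^sup>2 \<partial>lborel) \<le> \<delta>"
    and gd: "\<And>h. norm h \<le> e \<Longrightarrow> (\<integral>x. (g (x - h) - g x)\<^sup>2 \<partial>lborel) \<le> \<delta>"
    and sym: "(\<integral>x. g x * ball_avg e f x \<partial>lborel) = (\<integral>x. f x * ball_avg e g x \<partial>lborel)"
  shows "\<bar>(\<integral>x. f x * ball_avg e g x \<partial>lborel) - (\<integral>x. f x * g x \<partial>lborel)\<bar> \<le> \<delta> / 2"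
proof -
  interpret U: prob_space "ball_unif e :: 'a measure" using e by (rule prob_space_ball_unif)
  define q where "q = (\<integral>x. f x * g x \<partial>lborel)"
  define \<Phi> where "\<Phi> h = (\<integral>x. f x * g (x + h) \<partial>lborel)" for h
  define \<Gamma> where "\<Gamma> h = (\<integral>x. g x * f (x + h) \<partial>lborel)" for h
  note fg = integral_mult_ball_avg[OF assms(1,2) f2 g2 e, folded \<Phi>_def]
  note gf = integral_mult_ball_avg[OF assms(2,1) g2 f2 e, folded \<Gamma>_def]
  have D: "\<bar>\<Phi> h + \<Gamma> h - 2 * q\<bar> \<le> \<delta>" if "norm h \<le> e" for h
  proof -
    let ?df = "\<lambda>x. f (x + h) - f x" and ?dg = "\<lambda>x. g (x + h) - g x"
    have f2': "integrable lborel (\<lambda>x. (f (x + h))\<^sup>2)"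
      using integrable_lborel_translate[OF f2, of "-h"] by simp
    have g2': "integrable lborel (\<lambda>x. (g (x + h))\<^sup>2)"
      using integrable_lborel_translate[OF g2, of "-h"] by simp
    note i1 = integrable_mult_translate(1)[OF assms(1,2) f2 g2]
    note i2 = integrable_mult_translate(1)[OF assms(2,1) g2 f2]
    have i0: "integrable lborel (\<lambda>x. f x * g x)" using i1[of 0] by simp
    have i3: "integrable lborel (\<lambda>x. f (x + h) * g (x + h))"
      using integrable_lborel_translate[OF i0, of "-h"] by simp
    have q': "q = (\<integral>x. f (x + h) * g (x + h) \<partial>lborel)"
      unfolding q_def using integral_lborel_translate[of "\<lambda>x. f x * g x" "-h"] by simp
    have "(\<integral>x. f (x + h) * g (x + h) + f x * g x - (f x * g (x + h) + g x * f (x + h)) \<partial>lborel)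
       = 2 * q - (\<Phi> h + \<Gamma> h)"
      using i0 i1[of h] i2[of h] i3 q' unfolding q_def[symmetric] \<Phi>_def \<Gamma>_def by (simp add: q_def)
    then have eq: "(\<integral>x. ?df x * ?dg x \<partial>lborel) = 2 * q - (\<Phi> h + \<Gamma> h)"
      by (simp add: algebra_simps)
    have df2: "integrable lborel (\<lambda>x. (?df x)\<^sup>2)"
      by (rule Bochner_Integration.integrable_bound[of _ "\<lambda>x. 2 * (f (x + h))\<^sup>2 + 2 * (f x)\<^sup>2"])
         (use f2 f2' in \<open>auto intro!: square_diff_le\<close>)
    have dg2: "integrable lborel (\<lambda>x. (?dg x)\<^sup>2)"
      by (rule Bochner_Integration.integrable_bound[of _ "\<lambda>x. 2 * (g (x + h))\<^sup>2 + 2 * (g x)\<^sup>2"])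
         (use g2 g2' in \<open>auto intro!: square_diff_le\<close>)
    have "\<bar>2 * q - (\<Phi> h + \<Gamma> h)\<bar> \<le> (\<integral>x. \<bar>?df x * ?dg x\<bar> \<partial>lborel)"
      unfolding eq[symmetric] by (rule integral_abs_bound)
    also have "\<dots> \<le> ((\<integral>x. (?df x)\<^sup>2 \<partial>lborel) + (\<integral>x. (?dg x)\<^sup>2 \<partial>lborel)) / 2"
      using integrable_mult_translate(2)[of ?df ?dg 0] df2 dg2 by simp
    also have "\<dots> \<le> (\<delta> + \<delta>) / 2" using fd[of "-h"] gd[of "-h"] that by simp
    finally show ?thesis by (simp add: abs_minus_commute)
  qed
  have "\<bar>\<integral>h. \<Phi> h + \<Gamma> h - 2 * q \<partial>ball_unif e\<bar> \<le> (\<integral>h. \<bar>\<Phi> h + \<Gamma> h - 2 * q\<bar> \<partial>ball_unif e)"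
    by (rule integral_abs_bound)
  also have "\<dots> \<le> \<delta>"
    using fg(1) gf(1) by (intro U.integral_le_const eventually_mono[OF AE_ball_unif D]) auto
  also have "(\<integral>h. \<Phi> h + \<Gamma> h - 2 * q \<partial>ball_unif e) = 2 * ((\<integral>x. f x * ball_avg e g x \<partial>lborel) - q)"
    using fg gf sym by (simp add: U.prob_space[simplified])
  finally show ?thesis unfolding q_def abs_mult by simp
qed

lemma smoothing_bias_tendsto_0:
  fixes f g :: "'a::euclidean_space \<Rightarrow> real"
  assumes [measurable]: "f \<in> borel_measurable borel" "g \<in> borel_measurable borel"
    and nn: "\<And>x. 0 \<le> f x" "\<And>x. 0 \<le> g x"
    and f2: "integrable lborel (\<lambda>x. (f x)\<^sup>2)" and g2: "integrable lborel (\<lambda>x. (g x)\<^sup>2)"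
    and sym: "\<And>e. 0 < e \<Longrightarrow> (\<integral>x. g x * ball_avg e f x \<partial>lborel) = (\<integral>x. f x * ball_avg e g x \<partial>lborel)"
  shows "((\<lambda>e. \<integral>x. f x * ball_avg e g x \<partial>lborel) \<longlongrightarrow> (\<integral>x. f x * g x \<partial>lborel)) (at_right 0)"
proof (rule tendstoI)
  fix \<delta> :: real assume "0 < \<delta>"
  have "((\<lambda>h. \<integral>x. \<bar>f (x - h) - f x\<bar> ^ 2 \<partial>lborel) \<longlongrightarrow> 0) (nhds 0)"
    "((\<lambda>h. \<integral>x. \<bar>g (x - h) - g x\<bar> ^ 2 \<partial>lborel) \<longlongrightarrow> 0) (nhds 0)"
    by (rule Lr_translation_continuous; use f2 g2 nn in simp)+
  then have "eventually (\<lambda>h. dist (\<integral>x. \<bar>f (x - h) - f x\<bar> ^ 2 \<partial>lborel) 0 < \<delta> \<and>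
      dist (\<integral>x. \<bar>g (x - h) - g x\<bar> ^ 2 \<partial>lborel) 0 < \<delta>) (nhds 0)"
    using \<open>0 < \<delta>\<close> by (intro eventually_conj tendstoD) auto
  then obtain r where r: "r > 0" "\<And>h. norm h < r \<Longrightarrow> (\<integral>x. (f (x - h) - f x)\<^sup>2 \<partial>lborel) < \<delta> \<and>
    (\<integral>x. (g (x - h) - g x)\<^sup>2 \<partial>lborel) < \<delta>"
    by (auto simp: eventually_nhds_metric)
  have "eventually (\<lambda>e. 0 < e \<and> e < r) (at_right 0)"
    using r(1) eventually_at_right_real by (auto simp: eventually_at_right_field)
  then show "\<forall>\<^sub>F e in at_right 0. dist (\<integral>x. f x * ball_avg e g x \<partial>lborel) (\<integral>x. f x * g x \<partial>lborel) < \<delta>"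
  proof eventually_elim
    case (elim e)
    have "\<bar>(\<integral>x. f x * ball_avg e g x \<partial>lborel) - (\<integral>x. f x * g x \<partial>lborel)\<bar> \<le> \<delta> / 2"
      using elim r(2) by (intro smoothing_bias_le f2 g2 sym assms(1,2)) (auto intro: less_imp_le)
    then show ?case using \<open>0 < \<delta>\<close> by (simp add: dist_real_def)
  qed
qed

section \<open>Stationary m-dependent sequences\<close>

text \<open>
  Indices at which an \<open>m\<close>-dependent sequence is independent.
\<close>

definition far :: "nat \<Rightarrow> nat \<Rightarrow> nat \<Rightarrow> bool" where
  "far m i j \<longleftrightarrow> i + m < j \<or> j + m < i"

lemma far_commute: "far m i j \<longleftrightarrow> far m j i" by (auto simp: far_def)

lemma card_near_le: "card {i \<in> {1..n}. \<not> far m i k} \<le> 2 * m + 1"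
proof -
  have "{i \<in> {1..n}. \<not> far m i k} \<subseteq> {k - m..k + m}" by (auto simp: far_def)
  then have "card {i \<in> {1..n}. \<not> far m i k} \<le> card {k - m..k + m}" by (intro card_mono) auto
  then show ?thesis by simp
qed

lemma vimage_Pair_Times: "(\<lambda>x. (f x, g x)) -` (A \<times> B) = f -` A \<inter> g -` B"
  by auto

locale stationary_m_dependent = prob_space M for M :: "'w measure" +
  fixes Z :: "nat \<Rightarrow> 'w \<Rightarrow> 'b::topological_space" and m :: nat
  assumes Z_measurable: "\<And>i. 1 \<le> i \<Longrightarrow> Z i \<in> borel_measurable M"
    and stationary: "strictly_stationary M Z"
    and dependence: "m_dependent M m Z"
begin

lemma Z_restrict_measurable:
  "J \<subseteq> {1..} \<Longrightarrow> (\<lambda>\<omega>. \<lambda>j\<in>J. Z j \<omega>) \<in> M \<rightarrow>\<^sub>M (\<Pi>\<^sub>M j\<in>J. borel)"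
  by (rule measurable_restrict) (use Z_measurable in auto)

text \<open>
  Stationarity is used only through pairs of times.
\<close>

lemma expectation_shift:
  assumes i: "1 \<le> i" and f [measurable]: "case_prod f \<in> borel_measurable (borel \<Otimes>\<^sub>M borel)"
  shows "expectation (\<lambda>\<omega>. f (Z i \<omega>) (Z (i + h) \<omega>)) = expectation (\<lambda>\<omega>. f (Z 1 \<omega>) (Z (1 + h) \<omega>) :: real)"
proof -
  let ?J = "{1, 1 + h}" and ?P = "\<Pi>\<^sub>M j\<in>{1, 1 + h}. borel :: 'b measure"
  have [measurable]: "(\<lambda>x. f (x 1) (x (1 + h))) \<in> borel_measurable ?P" by measurable
  have eq: "expectation (\<lambda>\<omega>. f (Z (1 + s) \<omega>) (Z (1 + h + s) \<omega>))
      = (\<integral>x. f (x 1) (x (1 + h)) \<partial>distr M ?P (\<lambda>\<omega>. \<lambda>j\<in>?J. Z (j + s) \<omega>))" for s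
    by (subst integral_distr) (auto intro!: measurable_restrict Z_measurable)
  have "distr M ?P (\<lambda>\<omega>. \<lambda>j\<in>?J. Z (j + s) \<omega>) = distr M ?P (\<lambda>\<omega>. \<lambda>j\<in>?J. Z (j + 0) \<omega>)" for s
    using stationary[unfolded strictly_stationary_def, rule_format, of ?J s] by simp
  then have "expectation (\<lambda>\<omega>. f (Z (1 + (i - 1)) \<omega>) (Z (1 + h + (i - 1)) \<omega>))
      = expectation (\<lambda>\<omega>. f (Z (1 + 0) \<omega>) (Z (1 + h + 0) \<omega>))"
    unfolding eq by simp
  moreover have "1 + (i - 1) = i" "1 + h + (i - 1) = i + h" using i by auto
  ultimately show ?thesis by (simp only: add_0_right)
qed

lemma expectation_shift1:
  assumes "1 \<le> i" and [measurable]: "f \<in> borel_measurable borel"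
  shows "expectation (\<lambda>\<omega>. f (Z i \<omega>)) = expectation (\<lambda>\<omega>. f (Z 1 \<omega>) :: real)"
  using expectation_shift[of i "\<lambda>x y. f x" 0] assms by simp

definition box :: "nat set \<Rightarrow> (nat \<Rightarrow> 'b set) \<Rightarrow> 'w set" where
  "box J F = {\<omega> \<in> space M. \<forall>j\<in>J. Z j \<omega> \<in> F j}"

lemma box_eq_vimage:
  assumes "J \<subseteq> I"
  shows "box J F = (\<lambda>\<omega>. \<lambda>j\<in>I. Z j \<omega>) -` (PiE I (\<lambda>j. if j \<in> J then F j else UNIV)) \<inter> space M"
  using assms by (fastforce simp: box_def PiE_iff)

text \<open>
  The definition of \<open>m\<close>-dependence speaks of complete blocks of indices and of a past that is not
  empty; here both sides may be arbitrary finite sets of times, also empty ones.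
\<close>

lemma prob_box_split:
  assumes J: "finite J2" "J1 \<subseteq> {1..b}" "J2 \<subseteq> {b + m + 1..}"
    and F: "\<And>j. F j \<in> sets borel"
  shows "prob (box (J1 \<union> J2) F) = prob (box J1 F) * prob (box J2 F)"
proof (cases "b = 0")
  case True
  with J have "J1 = {}" by simp
  then show ?thesis by (simp add: box_def prob_space)
next
  case False
  \<comment> \<open>any length that makes the second block contain \<open>J2\<close>\<close>
  define l where "l = Suc (Max (insert 0 J2))"
  let ?I1 = "{1..b}" and ?I2 = "{b + (m + 1)..b + (m + 1) + l}"
  have J2: "J2 \<subseteq> ?I2"
  proof
    fix j assume "j \<in> J2"
    then have "j \<le> Max (insert 0 J2)" using J(1) by (intro Max_ge) auto
    then have "j \<le> l" unfolding l_def by (rule le_SucI)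
    then show "j \<in> ?I2" using \<open>j \<in> J2\<close> J(3) by auto
  qed
  let ?E1 = "PiE ?I1 (\<lambda>j. if j \<in> J1 then F j else UNIV)" and ?E2 = "PiE ?I2 (\<lambda>j. if j \<in> J2 then F j else UNIV)"
  have ind: "indep_var (\<Pi>\<^sub>M i\<in>?I1. borel) (\<lambda>\<omega>. \<lambda>i\<in>?I1. Z i \<omega>) (\<Pi>\<^sub>M i\<in>?I2. borel) (\<lambda>\<omega>. \<lambda>i\<in>?I2. Z i \<omega>)"
    using dependence[unfolded m_dependent_def, rule_format, of b "m + 1" l] False by (simp add: l_def)
  have "?E1 \<in> sets (\<Pi>\<^sub>M i\<in>?I1. borel)" "?E2 \<in> sets (\<Pi>\<^sub>M i\<in>?I2. borel)"
    using F by (auto intro!: sets_PiM_I_finite)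
  from indep_varD[OF ind this]
  have "prob ((\<lambda>\<omega>. (\<lambda>i\<in>?I1. Z i \<omega>, \<lambda>i\<in>?I2. Z i \<omega>)) -` (?E1 \<times> ?E2) \<inter> space M)
      = prob (box J1 F) * prob (box J2 F)"
    unfolding box_eq_vimage[OF J(2)] box_eq_vimage[OF J2] .
  also have "(\<lambda>\<omega>. (\<lambda>i\<in>?I1. Z i \<omega>, \<lambda>i\<in>?I2. Z i \<omega>)) -` (?E1 \<times> ?E2) \<inter> space M = box J1 F \<inter> box J2 F"
    unfolding box_eq_vimage[OF J(2)] box_eq_vimage[OF J2] vimage_Pair_Times by (simp only: Int_ac Int_absorb Int_left_absorb)
  also have "\<dots> = box (J1 \<union> J2) F" by (auto simp: box_def)
  finally show ?thesis .
qed

text \<open>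
  An isolated time \<open>i\<close> may have other times on both sides.  Split off the past first, then separate
  \<open>i\<close> from the future; past and future are independent of each other as well, so the factors can be
  put together again.
\<close>

lemma prob_box_isolated:
  assumes i: "1 \<le> i" and J: "finite J" "J \<subseteq> {1..}" "\<And>j. j \<in> J \<Longrightarrow> far m i j"
    and F: "\<And>j. F j \<in> sets borel"
  shows "prob (box (insert i J) F) = prob (box {i} F) * prob (box J F)"
proof -
  define P where "P = {j \<in> J. j + m < i}"
  define Q where "Q = {j \<in> J. i + m < j}"
  have fin: "finite P" "finite Q" using J by (auto simp: P_def Q_def)
  have JPQ: "J = P \<union> Q" using J(3) by (auto simp: P_def Q_def far_def)
  have iQ: "prob (box ({i} \<union> Q) F) = prob (box {i} F) * prob (box Q F)"
    by (rule prob_box_split[of _ _ i]) (use i fin F in \<open>auto simp: Q_def\<close>)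
  have PQ: "prob (box (P \<union> Q) F) = prob (box P F) * prob (box Q F)"
    by (rule prob_box_split[of _ _ i]) (use i J fin F in \<open>auto simp: P_def Q_def\<close>)
  have "prob (box (P \<union> ({i} \<union> Q)) F) = prob (box P F) * prob (box ({i} \<union> Q) F)"
  proof (cases "P = {}")
    case True
    then show ?thesis by (simp add: box_def prob_space)
  next
    case False
    then have "m < i" by (auto simp: P_def)
    then show ?thesis
      by (intro prob_box_split[of _ _ "i - m - 1"]) (use J fin F in \<open>auto simp: P_def Q_def\<close>)
  qed
  then show ?thesis using iQ PQ JPQ by (simp add: Un_insert_right)
qed

text \<open>
  A generator, closed under intersections, of the events determined by the times in \<open>J\<close>.
\<close>

definition cylinders :: "nat set \<Rightarrow> 'w set set" where
  "cylinders J = {(\<lambda>\<omega>. \<lambda>j\<in>J. Z j \<omega>) -` PiE J F \<inter> space M |F. \<forall>j\<in>J. F j \<in> sets borel}"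

lemma cylinder_eq_box:
  assumes "b \<in> cylinders J"
  obtains F where "\<And>j. F j \<in> sets borel" "b = box J F"
proof -
  obtain F where F: "\<forall>j\<in>J. F j \<in> sets borel" "b = (\<lambda>\<omega>. \<lambda>j\<in>J. Z j \<omega>) -` PiE J F \<inter> space M"
    using assms by (auto simp: cylinders_def)
  have "b = box J (\<lambda>j. if j \<in> J then F j else UNIV)"
    unfolding F(2) by (auto simp: box_def PiE_iff)
  then show ?thesis using F(1) by (intro that[of "\<lambda>j. if j \<in> J then F j else UNIV"]) auto
qed

lemma cylinders_events:
  assumes "finite J" "J \<subseteq> {1..}"
  shows "cylinders J \<subseteq> events"
  using assms unfolding cylinders_def
  by (auto intro!: measurable_sets[OF Z_restrict_measurable] sets_PiM_I_finite)

lemma Int_stable_cylinders: "Int_stable (cylinders J)"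
proof (rule Int_stableI)
  fix a b assume "a \<in> cylinders J" "b \<in> cylinders J"
  then obtain E F where "\<forall>j\<in>J. E j \<in> sets borel" "\<forall>j\<in>J. F j \<in> sets borel"
    "a = (\<lambda>\<omega>. \<lambda>j\<in>J. Z j \<omega>) -` PiE J E \<inter> space M" "b = (\<lambda>\<omega>. \<lambda>j\<in>J. Z j \<omega>) -` PiE J F \<inter> space M"
    by (auto simp: cylinders_def)
  then show "a \<inter> b \<in> cylinders J"
    unfolding cylinders_def by (intro CollectI exI[of _ "\<lambda>j. E j \<inter> F j"]) (auto simp: PiE_iff)
qed

lemma sigma_sets_cylinders:
  assumes "finite J"
  shows "sigma_sets (space M) {(\<lambda>\<omega>. \<lambda>j\<in>J. Z j \<omega>) -` E \<inter> space M |E. E \<in> sets (\<Pi>\<^sub>M j\<in>J. borel)}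
    = sigma_sets (space M) (cylinders J)"
proof -
  let ?G = "{PiE J F |F. \<forall>j\<in>J. F j \<in> sets (borel :: 'b measure)}"
  have "sets (\<Pi>\<^sub>M j\<in>J. borel) = sigma_sets (\<Pi>\<^sub>E j\<in>J. UNIV) ?G"
    using assms by (simp add: sets_PiM prod_algebra_eq_finite Pi_iff)
  moreover have "{(\<lambda>\<omega>. \<lambda>j\<in>J. Z j \<omega>) -` E \<inter> space M |E. E \<in> sigma_sets (\<Pi>\<^sub>E j\<in>J. UNIV) ?G}
      = sigma_sets (space M) {(\<lambda>\<omega>. \<lambda>j\<in>J. Z j \<omega>) -` E \<inter> space M |E. E \<in> ?G}"
    by (rule sigma_sets_vimage_commute) auto
  moreover have "{(\<lambda>\<omega>. \<lambda>j\<in>J. Z j \<omega>) -` E \<inter> space M |E. E \<in> ?G} = cylinders J"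
    by (auto simp: cylinders_def)
  moreover have "cylinders J \<subseteq> Pow (space M)" by (auto simp: cylinders_def)
  ultimately show ?thesis by (simp add: sigma_sets_sigma_sets_eq)
qed

text \<open>
  Independence of events is checked on the cylinders.  The single variable is wrapped as a family over
  \<open>{i}\<close> so that both sides have the same type, as \<open>indep_var\<close> demands.
\<close>

proposition indep_isolated:
  assumes i: "1 \<le> i" and J: "finite J" "J \<subseteq> {1..}" "\<And>j. j \<in> J \<Longrightarrow> far m i j"
  shows "indep_var (\<Pi>\<^sub>M j\<in>{i}. borel) (\<lambda>\<omega>. \<lambda>j\<in>{i}. Z j \<omega>) (\<Pi>\<^sub>M j\<in>J. borel) (\<lambda>\<omega>. \<lambda>j\<in>J. Z j \<omega>)"
proof -
  have iJ: "i \<notin> J" using J(3)[of i] by (auto simp: far_def)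
  have "indep_set (cylinders {i}) (cylinders J)"
    unfolding indep_sets2_eq
  proof (intro conjI ballI)
    show "cylinders {i} \<subseteq> events" "cylinders J \<subseteq> events" using i J by (auto intro!: cylinders_events del: subsetI)
    fix a b assume a: "a \<in> cylinders {i}" and b: "b \<in> cylinders J"
    obtain E where E: "\<And>j. E j \<in> sets borel" "a = box {i} E" using cylinder_eq_box[OF a] by metis
    obtain F where F: "\<And>j. F j \<in> sets borel" "b = box J F" using cylinder_eq_box[OF b] by metis
    have a': "a = box {i} (F(i := E i))" and b': "b = box J (F(i := E i))"
      and ab: "a \<inter> b = box (insert i J) (F(i := E i))"
      using E(2) F(2) iJ by (auto simp: box_def)
    show "prob (a \<inter> b) = prob a * prob b"
      unfolding ab unfolding a' b' using E F by (intro prob_box_isolated i J) auto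
  qed
  then have "indep_set (sigma_sets (space M) (cylinders {i})) (sigma_sets (space M) (cylinders J))"
    by (intro indep_set_sigma_sets Int_stable_cylinders)
  then show ?thesis
    unfolding indep_var_eq sigma_sets_cylinders[OF J(1)] sigma_sets_cylinders[OF finite.insertI[OF finite.emptyI]]
    using i J by (auto intro!: Z_restrict_measurable)
qed

text \<open>
  The isolated variable is integrated out first, by Fubini for the product of the two laws.
\<close>

lemma expectation_isolated_eq_0:
  fixes f :: "'b \<Rightarrow> (nat \<Rightarrow> 'b) \<Rightarrow> real"
  assumes i: "1 \<le> i" and J: "finite J" "J \<subseteq> {1..}" "\<And>j. j \<in> J \<Longrightarrow> far m i j"
    and f [measurable]: "case_prod f \<in> borel_measurable (borel \<Otimes>\<^sub>M (\<Pi>\<^sub>M j\<in>J. borel))"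
    and bound: "\<And>z t. \<bar>f z t\<bar> \<le> B"
    and zero: "\<And>t. t \<in> space (\<Pi>\<^sub>M j\<in>J. (borel :: 'b measure)) \<Longrightarrow> expectation (\<lambda>\<omega>. f (Z 1 \<omega>) t) = 0"
  shows "expectation (\<lambda>\<omega>. f (Z i \<omega>) (\<lambda>j\<in>J. Z j \<omega>)) = 0"
proof -
  let ?S = "\<lambda>\<omega>. \<lambda>j\<in>{i}. Z j \<omega>" and ?Q = "\<Pi>\<^sub>M j\<in>{i}. (borel :: 'b measure)"
  let ?T = "\<lambda>\<omega>. \<lambda>j\<in>J. Z j \<omega>" and ?P = "\<Pi>\<^sub>M j\<in>J. (borel :: 'b measure)"
  have [measurable]: "?S \<in> M \<rightarrow>\<^sub>M ?Q" "?T \<in> M \<rightarrow>\<^sub>M ?P" "Z i \<in> borel_measurable M"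
    using i J by (auto intro!: Z_restrict_measurable Z_measurable)
  have [measurable]: "(\<lambda>(s, t). f (s i) t) \<in> borel_measurable (?Q \<Otimes>\<^sub>M ?P)"
    by measurable
  interpret D1: prob_space "distr M ?Q ?S" by (rule prob_space_distr) measurable
  interpret D2: prob_space "distr M ?P ?T" by (rule prob_space_distr) measurable
  interpret D: pair_prob_space "distr M ?Q ?S" "distr M ?P ?T" ..
  have "expectation (\<lambda>\<omega>. f (Z i \<omega>) (?T \<omega>)) = (\<integral>x. (\<lambda>(s, t). f (s i) t) x \<partial>distr M (?Q \<Otimes>\<^sub>M ?P) (\<lambda>\<omega>. (?S \<omega>, ?T \<omega>)))"
    by (subst integral_distr) auto
  also have "\<dots> = (\<integral>x. (\<lambda>(s, t). f (s i) t) x \<partial>(distr M ?Q ?S \<Otimes>\<^sub>M distr M ?P ?T))"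
    using indep_isolated[OF i J] unfolding indep_var_distribution_eq by simp
  also have "\<dots> = (\<integral>t. (\<integral>s. f (s i) t \<partial>distr M ?Q ?S) \<partial>distr M ?P ?T)"
    by (rule D.integral_snd[symmetric]) (use bound in \<open>auto intro!: D.P.integrable_const_bound[where B=B]\<close>)
  also have "\<dots> = (\<integral>t. 0 \<partial>distr M ?P ?T)"
  proof (rule Bochner_Integration.integral_cong)
    fix t assume "t \<in> space (distr M ?P ?T)"
    then have t [measurable]: "t \<in> space ?P" by simp
    have [measurable]: "(\<lambda>z. f z t) \<in> borel_measurable borel"
      using measurable_Pair1[OF f] t by simp
    have "(\<integral>s. f (s i) t \<partial>distr M ?Q ?S) = expectation (\<lambda>\<omega>. f (Z i \<omega>) t)" by (subst integral_distr) auto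
    also have "\<dots> = 0" using expectation_shift1[OF i, of "\<lambda>z. f z t"] zero[OF t] by simp
    finally show "(\<integral>s. f (s i) t \<partial>distr M ?Q ?S) = 0" .
  qed simp
  finally show ?thesis by simp
qed

text \<open>
  The covariance at lag \<open>h\<close> occurs \<open>n - h\<close> times in each direction and vanishes for \<open>h > m\<close>.  Natural
  subtraction gives weight zero to lags that do not fit into \<open>{1..n}\<close>, so \<open>n < m\<close> needs no separate
  treatment.
\<close>

lemma second_moment_sum:
  fixes G :: "'b \<Rightarrow> real"
  assumes G [measurable]: "G \<in> borel_measurable borel" and bound: "\<And>z. \<bar>G z\<bar> \<le> B"
    and centred: "expectation (\<lambda>\<omega>. G (Z 1 \<omega>)) = 0"
  defines "\<gamma> \<equiv> \<lambda>h. expectation (\<lambda>\<omega>. G (Z 1 \<omega>) * G (Z (1 + h) \<omega>))"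
  shows "expectation (\<lambda>\<omega>. (\<Sum>i=1..n. G (Z i \<omega>))\<^sup>2) = real n * \<gamma> 0 + 2 * (\<Sum>h=1..m. real (n - h) * \<gamma> h)"
proof (induction n)
  case (Suc n)
  have B: "0 \<le> B" using bound[of undefined] by linarith
  note [measurable] = Z_measurable
  have meas_sum [measurable]: "(\<lambda>\<omega>. \<Sum>i=1..k. G (Z i \<omega>)) \<in> borel_measurable M" for k
    by (intro borel_measurable_sum measurable_compose[OF Z_measurable G]) auto
  have sum_le: "\<bar>\<Sum>i=1..k. G (Z i \<omega>)\<bar> \<le> real k * B" for k \<omega>
    using order_trans[OF sum_abs[of "\<lambda>i. G (Z i \<omega>)" "{1..k}"] sum_mono[OF bound]] by simp
  have int2: "integrable M (\<lambda>\<omega>. (\<Sum>i=1..k. G (Z i \<omega>))\<^sup>2)" for k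
    by (rule integrable_const_bound[where B="(real k * B)\<^sup>2"])
       (use power_mono[OF sum_le abs_ge_zero, of _ k 2] in auto)
  have intG2: "integrable M (\<lambda>\<omega>. (G (Z (Suc n) \<omega>))\<^sup>2)"
    by (rule integrable_const_bound[where B="B\<^sup>2"])
       (use power_mono[OF bound abs_ge_zero, of _ 2] in auto)
  have intGG: "integrable M (\<lambda>\<omega>. G (Z i \<omega>) * G (Z j \<omega>))" if "1 \<le> i" "1 \<le> j" for i j
    by (rule integrable_const_bound[where B="B * B"])
       (use that bound B in \<open>auto simp: abs_mult intro!: mult_mono\<close>)
  have zero: "\<gamma> h = 0" if "m < h" for h
  proof -
    have "expectation (\<lambda>\<omega>. (\<lambda>z t. G z * G (t (1 + h))) (Z 1 \<omega>) (\<lambda>j\<in>{1 + h}. Z j \<omega>)) = 0"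
      by (rule expectation_isolated_eq_0[where B="B * B"])
         (use that bound B centred in \<open>auto simp: far_def abs_mult intro!: mult_mono\<close>)
    then show ?thesis by (simp add: \<gamma>_def)
  qed
  have g0: "expectation (\<lambda>\<omega>. (G (Z (Suc n) \<omega>))\<^sup>2) = \<gamma> 0"
    using expectation_shift1[of "Suc n" "\<lambda>z. (G z)\<^sup>2"] by (simp add: \<gamma>_def power2_eq_square)
  have "expectation (\<lambda>\<omega>. \<Sum>i=1..n. G (Z i \<omega>) * G (Z (Suc n) \<omega>)) = (\<Sum>i=1..n. \<gamma> (n + 1 - i))"
    (is "?C = _")
  proof (subst Bochner_Integration.integral_sum)
    show "(\<Sum>i=1..n. expectation (\<lambda>\<omega>. G (Z i \<omega>) * G (Z (Suc n) \<omega>))) = (\<Sum>i=1..n. \<gamma> (n + 1 - i))"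
    proof (rule sum.cong)
      fix i assume "i \<in> {1..n}"
      then have i: "1 \<le> i" "i + (n + 1 - i) = Suc n" by auto
      show "expectation (\<lambda>\<omega>. G (Z i \<omega>) * G (Z (Suc n) \<omega>)) = \<gamma> (n + 1 - i)"
        using expectation_shift[OF i(1), of "\<lambda>x y. G x * G y" "n + 1 - i"] i(2) by (simp add: \<gamma>_def)
    qed simp
  qed (use intGG in auto)
  also have "\<dots> = (\<Sum>h=1..n. \<gamma> h)"
    using sum.atLeastAtMost_rev[of "\<lambda>i. \<gamma> (n + 1 - i)" 1 n] by (auto intro!: sum.cong)
  also have "\<dots> = (\<Sum>h=1..m. (real (Suc n - h) - real (n - h)) * \<gamma> h)"
  proof -
    have "(\<Sum>h=1..n. \<gamma> h) = (\<Sum>h\<in>{1..n} \<inter> {1..m}. \<gamma> h)"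
      using zero by (intro sum.mono_neutral_right) auto
    also have "\<dots> = (\<Sum>h\<in>{1..n} \<inter> {1..m}. (real (Suc n - h) - real (n - h)) * \<gamma> h)"
      by (intro sum.cong) (auto simp: of_nat_diff)
    also have "\<dots> = (\<Sum>h=1..m. (real (Suc n - h) - real (n - h)) * \<gamma> h)"
      by (intro sum.mono_neutral_left) (auto simp: not_le Suc_diff_le)
    finally show ?thesis .
  qed
  finally have C: "?C = (\<Sum>h=1..m. (real (Suc n - h) - real (n - h)) * \<gamma> h)" .
  have "expectation (\<lambda>\<omega>. (\<Sum>i=1..Suc n. G (Z i \<omega>))\<^sup>2)
      = expectation (\<lambda>\<omega>. (\<Sum>i=1..n. G (Z i \<omega>))\<^sup>2 + 2 * (\<Sum>i=1..n. G (Z i \<omega>) * G (Z (Suc n) \<omega>)) + (G (Z (Suc n) \<omega>))\<^sup>2)"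
    by (intro Bochner_Integration.integral_cong) (auto simp: power2_eq_square algebra_simps sum_distrib_left sum_distrib_right)
  also have "\<dots> = expectation (\<lambda>\<omega>. (\<Sum>i=1..n. G (Z i \<omega>))\<^sup>2) + 2 * ?C + \<gamma> 0"
  proof -
    have intC: "integrable M (\<lambda>\<omega>. \<Sum>i=1..n. G (Z i \<omega>) * G (Z (Suc n) \<omega>))"
      using intGG by (intro Bochner_Integration.integrable_sum) auto
    show ?thesis
      unfolding Bochner_Integration.integral_add[OF Bochner_Integration.integrable_add[OF int2 integrable_mult_right[OF intC]] intG2]
        Bochner_Integration.integral_add[OF int2 integrable_mult_right[OF intC]] g0 integral_mult_right_zero ..
  qed
  also have "\<dots> = real (Suc n) * \<gamma> 0 + 2 * (\<Sum>h=1..m. real (Suc n - h) * \<gamma> h)"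
    unfolding C Suc.IH by (simp add: algebra_simps sum_subtractf)
  finally show ?case .
qed simp

text \<open>
  By Cauchy-Schwarz and stationarity every autocovariance is at most the variance, and replacing
  \<open>n - h\<close> by \<open>n\<close> changes each of the \<open>m\<close> weights by at most \<open>m\<close>.
\<close>

lemma second_moment_sum_approx:
  fixes G :: "'b \<Rightarrow> real"
  assumes G [measurable]: "G \<in> borel_measurable borel" and bound: "\<And>z. \<bar>G z\<bar> \<le> B"
    and centred: "expectation (\<lambda>\<omega>. G (Z 1 \<omega>)) = 0"
  defines "\<gamma> \<equiv> \<lambda>h. expectation (\<lambda>\<omega>. G (Z 1 \<omega>) * G (Z (1 + h) \<omega>))"
  shows "\<bar>expectation (\<lambda>\<omega>. (\<Sum>i=1..n. G (Z i \<omega>))\<^sup>2) - real n * (\<gamma> 0 + 2 * (\<Sum>h=1..m. \<gamma> h))\<bar> \<le> 2 * real m ^ 2 * \<gamma> 0"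
    and "\<bar>\<gamma> 0 + 2 * (\<Sum>h=1..m. \<gamma> h)\<bar> \<le> (1 + 2 * real m) * \<gamma> 0"
proof -
  have int2: "integrable M (\<lambda>\<omega>. (G (Z i \<omega>))\<^sup>2)" if "1 \<le> i" for i
    by (rule integrable_const_bound[where B="B\<^sup>2"])
       (use that power_mono[OF bound abs_ge_zero, of _ 2] measurable_compose[OF Z_measurable G] in auto)
  have g0: "expectation (\<lambda>\<omega>. (G (Z i \<omega>))\<^sup>2) = \<gamma> 0" if "1 \<le> i" for i
    using expectation_shift1[of i "\<lambda>z. (G z)\<^sup>2"] that by (simp add: \<gamma>_def power2_eq_square)
  have g0_nonneg: "0 \<le> \<gamma> 0" by (simp add: \<gamma>_def)
  have le: "\<bar>\<gamma> h\<bar> \<le> \<gamma> 0" for h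
  proof -
    have "\<bar>\<gamma> h\<bar> \<le> sqrt (\<gamma> 0) * sqrt (\<gamma> 0)"
      using Cauchy_Schwarz_integral(2)[of "\<lambda>\<omega>. G (Z 1 \<omega>)" M "\<lambda>\<omega>. G (Z (1 + h) \<omega>)"] int2[of 1] int2[of "1 + h"]
        g0[of 1] g0[of "1 + h"] measurable_compose[OF Z_measurable G] by (simp add: \<gamma>_def)
    then show ?thesis using g0_nonneg by simp
  qed
  have "expectation (\<lambda>\<omega>. (\<Sum>i=1..n. G (Z i \<omega>))\<^sup>2) - real n * (\<gamma> 0 + 2 * (\<Sum>h=1..m. \<gamma> h))
      = 2 * (\<Sum>h=1..m. (real (n - h) - real n) * \<gamma> h)"
    unfolding \<gamma>_def second_moment_sum[OF G bound centred]
    by (simp add: algebra_simps sum_subtractf sum_distrib_left)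
  also have "\<bar>\<dots>\<bar> \<le> 2 * (\<Sum>h=1..m. \<bar>(real (n - h) - real n) * \<gamma> h\<bar>)"
    by (simp add: abs_mult del: abs_of_nat) (rule order_trans[OF sum_abs], simp add: abs_mult)
  also have "\<dots> \<le> 2 * (\<Sum>h=1..m. real m * \<gamma> 0)"
    by (intro mult_left_mono sum_mono) (auto simp: abs_mult intro!: mult_mono le)
  finally show "\<bar>expectation (\<lambda>\<omega>. (\<Sum>i=1..n. G (Z i \<omega>))\<^sup>2) - real n * (\<gamma> 0 + 2 * (\<Sum>h=1..m. \<gamma> h))\<bar> \<le> 2 * real m ^ 2 * \<gamma> 0"
    by (simp add: power2_eq_square algebra_simps)
  have "\<bar>\<Sum>h=1..m. \<gamma> h\<bar> \<le> (\<Sum>h=1..m. \<gamma> 0)"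
    by (rule order_trans[OF sum_abs sum_mono]) (rule le)
  then show "\<bar>\<gamma> 0 + 2 * (\<Sum>h=1..m. \<gamma> h)\<bar> \<le> (1 + 2 * real m) * \<gamma> 0"
    using g0_nonneg by (simp add: abs_le_iff algebra_simps)
qed

end

section \<open>The Hoeffding decomposition of a double sum\<close>

text \<open>
  \<open>u\<close> and \<open>v\<close> are the two Hoeffding projections of the kernel, \<open>\<theta>\<close> is its mean under independent
  arguments, and \<open>r\<close> is the completely degenerate rest.
\<close>

locale bounded_kernel = stationary_m_dependent M Z m
  for M :: "'w measure" and Z :: "nat \<Rightarrow> 'w \<Rightarrow> 'b::topological_space" and m +
  fixes H :: "'b \<Rightarrow> 'b \<Rightarrow> real" and B :: real
  assumes H_measurable: "case_prod H \<in> borel_measurable (borel \<Otimes>\<^sub>M borel)"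
    and H_bound: "\<And>x y. \<bar>H x y\<bar> \<le> B"
begin

definition u :: "'b \<Rightarrow> real" where "u z = expectation (\<lambda>\<omega>. H z (Z 1 \<omega>))"
definition v :: "'b \<Rightarrow> real" where "v z = expectation (\<lambda>\<omega>. H (Z 1 \<omega>) z)"
definition \<theta> :: real where "\<theta> = expectation (\<lambda>\<omega>. u (Z 1 \<omega>))"
definition r :: "'b \<Rightarrow> 'b \<Rightarrow> real" where "r x y = H x y - u x - v y + \<theta>"

lemma B_nonneg: "0 \<le> B" using H_bound[of undefined undefined] by linarith

lemma H_comp_measurable [measurable (raw)]:
  "f \<in> N \<rightarrow>\<^sub>M borel \<Longrightarrow> g \<in> N \<rightarrow>\<^sub>M borel \<Longrightarrow> (\<lambda>x. H (f x) (g x)) \<in> borel_measurable N"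
  using measurable_compose[OF measurable_Pair H_measurable] by simp

lemma Z1_measurable [measurable]: "Z (Suc 0) \<in> borel_measurable M"
  using Z_measurable[of 1] by simp

lemma u_measurable [measurable]: "u \<in> borel_measurable borel"
  unfolding u_def[abs_def] One_nat_def by measurable

lemma v_measurable [measurable]: "v \<in> borel_measurable borel"
  unfolding v_def[abs_def] One_nat_def by measurable

lemma abs_expectation_le:
  fixes f :: "'w \<Rightarrow> real"
  assumes "\<And>\<omega>. \<bar>f \<omega>\<bar> \<le> C" "0 \<le> C"
  shows "\<bar>expectation f\<bar> \<le> C"
proof (cases "integrable M f")
  case True
  have "\<bar>expectation f\<bar> \<le> expectation (\<lambda>\<omega>. \<bar>f \<omega>\<bar>)" by (rule integral_abs_bound)
  also have "\<dots> \<le> C" using True assms by (intro integral_le_const) auto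
  finally show ?thesis .
qed (use assms in \<open>auto simp: not_integrable_integral_eq\<close>)

lemma u_bound: "\<bar>u z\<bar> \<le> B" and v_bound: "\<bar>v z\<bar> \<le> B" and \<theta>_bound: "\<bar>\<theta>\<bar> \<le> B"
proof -
  show u: "\<bar>u z\<bar> \<le> B" for z unfolding u_def by (intro abs_expectation_le H_bound B_nonneg)
  show "\<bar>v z\<bar> \<le> B" unfolding v_def by (intro abs_expectation_le H_bound B_nonneg)
  show "\<bar>\<theta>\<bar> \<le> B" unfolding \<theta>_def by (intro abs_expectation_le u B_nonneg)
qed

lemma integrable_bounded:
  assumes "f \<in> borel_measurable M" "\<And>\<omega>. \<bar>f \<omega>\<bar> \<le> C"
  shows "integrable M (f :: 'w \<Rightarrow> real)"
  by (rule integrable_const_bound[where B=C]) (use assms in auto)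

lemma \<theta>_eq_v: "\<theta> = expectation (\<lambda>\<omega>. v (Z 1 \<omega>))"
proof -
  interpret P: pair_prob_space M M ..
  have "integrable (M \<Otimes>\<^sub>M M) (\<lambda>(\<omega>, \<omega>'). H (Z 1 \<omega>) (Z 1 \<omega>'))"
    by (rule P.P.integrable_const_bound[where B=B]) (use H_bound in auto)
  from P.Fubini_integral[OF this] show ?thesis by (simp add: \<theta>_def u_def v_def)
qed

lemma r_comp_measurable [measurable (raw)]:
  "f \<in> N \<rightarrow>\<^sub>M borel \<Longrightarrow> g \<in> N \<rightarrow>\<^sub>M borel \<Longrightarrow> (\<lambda>x. r (f x) (g x)) \<in> borel_measurable N"
  unfolding r_def
  by (intro borel_measurable_add borel_measurable_diff H_comp_measurable borel_measurable_const
      measurable_compose[OF _ u_measurable] measurable_compose[OF _ v_measurable])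

lemma r_bound: "\<bar>r x y\<bar> \<le> 4 * B"
  using H_bound[of x y] u_bound[of x] v_bound[of y] \<theta>_bound unfolding r_def by linarith

lemma r_degenerate:
  "expectation (\<lambda>\<omega>. r x (Z 1 \<omega>)) = 0" "expectation (\<lambda>\<omega>. r (Z 1 \<omega>) y) = 0"
proof -
  have i: "integrable M (\<lambda>\<omega>. H x (Z 1 \<omega>))" "integrable M (\<lambda>\<omega>. H (Z 1 \<omega>) y)"
    "integrable M (\<lambda>\<omega>. u (Z 1 \<omega>))" "integrable M (\<lambda>\<omega>. v (Z 1 \<omega>))"
    by (auto intro!: integrable_bounded H_bound u_bound v_bound)
  show "expectation (\<lambda>\<omega>. r x (Z 1 \<omega>)) = 0"
    unfolding r_def using i by (simp add: prob_space \<theta>_eq_v u_def)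
  show "expectation (\<lambda>\<omega>. r (Z 1 \<omega>) y) = 0"
    unfolding r_def using i by (simp add: prob_space \<theta>_def v_def)
qed

lemma r_cross_bound: "\<bar>r x y * r x' y'\<bar> \<le> 16 * B\<^sup>2"
  using mult_mono[OF r_bound[of x y] r_bound[of x' y']] B_nonneg by (simp add: abs_mult power2_eq_square)

text \<open>
  The isolated index may be either argument of the first factor.
\<close>

lemma r_cross_eq_0:
  assumes "1 \<le> i" "1 \<le> j" "1 \<le> k" "1 \<le> l"
    and "far m i j" "far m i k" "far m i l"
  shows "expectation (\<lambda>\<omega>. r (Z i \<omega>) (Z j \<omega>) * r (Z k \<omega>) (Z l \<omega>)) = 0"
    and "expectation (\<lambda>\<omega>. r (Z j \<omega>) (Z i \<omega>) * r (Z k \<omega>) (Z l \<omega>)) = 0"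
proof -
  let ?J = "{j, k, l}"
  have "expectation (\<lambda>\<omega>. (\<lambda>z t. r z (t j) * r (t k) (t l)) (Z i \<omega>) (\<lambda>j\<in>?J. Z j \<omega>)) = 0"
    by (rule expectation_isolated_eq_0[where B="16 * B\<^sup>2"])
       (use assms r_degenerate r_cross_bound in auto)
  then show "expectation (\<lambda>\<omega>. r (Z i \<omega>) (Z j \<omega>) * r (Z k \<omega>) (Z l \<omega>)) = 0" by simp
  have "expectation (\<lambda>\<omega>. (\<lambda>z t. r (t j) z * r (t k) (t l)) (Z i \<omega>) (\<lambda>j\<in>?J. Z j \<omega>)) = 0"
    by (rule expectation_isolated_eq_0[where B="16 * B\<^sup>2"])
       (use assms r_degenerate r_cross_bound in auto)
  then show "expectation (\<lambda>\<omega>. r (Z j \<omega>) (Z i \<omega>) * r (Z k \<omega>) (Z l \<omega>)) = 0" by simp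
qed

definition near_pairs :: "nat \<Rightarrow> (nat \<times> nat) set" where
  "near_pairs n = {(i, j). i \<in> {1..n} \<and> j \<in> {1..n} \<and> \<not> far m i j}"
definition far_pairs :: "nat \<Rightarrow> (nat \<times> nat) set" where
  "far_pairs n = {(i, j). i \<in> {1..n} \<and> j \<in> {1..n} \<and> far m i j}"

lemma finite_pairs: "finite (near_pairs n)" "finite (far_pairs n)"
  by (rule finite_subset[of _ "{1..n} \<times> {1..n}"], auto simp: near_pairs_def far_pairs_def)+

lemma card_near_pairs: "card (near_pairs n) \<le> n * (2 * m + 1)"
proof -
  have "near_pairs n = (\<lambda>(j, i). (i, j)) ` (SIGMA j:{1..n}. {i \<in> {1..n}. \<not> far m i j})"
    by (auto simp: near_pairs_def)
  then have "card (near_pairs n) \<le> card (SIGMA j:{1..n}. {i \<in> {1..n}. \<not> far m i j})"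
    by (simp add: card_image_le del: card_SigmaI)
  also have "\<dots> = (\<Sum>j=1..n. card {i \<in> {1..n}. \<not> far m i j})" by (subst card_SigmaI) auto
  also have "\<dots> \<le> (\<Sum>j=1..n. 2 * m + 1)" by (intro sum_mono card_near_le)
  finally show ?thesis by simp
qed

text \<open>
  For a fixed second pair only those first pairs contribute whose two indices both lie near one of the
  indices of the second pair; there are at most \<open>(2 (2 m + 1))\<^sup>2\<close> of them.
\<close>

lemma far_second_moment:
  "expectation (\<lambda>\<omega>. (\<Sum>(i, j)\<in>far_pairs n. r (Z i \<omega>) (Z j \<omega>))\<^sup>2) \<le> 64 * (2 * real m + 1)\<^sup>2 * B\<^sup>2 * (real n)\<^sup>2"
proof -
  define E where "E p q = expectation (\<lambda>\<omega>. r (Z (fst p) \<omega>) (Z (snd p) \<omega>) * r (Z (fst q) \<omega>) (Z (snd q) \<omega>))" for p q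
  define N where "N q = {i \<in> {1..n}. \<not> far m i (fst q)} \<union> {i \<in> {1..n}. \<not> far m i (snd q)}" for q
  have E_le: "\<bar>E p q\<bar> \<le> 16 * B\<^sup>2" for p q
    unfolding E_def by (intro abs_expectation_le r_cross_bound) simp
  have E0: "E p q = 0" if "p \<in> far_pairs n" "q \<in> far_pairs n" "p \<notin> N q \<times> N q" for p q
    using that r_cross_eq_0[of "fst p" "snd p" "fst q" "snd q"] r_cross_eq_0[of "snd p" "fst p" "fst q" "snd q"]
    by (auto simp: far_pairs_def N_def E_def far_commute)
  have cardN: "real (card (N q)) \<le> 2 * (2 * real m + 1)" for q
  proof -
    have "card (N q) \<le> card {i \<in> {1..n}. \<not> far m i (fst q)} + card {i \<in> {1..n}. \<not> far m i (snd q)}"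
      unfolding N_def by (rule card_Un_le)
    also have "\<dots> \<le> (2 * m + 1) + (2 * m + 1)" by (intro add_mono card_near_le)
    finally have "real (card (N q)) \<le> real ((2 * m + 1) + (2 * m + 1))" by (rule of_nat_mono)
    then show ?thesis by simp
  qed
  have finN: "finite (N q)" for q by (simp add: N_def)
  have meas: "(\<lambda>\<omega>. r (Z (fst p) \<omega>) (Z (snd p) \<omega>)) \<in> borel_measurable M" if "p \<in> far_pairs n" for p
    using that Z_measurable by (intro r_comp_measurable) (auto simp: far_pairs_def)
  have int: "integrable M (\<lambda>\<omega>. r (Z (fst p) \<omega>) (Z (snd p) \<omega>) * r (Z (fst q) \<omega>) (Z (snd q) \<omega>))"
    if "p \<in> far_pairs n" "q \<in> far_pairs n" for p q
    by (rule integrable_bounded[OF borel_measurable_times[OF meas[OF that(1)] meas[OF that(2)]]]) (rule r_cross_bound)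
  have "expectation (\<lambda>\<omega>. (\<Sum>(i, j)\<in>far_pairs n. r (Z i \<omega>) (Z j \<omega>))\<^sup>2)
      = expectation (\<lambda>\<omega>. \<Sum>q\<in>far_pairs n. \<Sum>p\<in>far_pairs n.
          r (Z (fst p) \<omega>) (Z (snd p) \<omega>) * r (Z (fst q) \<omega>) (Z (snd q) \<omega>))"
    by (simp add: power2_eq_square sum_product split_beta mult.commute)
  also have "\<dots> = (\<Sum>q\<in>far_pairs n. \<Sum>p\<in>far_pairs n. E p q)"
    unfolding E_def using int
    by (simp add: Bochner_Integration.integral_sum Bochner_Integration.integrable_sum)
  also have "\<dots> \<le> (\<Sum>q\<in>far_pairs n. 64 * (2 * real m + 1)\<^sup>2 * B\<^sup>2)"
  proof (rule sum_mono)
    fix q assume q: "q \<in> far_pairs n"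
    have "(\<Sum>p\<in>far_pairs n. E p q) = (\<Sum>p\<in>far_pairs n \<inter> (N q \<times> N q). E p q)"
      using E0[OF _ q] finite_pairs by (intro sum.mono_neutral_right) auto
    also have "\<dots> \<le> (\<Sum>p\<in>far_pairs n \<inter> (N q \<times> N q). 16 * B\<^sup>2)"
      using E_le by (intro sum_mono) (auto simp: abs_le_iff)
    also have "\<dots> \<le> (\<Sum>p\<in>N q \<times> N q. 16 * B\<^sup>2)"
      using finN by (intro sum_mono2) auto
    also have "\<dots> = (real (card (N q)))\<^sup>2 * (16 * B\<^sup>2)" by (simp add: power2_eq_square card_cartesian_product)
    also have "\<dots> \<le> (2 * (2 * real m + 1))\<^sup>2 * (16 * B\<^sup>2)"
      using cardN by (intro mult_right_mono power_mono) auto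
    also have "\<dots> = 64 * (2 * real m + 1)\<^sup>2 * B\<^sup>2" unfolding power_mult_distrib by simp
    finally show "(\<Sum>p\<in>far_pairs n. E p q) \<le> 64 * (2 * real m + 1)\<^sup>2 * B\<^sup>2" .
  qed
  also have "\<dots> = real (card (far_pairs n)) * (64 * (2 * real m + 1)\<^sup>2 * B\<^sup>2)" by simp
  also have "\<dots> \<le> (real n)\<^sup>2 * (64 * (2 * real m + 1)\<^sup>2 * B\<^sup>2)"
  proof (rule mult_right_mono)
    have "card (far_pairs n) \<le> card ({1..n} \<times> {1..n})"
      by (intro card_mono) (auto simp: far_pairs_def)
    then have "real (card (far_pairs n)) \<le> real (n * n)" by (intro of_nat_mono) (simp add: card_cartesian_product)
    then show "real (card (far_pairs n)) \<le> (real n)\<^sup>2" by (simp add: power2_eq_square)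
  qed simp
  finally show ?thesis by (simp add: mult.commute)
qed

text \<open>
  Near pairs are few enough to be bounded pointwise; far pairs use the cancellation.
\<close>

proposition degenerate_second_moment:
  "expectation (\<lambda>\<omega>. (\<Sum>i=1..n. \<Sum>j=1..n. r (Z i \<omega>) (Z j \<omega>))\<^sup>2) \<le> 160 * (2 * real m + 1)\<^sup>2 * B\<^sup>2 * (real n)\<^sup>2"
proof -
  define F where "F \<omega> = (\<Sum>(i, j)\<in>far_pairs n. r (Z i \<omega>) (Z j \<omega>))" for \<omega>
  define N where "N \<omega> = (\<Sum>(i, j)\<in>near_pairs n. r (Z i \<omega>) (Z j \<omega>))" for \<omega>
  have split: "(\<Sum>i=1..n. \<Sum>j=1..n. r (Z i \<omega>) (Z j \<omega>)) = N \<omega> + F \<omega>" for \<omega>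
  proof -
    have "{1..n} \<times> {1..n} = near_pairs n \<union> far_pairs n" by (auto simp: near_pairs_def far_pairs_def)
    moreover have "near_pairs n \<inter> far_pairs n = {}" by (auto simp: near_pairs_def far_pairs_def)
    ultimately show ?thesis
      by (simp add: sum.cartesian_product sum.union_disjoint finite_pairs N_def F_def)
  qed
  have r_meas: "(\<lambda>\<omega>. r (Z i \<omega>) (Z j \<omega>)) \<in> borel_measurable M" if "1 \<le> i" "1 \<le> j" for i j
    using that Z_measurable by (intro r_comp_measurable) auto
  have meas [measurable]: "F \<in> borel_measurable M" "N \<in> borel_measurable M"
    unfolding F_def[abs_def] N_def[abs_def]
    by (intro borel_measurable_sum; auto simp: far_pairs_def near_pairs_def intro!: r_meas)+
  have sum_le: "\<bar>\<Sum>(i, j)\<in>A. r (Z i \<omega>) (Z j \<omega>)\<bar> \<le> real (card A) * (4 * B)" for A \<omega>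
  proof -
    have "\<bar>\<Sum>(i, j)\<in>A. r (Z i \<omega>) (Z j \<omega>)\<bar> \<le> (\<Sum>(i, j)\<in>A. \<bar>r (Z i \<omega>) (Z j \<omega>)\<bar>)"
      by (rule order_trans[OF sum_abs]) (simp add: split_beta)
    also have "\<dots> \<le> (\<Sum>(i, j)\<in>A. 4 * B)" by (intro sum_mono) (auto simp: r_bound)
    finally show ?thesis by (simp add: split_beta)
  qed
  have F2: "integrable M (\<lambda>\<omega>. (F \<omega>)\<^sup>2)"
  proof (rule integrable_bounded)
    show "\<bar>(F \<omega>)\<^sup>2\<bar> \<le> (real (card (far_pairs n)) * (4 * B))\<^sup>2" for \<omega>
      using power_mono[OF sum_le[of \<omega> "far_pairs n"] abs_ge_zero, of 2] by (simp add: F_def)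
  qed measurable
  have N_le: "(N \<omega>)\<^sup>2 \<le> (real n * (2 * real m + 1) * (4 * B))\<^sup>2" for \<omega>
  proof -
    have "real (card (near_pairs n)) \<le> real (n * (2 * m + 1))" by (intro of_nat_mono card_near_pairs)
    then have "real (card (near_pairs n)) * (4 * B) \<le> real n * (2 * real m + 1) * (4 * B)"
      using B_nonneg by (intro mult_right_mono) (auto simp: algebra_simps)
    then have "\<bar>N \<omega>\<bar> \<le> real n * (2 * real m + 1) * (4 * B)"
      unfolding N_def by (rule order_trans[OF sum_le])
    from power_mono[OF this abs_ge_zero, of 2] show ?thesis by simp
  qed
  have "expectation (\<lambda>\<omega>. (\<Sum>i=1..n. \<Sum>j=1..n. r (Z i \<omega>) (Z j \<omega>))\<^sup>2)
      \<le> expectation (\<lambda>\<omega>. 2 * (real n * (2 * real m + 1) * (4 * B))\<^sup>2 + 2 * (F \<omega>)\<^sup>2)"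
  proof (rule integral_mono')
    fix \<omega>
    have "(N \<omega> + F \<omega>)\<^sup>2 \<le> 2 * (N \<omega>)\<^sup>2 + 2 * (F \<omega>)\<^sup>2" using square_diff_le[of "N \<omega>" "- F \<omega>"] by simp
    then show "(\<Sum>i=1..n. \<Sum>j=1..n. r (Z i \<omega>) (Z j \<omega>))\<^sup>2 \<le> 2 * (real n * (2 * real m + 1) * (4 * B))\<^sup>2 + 2 * (F \<omega>)\<^sup>2"
      unfolding split using N_le[of \<omega>] by linarith
  qed (use F2 in auto)
  also have "\<dots> = 2 * (real n * (2 * real m + 1) * (4 * B))\<^sup>2 + 2 * expectation (\<lambda>\<omega>. (F \<omega>)\<^sup>2)"
    using F2 by (simp add: prob_space)
  also have "\<dots> \<le> 2 * (real n * (2 * real m + 1) * (4 * B))\<^sup>2 + 2 * (64 * (2 * real m + 1)\<^sup>2 * B\<^sup>2 * (real n)\<^sup>2)"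
    unfolding F_def by (intro add_left_mono mult_left_mono far_second_moment) simp
  also have "\<dots> = 160 * (2 * real m + 1)\<^sup>2 * B\<^sup>2 * (real n)\<^sup>2" by (simp add: power_mult_distrib)
  finally show ?thesis .
qed

lemma hoeffding_decomposition:
  assumes "1 \<le> n"
  shows "1 / (real n)\<^sup>2 * (\<Sum>i=1..n. \<Sum>j=1..n. H (Z i \<omega>) (Z j \<omega>))
    = \<theta> + 2 / real n * (\<Sum>i=1..n. (u (Z i \<omega>) + v (Z i \<omega>)) / 2 - \<theta>)
      + 1 / (real n)\<^sup>2 * (\<Sum>i=1..n. \<Sum>j=1..n. r (Z i \<omega>) (Z j \<omega>))"
  using assms unfolding r_def
  by (simp add: sum.distrib sum_subtractf sum_divide_distrib[symmetric] power2_eq_square field_simps sum_distrib_left[symmetric])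

end

section \<open>Rates from bounds on the linear part and the remainder\<close>

text \<open>
  Slow variation at \<open>t = 1/2\<close> bounds \<open>L n\<close> by \<open>2\<^sup>\<delta> L (n div 2)\<close> for large \<open>n\<close>.  Iterated halving turns
  this into a bound by a power, without appeal to the uniform convergence theorem.
\<close>

lemma slowly_varying_le_powr:
  assumes sv: "slowly_varying L" and \<delta>: "0 < \<delta>"
  shows "\<exists>C>0. eventually (\<lambda>n. L n \<le> C * real n powr \<delta>) sequentially"
proof -
  have pos: "0 < L n" if "1 \<le> n" for n using sv that by (simp add: slowly_varying_def)
  have "(\<lambda>n. L (nat \<lfloor>(1/2) * real n\<rfloor>) / L n) \<longlonglongrightarrow> 1" 
    by (rule sv[unfolded slowly_varying_def, THEN conjunct2, rule_format]) simp
  moreover have half: "nat \<lfloor>(1/2) * real n\<rfloor> = n div 2" for n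
  proof -
    have "(1/2) * real n = real n / real 2" by simp
    then show ?thesis by (simp only: floor_divide_of_nat_eq nat_int)
  qed
  ultimately have lim: "(\<lambda>n. L (n div 2) / L n) \<longlonglongrightarrow> 1" by (simp only: half)
  have "2 powr (- \<delta>) < (1 :: real)" using \<delta> by (simp add: powr_less_one)
  from order_tendstoD(1)[OF lim this] obtain N where N: "\<And>n. N \<le> n \<Longrightarrow> 2 powr (- \<delta>) < L (n div 2) / L n"
    by (auto simp: eventually_sequentially)
  define N' where "N' = max 2 N"
  have step: "L n \<le> 2 powr \<delta> * L (n div 2)" if "N' \<le> n" for n
  proof -
    have "2 powr (- \<delta>) * L n < L (n div 2)"
      using N[of n] pos[of n] that by (simp add: N'_def pos_less_divide_eq)
    then have "2 powr \<delta> * (2 powr (- \<delta>) * L n) \<le> 2 powr \<delta> * L (n div 2)"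
      by (intro mult_left_mono) auto
    then show ?thesis by (simp add: mult.assoc[symmetric] powr_add[symmetric])
  qed
  define C where "C = Max (insert 1 (L ` {1..N'}))"
  have "1 \<le> C" unfolding C_def by (rule Max_ge) auto
  then have C_pos: "0 < C" by simp
  have C: "L n \<le> C" if "1 \<le> n" "n \<le> N'" for n
    unfolding C_def by (rule Max_ge) (use that in auto)
  have bound: "L n \<le> C * real n powr \<delta>" if "1 \<le> n" for n
    using that
  proof (induction n rule: less_induct)
    case (less n)
    show ?case
    proof (cases "n \<le> N'")
      case True
      have "C * 1 \<le> C * real n powr \<delta>"
        using less.prems \<delta> C_pos by (intro mult_left_mono) (auto intro: ge_one_powr_ge_zero)
      then show ?thesis using C[OF less.prems True] by simp
    next
      case False
      then have n: "N' \<le> n" "1 \<le> n div 2" "n div 2 < n" by (auto simp: N'_def)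
      have "L n \<le> 2 powr \<delta> * L (n div 2)" using step n by simp
      also have "\<dots> \<le> 2 powr \<delta> * (C * real (n div 2) powr \<delta>)"
        using less.IH[OF n(3,2)] by (intro mult_left_mono) auto
      also have "\<dots> = C * (2 * real (n div 2)) powr \<delta>" by (simp add: powr_mult)
      also have "\<dots> \<le> C * real n powr \<delta>"
      proof -
        have "real (2 * (n div 2)) \<le> real n" by (intro of_nat_mono) simp
        then show ?thesis using \<delta> C_pos by (intro mult_left_mono powr_mono2) auto
      qed
      finally show ?thesis .
    qed
  qed
  then show ?thesis using C_pos by (auto simp: eventually_sequentially)
qed

lemma asymp_equiv_two_sided:
  fixes \<epsilon> g :: "nat \<Rightarrow> real"
  assumes eq: "\<epsilon> \<sim>[at_top] g" and g: "eventually (\<lambda>n. 0 < g n) at_top"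
  shows "eventually (\<lambda>n. g n / 2 \<le> \<epsilon> n \<and> \<epsilon> n \<le> 2 * g n) at_top"
proof -
  have lim: "((\<lambda>n. \<epsilon> n / g n) \<longlongrightarrow> 1) at_top"
    using g by (intro asymp_equivD_strong[OF eq]) (auto elim: eventually_mono)
  have "eventually (\<lambda>n. 1 / 2 < \<epsilon> n / g n) at_top" "eventually (\<lambda>n. \<epsilon> n / g n < 2) at_top"
    by (rule order_tendstoD[OF lim]; simp)+
  with g show ?thesis by eventually_elim (auto simp: field_simps)
qed

text \<open>
  The numerical content of the probabilistic part: \<open>e\<close> is the mean square error, \<open>a\<close> and \<open>w\<close> are the
  second moments of the linear part and of everything else, \<open>s\<close> is the long-run variance at bandwidth
  \<open>\<epsilon>\<close> and \<open>\<beta>\<close> the bias.  The bounds start at \<open>n = 2\<close>, the first sample size with a pair of distinct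
  indices.
\<close>

locale error_bounds =
  fixes e a w s \<beta> \<epsilon> :: "nat \<Rightarrow> real" and d :: nat and C :: real
  assumes e_nonneg: "\<And>n. 2 \<le> n \<Longrightarrow> 0 \<le> e n" and a_nonneg: "\<And>n. 2 \<le> n \<Longrightarrow> 0 \<le> a n"
    and w_nonneg: "\<And>n. 2 \<le> n \<Longrightarrow> 0 \<le> w n" and \<epsilon>_pos: "\<And>n. 2 \<le> n \<Longrightarrow> 0 < \<epsilon> n"
    and e_split: "\<And>n. 2 \<le> n \<Longrightarrow> \<bar>e n - a n - w n\<bar> \<le> 2 * (sqrt (a n) * sqrt (w n))"
    and w_le: "\<And>n. 2 \<le> n \<Longrightarrow> w n \<le> C * ((\<beta> n)\<^sup>2 + (1 / (real n * \<epsilon> n ^ d))\<^sup>2 + (1 / real n)\<^sup>2)"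
    and a_approx: "\<And>n. 2 \<le> n \<Longrightarrow> \<bar>a n - 4 * s n / real n\<bar> \<le> C / (real n)\<^sup>2"
    and s_bound: "\<And>n. 2 \<le> n \<Longrightarrow> \<bar>s n\<bar> \<le> C"
begin

lemma C_nonneg: "0 \<le> C" using s_bound[of 2] by linarith

lemma e_le: "2 \<le> n \<Longrightarrow> e n \<le> 2 * a n + 2 * w n"
proof -
  assume n: "2 \<le> n"
  have "2 * (sqrt (a n) * sqrt (w n)) \<le> a n + w n"
    using sum_squares_bound[of "sqrt (a n)" "sqrt (w n)"] a_nonneg[OF n] w_nonneg[OF n] by simp
  then show ?thesis using e_split[OF n] by linarith
qed

lemma a_le: "2 \<le> n \<Longrightarrow> a n \<le> 5 * C / real n"
proof -
  assume n: "2 \<le> n"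
  have "4 * s n / real n \<le> 4 * C / real n" using s_bound[OF n] by (intro divide_right_mono) auto
  moreover have "C / (real n)\<^sup>2 \<le> C / real n"
    using n C_nonneg by (intro divide_left_mono) (auto simp: power2_eq_square)
  ultimately show ?thesis using a_approx[OF n] by (simp add: add_divide_distrib[symmetric])
qed

lemma consistency:
  assumes \<beta>: "\<beta> \<longlonglongrightarrow> 0" and \<epsilon>: "filterlim (\<lambda>n. real n * \<epsilon> n ^ d) at_top sequentially"
  shows "e \<longlonglongrightarrow> 0"
proof (rule tendsto_sandwich[OF _ _ tendsto_const])
  show "eventually (\<lambda>n. 0 \<le> e n) sequentially"
    using e_nonneg by (auto simp: eventually_sequentially)
  show "eventually (\<lambda>n. e n \<le> 2 * (5 * C / real n)
      + 2 * (C * ((\<beta> n)\<^sup>2 + (1 / (real n * \<epsilon> n ^ d))\<^sup>2 + (1 / real n)\<^sup>2))) sequentially"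
    using eventually_ge_at_top[of 2]
  proof eventually_elim
    case (elim n)
    show ?case using e_le[OF elim] a_le[OF elim] w_le[OF elim] by linarith
  qed
  have "(\<lambda>n. 1 / (real n * \<epsilon> n ^ d)) \<longlonglongrightarrow> 0"
    by (intro tendsto_divide_0[OF tendsto_const] filterlim_at_top_imp_at_infinity[OF \<epsilon>])
  moreover have "(\<lambda>n. 1 / real n) \<longlonglongrightarrow> 0" by (rule lim_1_over_n)
  moreover have "(\<lambda>n. 5 * C / real n) \<longlonglongrightarrow> 0" by real_asymp
  ultimately have "(\<lambda>n. 2 * (5 * C / real n)
      + 2 * (C * ((\<beta> n)\<^sup>2 + (1 / (real n * \<epsilon> n ^ d))\<^sup>2 + (1 / real n)\<^sup>2))) \<longlonglongrightarrow> 2 * 0 + 2 * (C * (0\<^sup>2 + 0\<^sup>2 + 0\<^sup>2))"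
    using \<beta> by (intro tendsto_intros)
  then show "(\<lambda>n. 2 * (5 * C / real n)
      + 2 * (C * ((\<beta> n)\<^sup>2 + (1 / (real n * \<epsilon> n ^ d))\<^sup>2 + (1 / real n)\<^sup>2))) \<longlonglongrightarrow> 0" by simp
qed

text \<open>
  The bandwidth balances \<open>\<beta>\<^sup>2\<close> against \<open>1 / (n \<epsilon>\<^sup>d)\<^sup>2\<close>; both are of the order \<open>n\<close> to the power
  \<open>-4 \<alpha> / (2 \<alpha> + d)\<close>.  The linear part of order \<open>1 / n\<close> is not larger, since \<open>\<alpha> \<le> d / 2\<close>.
\<close>

lemma smooth_rate:
  assumes \<alpha>: "0 < \<alpha>" "\<alpha> \<le> real d / 2" and c: "0 < c"
    and \<epsilon>: "\<epsilon> \<sim>[at_top] (\<lambda>n. c * real n powr (- 1 / (2 * \<alpha> + real d)))"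
    and \<beta>: "eventually (\<lambda>n. \<bar>\<beta> n\<bar> \<le> D * \<epsilon> n powr (2 * \<alpha>)) sequentially"
  shows "e \<in> O(\<lambda>n. real n powr (- 4 * \<alpha> / (2 * \<alpha> + real d)))"
proof -
  define \<rho> where "\<rho> = 1 / (2 * \<alpha> + real d)"
  have \<rho>: "0 < \<rho>" using \<alpha> by (simp add: \<rho>_def)
  have \<rho>d: "1 - \<rho> * real d = 2 * \<alpha> * \<rho>" using \<alpha> by (simp add: \<rho>_def field_simps)
  have \<kappa>: "4 * \<alpha> * \<rho> \<le> 1" using \<alpha> by (simp add: \<rho>_def field_simps)
  define \<kappa> where "\<kappa> = 4 * \<alpha> * \<rho>"
  have eqk: "- 4 * \<alpha> / (2 * \<alpha> + real d) = - \<kappa>" by (simp add: \<kappa>_def \<rho>_def)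
  have two: "eventually (\<lambda>n. c * real n powr (- \<rho>) / 2 \<le> \<epsilon> n \<and> \<epsilon> n \<le> 2 * (c * real n powr (- \<rho>))) sequentially"
    using \<epsilon> c by (intro asymp_equiv_two_sided) (auto simp: \<rho>_def intro!: eventually_mono[OF eventually_gt_at_top[of 0]])
  define K where "K = 10 * C + 2 * C * ((D * (2 * c) powr (2 * \<alpha>))\<^sup>2 + (1 / (c / 2) ^ d)\<^sup>2 + 1)"
  have "eventually (\<lambda>n. norm (e n) \<le> K * norm (real n powr (- \<kappa>))) sequentially"
    using two \<beta> eventually_ge_at_top[of 2]
  proof eventually_elim
    case (elim n)
    let ?x = "real n powr (- \<kappa>)"
    have n: "1 \<le> real n" "0 < real n" "2 \<le> n" using elim by auto
    have inv_n: "1 / real n \<le> ?x"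
    proof -
      have "1 / real n = real n powr (- 1)" using n by (simp add: powr_minus divide_inverse)
      also have "\<dots> \<le> ?x" using n \<kappa> by (intro powr_mono) (auto simp: \<kappa>_def)
      finally show ?thesis .
    qed
    have "\<bar>\<beta> n\<bar> \<le> D * (2 * c) powr (2 * \<alpha>) * real n powr (- \<rho> * (2 * \<alpha>))"
    proof -
      have D: "0 \<le> D"
      proof (rule ccontr)
        assume "\<not> 0 \<le> D"
        then have "D * \<epsilon> n powr (2 * \<alpha>) < 0" using \<epsilon>_pos[OF n(3)] by (intro mult_neg_pos) auto
        then show False using elim(2) by linarith
      qed
      have "\<epsilon> n powr (2 * \<alpha>) \<le> (2 * c * real n powr (- \<rho>)) powr (2 * \<alpha>)"
        using elim(1) \<epsilon>_pos[OF n(3)] \<alpha> by (intro powr_mono2) auto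
      also have "\<dots> = (2 * c) powr (2 * \<alpha>) * real n powr (- \<rho> * (2 * \<alpha>))"
        using c by (simp add: powr_mult powr_powr)
      finally show ?thesis using elim(2) D by (metis mult.assoc mult_left_mono order_trans)
    qed
    then have "\<bar>\<beta> n\<bar>\<^sup>2 \<le> (D * (2 * c) powr (2 * \<alpha>) * real n powr (- \<rho> * (2 * \<alpha>)))\<^sup>2"
      by (intro power_mono) auto
    also have "\<dots> = (D * (2 * c) powr (2 * \<alpha>))\<^sup>2 * ?x"
      using n by (simp add: power_mult_distrib powr_powr powr_realpow[symmetric] \<kappa>_def algebra_simps
          flip: powr_numeral)
    finally have b: "(\<beta> n)\<^sup>2 \<le> (D * (2 * c) powr (2 * \<alpha>))\<^sup>2 * ?x" by simp
    have low: "0 < c * real n powr (- \<rho>) / 2" using c n by simp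
    then have "real n * (c * real n powr (- \<rho>) / 2) ^ d \<le> real n * \<epsilon> n ^ d"
      using elim(1) by (intro mult_left_mono power_mono) auto
    moreover have "0 < real n * (c * real n powr (- \<rho>) / 2) ^ d"
      using low n(2) by (intro mult_pos_pos zero_less_power)
    ultimately have "1 / (real n * \<epsilon> n ^ d) \<le> 1 / (real n * (c * real n powr (- \<rho>) / 2) ^ d)"
      by (intro frac_le) auto
    also have "\<dots> = 1 / (c / 2) ^ d * (1 / (real n powr 1 * real n powr (- \<rho> * real d)))"
      using n by (simp add: power_mult_distrib powr_powr powr_realpow[symmetric] power_divide)
    also have "\<dots> = 1 / (c / 2) ^ d * real n powr (- (2 * \<alpha> * \<rho>))"
    proof -
      have "1 + - \<rho> * real d = 2 * \<alpha> * \<rho>" using \<rho>d by simp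
      then have "real n powr 1 * real n powr (- \<rho> * real d) = real n powr (2 * \<alpha> * \<rho>)"
        by (simp only: powr_add[symmetric])
      then show ?thesis by (simp only: powr_minus_divide)
    qed
    finally have "(1 / (real n * \<epsilon> n ^ d))\<^sup>2 \<le> (1 / (c / 2) ^ d * real n powr (- (2 * \<alpha> * \<rho>)))\<^sup>2"
      using n \<epsilon>_pos[OF n(3)] by (intro power_mono) auto
    also have "\<dots> = (1 / (c / 2) ^ d)\<^sup>2 * ?x"
      unfolding power_mult_distrib using n by (simp add: powr_powr powr_realpow[symmetric] \<kappa>_def algebra_simps
          flip: powr_numeral)
    finally have v: "(1 / (real n * \<epsilon> n ^ d))\<^sup>2 \<le> (1 / (c / 2) ^ d)\<^sup>2 * ?x" .
    have "(1 / real n)\<^sup>2 \<le> 1 / real n" using n by (simp add: power2_eq_square field_simps)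
    then have i2: "(1 / real n)\<^sup>2 \<le> ?x" using inv_n by linarith
    have "e n \<le> 2 * a n + 2 * w n" by (rule e_le[OF n(3)])
    also have "\<dots> \<le> 2 * (5 * C / real n) + 2 * (C * ((\<beta> n)\<^sup>2 + (1 / (real n * \<epsilon> n ^ d))\<^sup>2 + (1 / real n)\<^sup>2))"
      using a_le[OF n(3)] w_le[OF n(3)] by linarith
    also have "\<dots> \<le> 2 * (5 * C * ?x) + 2 * (C * ((D * (2 * c) powr (2 * \<alpha>))\<^sup>2 * ?x + (1 / (c / 2) ^ d)\<^sup>2 * ?x + ?x))"
    proof -
      have "5 * C / real n \<le> 5 * C * ?x" using mult_left_mono[OF inv_n, of "5 * C"] C_nonneg by simp
      moreover have "C * ((\<beta> n)\<^sup>2 + (1 / (real n * \<epsilon> n ^ d))\<^sup>2 + (1 / real n)\<^sup>2)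
        \<le> C * ((D * (2 * c) powr (2 * \<alpha>))\<^sup>2 * ?x + (1 / (c / 2) ^ d)\<^sup>2 * ?x + ?x)"
        using b v i2 C_nonneg by (intro mult_left_mono add_mono) auto
      ultimately show ?thesis by linarith
    qed
    also have "\<dots> = K * ?x" by (simp add: K_def algebra_simps)
    finally show ?case using e_nonneg[OF n(3)] by simp
  qed
  then show ?thesis unfolding eqk by (rule bigoI)
qed

text \<open>
  Now the linear part dominates: \<open>n w\<close> tends to zero because \<open>n / (n \<epsilon>)\<^sup>2\<close> is comparable with
  \<open>L n\<close> to the power \<open>-2\<close>, and because \<open>n \<beta>\<^sup>2\<close> is at most a constant times \<open>n\<^sup>1\<^sup>-\<^sup>2\<^sup>\<alpha>\<close> times a power
  of \<open>L n\<close>, where \<open>2 \<alpha> > 1\<close> leaves room for a slowly varying factor.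
\<close>

lemma parametric_rate:
  assumes d: "d = 1" and \<alpha>: "1 / 2 < \<alpha>"
    and L: "slowly_varying L" "filterlim L at_top sequentially"
    and \<epsilon>: "\<epsilon> \<sim>[at_top] (\<lambda>n. L n * real n powr (- 1 / 2))"
    and \<beta>: "eventually (\<lambda>n. \<bar>\<beta> n\<bar> \<le> D * \<epsilon> n powr (2 * \<alpha>)) sequentially"
    and s: "s \<longlonglongrightarrow> \<sigma>"
  shows "(\<lambda>n. e n - 4 * \<sigma> / real n) \<in> o(\<lambda>n. 1 / real n)"
proof -
  \<comment> \<open>half of the largest exponent with which a bound \<open>L n \<le> C n\<^sup>\<delta>\<close> still makes \<open>n \<beta>\<^sup>2\<close> vanish\<close>
  define \<delta> where "\<delta> = (2 * \<alpha> - 1) / (8 * \<alpha>)"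
  have \<delta>: "0 < \<delta>" using \<alpha> by (simp add: \<delta>_def)
  define \<eta> where "\<eta> = (2 * \<alpha> - 1) / 2"
  have \<eta>: "0 < \<eta>" "1 + (\<delta> - 1 / 2) * (4 * \<alpha>) = - \<eta>"
    using \<alpha> by (auto simp: \<eta>_def \<delta>_def field_simps)
  obtain C' where C': "0 < C'" "eventually (\<lambda>n. L n \<le> C' * real n powr \<delta>) sequentially"
    using slowly_varying_le_powr[OF L(1) \<delta>] by auto
  have Lpos: "0 < L n" if "1 \<le> n" for n using L(1) that by (simp add: slowly_varying_def)
  have two: "eventually (\<lambda>n. L n * real n powr (- 1 / 2) / 2 \<le> \<epsilon> n \<and> \<epsilon> n \<le> 2 * (L n * real n powr (- 1 / 2))) sequentially"
    using \<epsilon> Lpos by (intro asymp_equiv_two_sided) (auto intro!: eventually_mono[OF eventually_ge_at_top[of 1]])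
  define K where "K = D\<^sup>2 * (2 * C') powr (4 * \<alpha>)"
  have nw: "(\<lambda>n. real n * w n) \<longlonglongrightarrow> 0"
  proof (rule tendsto_sandwich[OF _ _ tendsto_const])
    show "eventually (\<lambda>n. 0 \<le> real n * w n) sequentially"
      using eventually_ge_at_top[of 2] by eventually_elim (use w_nonneg in auto)
    show "eventually (\<lambda>n. real n * w n \<le> C * (K * real n powr (- \<eta>) + (2 / L n)\<^sup>2 + 1 / real n)) sequentially"
      using two \<beta> C'(2) eventually_ge_at_top[of 2]
    proof eventually_elim
      case (elim n)
      have n: "1 \<le> real n" "0 < real n" "2 \<le> n" using elim by auto
      have "\<epsilon> n \<le> 2 * C' * real n powr (\<delta> - 1 / 2)"
      proof -
        have "L n * real n powr (- 1 / 2) \<le> C' * real n powr \<delta> * real n powr (- 1 / 2)"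
          using elim by (intro mult_right_mono) auto
        also have "\<dots> = C' * real n powr (\<delta> - 1 / 2)" by (simp add: mult.assoc powr_add[symmetric])
        finally show ?thesis using elim by simp
      qed
      then have "\<epsilon> n powr (4 * \<alpha>) \<le> (2 * C' * real n powr (\<delta> - 1 / 2)) powr (4 * \<alpha>)"
        using \<epsilon>_pos[OF n(3)] \<alpha> by (intro powr_mono2) auto
      also have "\<dots> = (2 * C') powr (4 * \<alpha>) * real n powr ((\<delta> - 1 / 2) * (4 * \<alpha>))"
        using C'(1) by (simp add: powr_mult powr_powr)
      finally have e4: "\<epsilon> n powr (4 * \<alpha>) \<le> (2 * C') powr (4 * \<alpha>) * real n powr ((\<delta> - 1 / 2) * (4 * \<alpha>))" .
      have "(\<beta> n)\<^sup>2 \<le> (D * \<epsilon> n powr (2 * \<alpha>))\<^sup>2"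
        using power_mono[OF elim(2) abs_ge_zero, of 2] by simp
      also have "\<dots> = D\<^sup>2 * \<epsilon> n powr (4 * \<alpha>)"
        using powr_add[of "\<epsilon> n" "2 * \<alpha>" "2 * \<alpha>"] by (simp add: power_mult_distrib power2_eq_square)
      also have "\<dots> \<le> D\<^sup>2 * ((2 * C') powr (4 * \<alpha>) * real n powr ((\<delta> - 1 / 2) * (4 * \<alpha>)))"
        using e4 by (intro mult_left_mono) auto
      finally have "real n * (\<beta> n)\<^sup>2 \<le> real n * (K * real n powr ((\<delta> - 1 / 2) * (4 * \<alpha>)))"
        unfolding K_def by (intro mult_left_mono) (auto simp: mult.assoc)
      also have "\<dots> = K * real n powr (1 + (\<delta> - 1 / 2) * (4 * \<alpha>))"
        using n by (simp add: powr_add)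
      finally have b: "real n * (\<beta> n)\<^sup>2 \<le> K * real n powr (- \<eta>)" unfolding \<eta>(2) .
      have "L n / 2 * real n powr (1 / 2) = real n * (L n * real n powr (- 1 / 2) / 2)"
        using n powr_add[of "real n" 1 "- 1 / 2"] by simp
      also have "\<dots> \<le> real n * \<epsilon> n" using elim n by (intro mult_left_mono) auto
      finally have "1 / (real n * \<epsilon> n) \<le> 1 / (L n / 2 * real n powr (1 / 2))"
        using Lpos[of n] n \<epsilon>_pos[OF n(3)] by (intro divide_left_mono mult_pos_pos) auto
      then have "(1 / (real n * \<epsilon> n))\<^sup>2 \<le> (1 / (L n / 2 * real n powr (1 / 2)))\<^sup>2"
        using n \<epsilon>_pos[OF n(3)] by (intro power_mono) auto
      also have "\<dots> = (2 / L n)\<^sup>2 / real n"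
        using n by (simp add: power_divide power_mult_distrib powr_power)
      finally have "real n * (1 / (real n * \<epsilon> n))\<^sup>2 \<le> real n * ((2 / L n)\<^sup>2 / real n)"
        by (intro mult_left_mono) auto
      then have v: "real n * (1 / (real n * \<epsilon> n))\<^sup>2 \<le> (2 / L n)\<^sup>2" using n by simp
      have "real n * w n \<le> real n * (C * ((\<beta> n)\<^sup>2 + (1 / (real n * \<epsilon> n))\<^sup>2 + (1 / real n)\<^sup>2))"
        using w_le[OF n(3)] d by (intro mult_left_mono) auto
      also have "\<dots> = C * (real n * (\<beta> n)\<^sup>2 + real n * (1 / (real n * \<epsilon> n))\<^sup>2 + 1 / real n)"
        using n by (simp add: algebra_simps power2_eq_square)
      also have "\<dots> \<le> C * (K * real n powr (- \<eta>) + (2 / L n)\<^sup>2 + 1 / real n)"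
        using b v C_nonneg by (intro mult_left_mono add_mono) auto
      finally show ?case .
    qed
    have "(\<lambda>n. 2 / L n) \<longlonglongrightarrow> 0"
      by (intro tendsto_divide_0[OF tendsto_const] filterlim_at_top_imp_at_infinity[OF L(2)])
    moreover have "(\<lambda>n. 1 / real n) \<longlonglongrightarrow> 0" by (rule lim_1_over_n)
    moreover have "(\<lambda>n. real n powr (- \<eta>)) \<longlonglongrightarrow> 0" using \<eta> by real_asymp
    ultimately have "(\<lambda>n. C * (K * real n powr (- \<eta>) + (2 / L n)\<^sup>2 + 1 / real n)) \<longlonglongrightarrow> C * (K * 0 + 0\<^sup>2 + 0)"
      by (intro tendsto_intros)
    then show "(\<lambda>n. C * (K * real n powr (- \<eta>) + (2 / L n)\<^sup>2 + 1 / real n)) \<longlonglongrightarrow> 0" by simp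
  qed
  have "(\<lambda>n. real n * (e n - 4 * \<sigma> / real n)) \<longlonglongrightarrow> 0"
  proof (rule Lim_null_comparison)
    show "eventually (\<lambda>n. norm (real n * (e n - 4 * \<sigma> / real n))
        \<le> 2 * (sqrt (5 * C) * sqrt (real n * w n)) + real n * w n + C / real n + 4 * \<bar>s n - \<sigma>\<bar>) sequentially"
      using eventually_ge_at_top[of 2]
    proof eventually_elim
      case (elim n)
      then have n: "0 < real n" by simp
      have "real n * \<bar>e n - a n - w n\<bar> \<le> real n * (2 * (sqrt (a n) * sqrt (w n)))"
        using e_split[OF elim] by (intro mult_left_mono) auto
      also have "\<dots> = 2 * (sqrt (real n * a n) * sqrt (real n * w n))"
        using n by (simp add: real_sqrt_mult algebra_simps)
      also have "\<dots> \<le> 2 * (sqrt (5 * C) * sqrt (real n * w n))"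
        using a_le[OF elim] w_nonneg[OF elim] n by (intro mult_left_mono mult_right_mono) (auto simp: field_simps)
      finally have 1: "\<bar>real n * (e n - a n - w n)\<bar> \<le> 2 * (sqrt (5 * C) * sqrt (real n * w n))"
        using n by (simp add: abs_mult)
      have "real n * \<bar>a n - 4 * s n / real n\<bar> \<le> real n * (C / (real n)\<^sup>2)"
        using a_approx[OF elim] by (intro mult_left_mono) auto
      then have 2: "\<bar>real n * (a n - 4 * s n / real n)\<bar> \<le> C / real n"
        using n by (simp add: abs_mult power2_eq_square)
      have "real n * (e n - 4 * \<sigma> / real n)
          = real n * (e n - a n - w n) + real n * w n + real n * (a n - 4 * s n / real n) + 4 * (s n - \<sigma>)"
        using n by (simp add: field_simps)
      also have "\<bar>\<dots>\<bar> \<le> 2 * (sqrt (5 * C) * sqrt (real n * w n)) + real n * w n + C / real n + 4 * \<bar>s n - \<sigma>\<bar>"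
      proof -
        have tri: "\<bar>x + z + y + 4 * t\<bar> \<le> X + z + Y + 4 * \<bar>t\<bar>"
          if "\<bar>x\<bar> \<le> X" "\<bar>y\<bar> \<le> Y" "0 \<le> z" for x y z t X Y :: real
          using that by linarith
        show ?thesis using w_nonneg[OF elim] n by (intro tri 1 2) simp
      qed
      finally show ?case by simp
    qed
    have "(\<lambda>n. C / real n) \<longlonglongrightarrow> 0" by real_asymp
    moreover have "(\<lambda>n. s n - \<sigma>) \<longlonglongrightarrow> 0" using s by (simp add: LIM_zero)
    ultimately have "(\<lambda>n. 2 * (sqrt (5 * C) * sqrt (real n * w n)) + real n * w n + C / real n + 4 * \<bar>s n - \<sigma>\<bar>)
      \<longlonglongrightarrow> 2 * (sqrt (5 * C) * sqrt 0) + 0 + 0 + 4 * \<bar>0\<bar>"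
      using nw by (intro tendsto_intros)
    then show "(\<lambda>n. 2 * (sqrt (5 * C) * sqrt (real n * w n)) + real n * w n + C / real n + 4 * \<bar>s n - \<sigma>\<bar>) \<longlonglongrightarrow> 0"
      by simp
  qed
  moreover have "eventually (\<lambda>n. real n * (e n - 4 * \<sigma> / real n) = (e n - 4 * \<sigma> / real n) / (1 / real n)) sequentially"
    by (simp add: mult.commute)
  ultimately show ?thesis
    using eventually_gt_at_top[of 0] by (intro smalloI_tendsto) (auto simp: mult.commute elim: eventually_mono)
qed

end

section \<open>Counting close pairs of points with given densities\<close>

lemma is_densityD:
  assumes "is_density M X p" "p \<in> Lp_fun 3"
  shows "\<And>x. 0 \<le> p x" "distributed M lborel X (\<lambda>x. ennreal (p x))" "p \<in> borel_measurable borel"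
    "integrable lborel (\<lambda>x. p x ^ 3)"
  using assms by (auto simp: is_density_def Lp_fun_def)

text \<open>
  A nonnegative integrable function with integrable cube is square integrable.
\<close>

lemma density_integrable:
  assumes M: "prob_space M" and p: "is_density M X p" "p \<in> Lp_fun 3"
  shows "integrable lborel p" "integrable lborel (\<lambda>x. (p x)\<^sup>2)"
proof -
  interpret prob_space M by fact
  note D = is_densityD[OF p]
  note [measurable] = D(3)
  have "(\<integral>\<^sup>+x. ennreal (p x) \<partial>lborel) = 1"
    using distributed_nn_integral[OF D(2), of "\<lambda>_. 1"] by (simp add: emeasure_space_1)
  then show 1: "integrable lborel p"
    using D(1) by (intro integrableI_nonneg) auto
  have "(p x)\<^sup>2 \<le> p x + p x ^ 3" for x
  proof -
    have "0 \<le> p x * (1 - p x)\<^sup>2 + (p x)\<^sup>2" using D(1)[of x] by simp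
    then show ?thesis by (simp add: power2_eq_square power3_eq_cube algebra_simps)
  qed
  then show "integrable lborel (\<lambda>x. (p x)\<^sup>2)"
    by (intro Bochner_Integration.integrable_bound[OF Bochner_Integration.integrable_add[OF 1 D(4)]])
       (use D(1) in \<open>auto simp: abs_of_nonneg\<close>)
qed

lemma density_square_moment_le:
  assumes M: "prob_space M" and p: "is_density M X p" "p \<in> Lp_fun 3"
    and h [measurable]: "h \<in> borel_measurable borel" and c: "0 \<le> c"
    and le: "(\<integral>\<^sup>+x. ennreal (p x * (h x)\<^sup>2) \<partial>lborel) \<le> ennreal c"
  shows "integrable M (\<lambda>\<omega>. (h (X \<omega>))\<^sup>2)" "(\<integral>\<omega>. (h (X \<omega>))\<^sup>2 \<partial>M) \<le> c"
proof -
  note D = is_densityD[OF p]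
  have [measurable]: "X \<in> borel_measurable M" using distributed_measurable[OF D(2)] by simp
  have "(\<integral>\<^sup>+\<omega>. ennreal ((h (X \<omega>))\<^sup>2) \<partial>M) = (\<integral>\<^sup>+x. ennreal (p x) * ennreal ((h x)\<^sup>2) \<partial>lborel)"
    by (rule distributed_nn_integral[OF D(2), symmetric]) measurable
  also have "\<dots> \<le> ennreal c" using le D(1) by (simp add: ennreal_mult)
  finally have le': "(\<integral>\<^sup>+\<omega>. ennreal ((h (X \<omega>))\<^sup>2) \<partial>M) \<le> ennreal c" .
  show "integrable M (\<lambda>\<omega>. (h (X \<omega>))\<^sup>2)" by (rule integrable_and_integral_le(1)[OF _ _ c le']) auto
  show "(\<integral>\<omega>. (h (X \<omega>))\<^sup>2 \<partial>M) \<le> c" by (rule integrable_and_integral_le(2)[OF _ _ c le']) auto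
qed

text \<open>
  The maps \<open>\<phi>\<close> and \<open>\<psi>\<close> select which component of the process enters as the first and as the second
  point of a pair.  With \<open>\<phi> = fst\<close>, \<open>\<psi> = snd\<close> one counts pairs of one point of each sample, with
  \<open>\<phi> = \<psi> = fst\<close> pairs within the first sample.
\<close>

locale smoothed_pairs = stationary_m_dependent M Z m
  for M :: "'w measure" and Z :: "nat \<Rightarrow> 'w \<Rightarrow> 'b::topological_space" and m +
  fixes \<phi> \<psi> :: "'b \<Rightarrow> 'a::euclidean_space" and f g :: "'a \<Rightarrow> real"
  assumes \<phi> [measurable]: "\<phi> \<in> borel_measurable borel" and \<psi> [measurable]: "\<psi> \<in> borel_measurable borel"
    and f_density: "is_density M (\<lambda>\<omega>. \<phi> (Z 1 \<omega>)) f" and g_density: "is_density M (\<lambda>\<omega>. \<psi> (Z 1 \<omega>)) g"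
    and f_L3: "f \<in> Lp_fun 3" and g_L3: "g \<in> Lp_fun 3"
begin

lemmas f = is_densityD[OF f_density f_L3] density_integrable[OF prob_space_axioms f_density f_L3]
lemmas g = is_densityD[OF g_density g_L3] density_integrable[OF prob_space_axioms g_density g_L3]

declare f(3) [measurable] g(3) [measurable]

definition vol :: "real \<Rightarrow> real" where "vol e = measure lborel (cball (0::'a) e)"

definition ind :: "real \<Rightarrow> 'b \<Rightarrow> 'b \<Rightarrow> real" where
  "ind e x y = of_bool (dist (\<phi> x) (\<psi> y) \<le> e) / vol e"

definition q :: real where "q = (\<integral>x. f x * g x \<partial>lborel)"

definition center :: "real \<Rightarrow> real" where "center e = (\<integral>x. f x * ball_avg e g x \<partial>lborel)"

definition smooth_score :: "real \<Rightarrow> 'b \<Rightarrow> real" where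
  "smooth_score e z = (ball_avg e g (\<phi> z) + ball_avg e f (\<psi> z)) / 2 - center e"

definition limit_score :: "'b \<Rightarrow> real" where
  "limit_score z = (g (\<phi> z) + f (\<psi> z)) / 2 - expectation (\<lambda>\<omega>. (g (\<phi> (Z 1 \<omega>)) + f (\<psi> (Z 1 \<omega>))) / 2)"

definition V :: "real \<Rightarrow> nat \<Rightarrow> 'w \<Rightarrow> real" where
  "V e n \<omega> = 1 / (real n)\<^sup>2 * (\<Sum>i=1..n. \<Sum>j=1..n. ind e (Z i \<omega>) (Z j \<omega>))"

definition linear_part :: "real \<Rightarrow> nat \<Rightarrow> 'w \<Rightarrow> real" where
  "linear_part e n \<omega> = 2 / real n * (\<Sum>i=1..n. smooth_score e (Z i \<omega>))"

text \<open>
  Lag zero is written as \<open>1 + 0\<close> so that all autocovariances have the same form.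
\<close>

definition long_run_variance :: "('b \<Rightarrow> real) \<Rightarrow> real" where
  "long_run_variance G = expectation (\<lambda>\<omega>. G (Z 1 \<omega>) * G (Z (1 + 0) \<omega>))
     + 2 * (\<Sum>h=1..m. expectation (\<lambda>\<omega>. G (Z 1 \<omega>) * G (Z (1 + h) \<omega>)))"

definition score_bound :: real where
  "score_bound = (\<integral>x. f x ^ 3 \<partial>lborel) + (\<integral>x. g x ^ 3 \<partial>lborel)"

lemma vol_pos: "0 < e \<Longrightarrow> 0 < vol e"
  by (simp add: vol_def content_cball_pos)

lemma vol_eq: "0 \<le> e \<Longrightarrow> vol e = vol 1 * e ^ DIM('a)"
  by (simp add: vol_def content_cball)

lemma score_bound_nonneg: "0 \<le> score_bound"
  unfolding score_bound_def using f(1) g(1) by (intro add_nonneg_nonneg integral_nonneg_AE) auto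

lemma bounded_kernel_ind:
  assumes "0 < e"
  shows "bounded_kernel M Z m (ind e) (1 / vol e)"
proof unfold_locales
  show "case_prod (ind e) \<in> borel_measurable (borel \<Otimes>\<^sub>M borel)"
    unfolding ind_def[abs_def] by measurable
  show "\<bar>ind e x y\<bar> \<le> 1 / vol e" for x y
    using vol_pos[OF assms] by (simp add: ind_def)
qed

context
  fixes e :: real
  assumes e: "0 < e"
begin

interpretation K: bounded_kernel M Z m "ind e" "1 / vol e"
  by (rule bounded_kernel_ind[OF e])

lemma u_eq: "K.u z = ball_avg e g (\<phi> z)"
proof -
  have "K.u z = (\<integral>y. g y * (of_bool (dist (\<phi> z) y \<le> e) / vol e) \<partial>lborel)"
    unfolding K.u_def ind_def using g(1)
    by (intro distributed_integral[OF g(2), of "\<lambda>y. of_bool (dist (\<phi> z) y \<le> e) / vol e", symmetric]) auto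
  then show ?thesis using ball_avg_eq_kernel[OF g(3), of e "\<phi> z"] by (simp add: vol_def)
qed

lemma v_eq: "K.v z = ball_avg e f (\<psi> z)"
proof -
  have "K.v z = (\<integral>y. f y * (of_bool (dist y (\<psi> z) \<le> e) / vol e) \<partial>lborel)"
    unfolding K.v_def ind_def using f(1)
    by (intro distributed_integral[OF f(2), of "\<lambda>y. of_bool (dist y (\<psi> z) \<le> e) / vol e", symmetric]) auto
  then show ?thesis using ball_avg_eq_kernel[OF f(3), of e "\<psi> z"] by (simp add: vol_def dist_commute)
qed

lemma \<theta>_eq: "K.\<theta> = center e"
  unfolding K.\<theta>_def u_eq center_def using f(1)
  by (intro distributed_integral[OF f(2), of "ball_avg e g", symmetric]) (auto intro!: ball_avg_measurable e)

text \<open>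
  Both sides are the mean of the counting kernel at two independent points.
\<close>

lemma center_swap: "(\<integral>x. g x * ball_avg e f x \<partial>lborel) = (\<integral>x. f x * ball_avg e g x \<partial>lborel)"
proof -
  have "K.\<theta> = (\<integral>x. g x * ball_avg e f x \<partial>lborel)"
    unfolding K.\<theta>_eq_v v_eq using g(1)
    by (intro distributed_integral[OF g(2), of "ball_avg e f", symmetric]) (auto intro!: ball_avg_measurable e)
  then show ?thesis by (simp add: \<theta>_eq center_def)
qed

lemma smooth_score_eq: "smooth_score e = (\<lambda>z. (K.u z + K.v z) / 2 - K.\<theta>)"
  by (simp add: smooth_score_def[abs_def] u_eq v_eq \<theta>_eq)

lemma smooth_score_measurable: "smooth_score e \<in> borel_measurable borel"
  unfolding smooth_score_eq by measurable

lemma smooth_score_bound: "\<bar>smooth_score e z\<bar> \<le> 2 / vol e"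
  using K.u_bound[of z] K.v_bound[of z] K.\<theta>_bound unfolding smooth_score_eq by (simp add: field_simps)

lemma smooth_mean:
  "integrable M (\<lambda>\<omega>. (ball_avg e g (\<phi> (Z 1 \<omega>)) + ball_avg e f (\<psi> (Z 1 \<omega>))) / 2)"
  "expectation (\<lambda>\<omega>. (ball_avg e g (\<phi> (Z 1 \<omega>)) + ball_avg e f (\<psi> (Z 1 \<omega>))) / 2) = center e"
proof -
  have i: "integrable M (\<lambda>\<omega>. K.u (Z 1 \<omega>))" "integrable M (\<lambda>\<omega>. K.v (Z 1 \<omega>))"
    by (auto intro!: K.integrable_bounded K.u_bound K.v_bound)
  then show "integrable M (\<lambda>\<omega>. (ball_avg e g (\<phi> (Z 1 \<omega>)) + ball_avg e f (\<psi> (Z 1 \<omega>))) / 2)"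
    by (simp add: u_eq v_eq)
  show "expectation (\<lambda>\<omega>. (ball_avg e g (\<phi> (Z 1 \<omega>)) + ball_avg e f (\<psi> (Z 1 \<omega>))) / 2) = center e"
    using i K.\<theta>_def K.\<theta>_eq_v by (simp add: u_eq[symmetric] v_eq[symmetric] \<theta>_eq)
qed

lemma smooth_score_centred: "expectation (\<lambda>\<omega>. smooth_score e (Z 1 \<omega>)) = 0"
  unfolding smooth_score_def using smooth_mean by (simp add: prob_space)

lemma remainder_second_moment:
  assumes n: "1 \<le> n"
  shows "(\<lambda>\<omega>. V e n \<omega> - q - linear_part e n \<omega>) \<in> borel_measurable M"
    and "integrable M (\<lambda>\<omega>. (V e n \<omega> - q - linear_part e n \<omega>)\<^sup>2)"
    and "expectation (\<lambda>\<omega>. (V e n \<omega> - q - linear_part e n \<omega>)\<^sup>2)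
      \<le> 320 * (2 * real m + 1)\<^sup>2 * ((center e - q)\<^sup>2 + (1 / (real n * vol e))\<^sup>2)"
proof -
  define R where "R \<omega> = (\<Sum>i=1..n. \<Sum>j=1..n. K.r (Z i \<omega>) (Z j \<omega>))" for \<omega>
  have eq: "V e n \<omega> - q - linear_part e n \<omega> = (center e - q) + 1 / (real n)\<^sup>2 * R \<omega>" for \<omega>
    using K.hoeffding_decomposition[OF n, of \<omega>]
    by (simp add: V_def linear_part_def smooth_score_eq R_def \<theta>_eq)
  have R [measurable]: "R \<in> borel_measurable M"
    unfolding R_def[abs_def]
    by (intro borel_measurable_sum K.r_comp_measurable Z_measurable) auto
  have R_le: "\<bar>R \<omega>\<bar> \<le> (\<Sum>i=1..n. \<Sum>j=1..n. 4 * (1 / vol e))" for \<omega>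
    unfolding R_def by (intro order_trans[OF sum_abs] sum_mono K.r_bound)
  have R2: "integrable M (\<lambda>\<omega>. (R \<omega>)\<^sup>2)"
  proof (rule K.integrable_bounded)
    show "\<bar>(R \<omega>)\<^sup>2\<bar> \<le> (\<Sum>i=1..n. \<Sum>j=1..n. 4 * (1 / vol e))\<^sup>2" for \<omega>
      using power_mono[OF R_le[of \<omega>] abs_ge_zero, of 2] by simp
  qed measurable
  show "(\<lambda>\<omega>. V e n \<omega> - q - linear_part e n \<omega>) \<in> borel_measurable M" unfolding eq by measurable
  show W2: "integrable M (\<lambda>\<omega>. (V e n \<omega> - q - linear_part e n \<omega>)\<^sup>2)" unfolding eq
    by (rule integrable_square_add) (use R2 in \<open>auto simp: power_mult_distrib power_divide\<close>)
  have "expectation (\<lambda>\<omega>. (V e n \<omega> - q - linear_part e n \<omega>)\<^sup>2)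
      \<le> expectation (\<lambda>\<omega>. 2 * (center e - q)\<^sup>2 + 2 * (1 / (real n)\<^sup>2)\<^sup>2 * (R \<omega>)\<^sup>2)"
  proof (rule integral_mono[OF W2])
    show "(V e n \<omega> - q - linear_part e n \<omega>)\<^sup>2 \<le> 2 * (center e - q)\<^sup>2 + 2 * (1 / (real n)\<^sup>2)\<^sup>2 * (R \<omega>)\<^sup>2" for \<omega>
      unfolding eq using square_diff_le[of "center e - q" "- (1 / (real n)\<^sup>2 * R \<omega>)"]
      by (simp add: power_mult_distrib power_divide)
  qed (use R2 in auto)
  also have "\<dots> = 2 * (center e - q)\<^sup>2 + 2 * (1 / (real n)\<^sup>2)\<^sup>2 * expectation (\<lambda>\<omega>. (R \<omega>)\<^sup>2)"
    using R2 by (simp add: prob_space)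
  also have "\<dots> \<le> 2 * (center e - q)\<^sup>2 + 2 * (1 / (real n)\<^sup>2)\<^sup>2 * (160 * (2 * real m + 1)\<^sup>2 * (1 / vol e)\<^sup>2 * (real n)\<^sup>2)"
    using K.degenerate_second_moment[of n] unfolding R_def by (intro add_left_mono mult_left_mono) auto
  also have "\<dots> = 2 * (center e - q)\<^sup>2 + 320 * (2 * real m + 1)\<^sup>2 * (1 / (real n * vol e))\<^sup>2"
    using n by (simp add: power_mult_distrib power_divide power2_eq_square)
  also have "\<dots> \<le> 320 * (2 * real m + 1)\<^sup>2 * ((center e - q)\<^sup>2 + (1 / (real n * vol e))\<^sup>2)"
  proof -
    have "1 \<le> (2 * real m + 1)\<^sup>2" by (simp add: power2_eq_square algebra_simps)
    then have "2 \<le> 320 * (2 * real m + 1)\<^sup>2" by linarith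
    then have "2 * (center e - q)\<^sup>2 \<le> 320 * (2 * real m + 1)\<^sup>2 * (center e - q)\<^sup>2"
      by (rule mult_right_mono) simp
    then show ?thesis by (simp add: distrib_left)
  qed
  finally show "expectation (\<lambda>\<omega>. (V e n \<omega> - q - linear_part e n \<omega>)\<^sup>2)
      \<le> 320 * (2 * real m + 1)\<^sup>2 * ((center e - q)\<^sup>2 + (1 / (real n * vol e))\<^sup>2)" .
qed

text \<open>
  The bound does not depend on the bandwidth, although the score itself may be of the order of
  the reciprocal of the volume of the ball.
\<close>

lemma smooth_score_second_moment:
  "expectation (\<lambda>\<omega>. smooth_score e (Z 1 \<omega>) * smooth_score e (Z (1 + 0) \<omega>)) \<le> score_bound"
proof -
  note [measurable] = ball_avg_measurable[OF g(3) e] ball_avg_measurable[OF f(3) e]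
  define D where "D \<omega> = (ball_avg e g (\<phi> (Z 1 \<omega>)) + ball_avg e f (\<psi> (Z 1 \<omega>))) / 2" for \<omega>
  note U = density_square_moment_le[OF prob_space_axioms f_density f_L3 ball_avg_measurable[OF g(3) e] score_bound_nonneg
    nn_integral_ball_avg_square_le[OF f(3) g(3) f(1) g(1) e f(4) g(4), folded score_bound_def]]
  note V = density_square_moment_le[OF prob_space_axioms g_density g_L3 ball_avg_measurable[OF f(3) e] score_bound_nonneg
    nn_integral_ball_avg_square_le[OF g(3) f(3) g(1) f(1) e g(4) f(4), unfolded add.commute[of "integral\<^sup>L lborel (\<lambda>x. g x ^ 3)"], folded score_bound_def]]
  have D_le: "(D \<omega>)\<^sup>2 \<le> ((ball_avg e g (\<phi> (Z 1 \<omega>)))\<^sup>2 + (ball_avg e f (\<psi> (Z 1 \<omega>)))\<^sup>2) / 2" for \<omega>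
    using square_diff_le[of "ball_avg e g (\<phi> (Z 1 \<omega>))" "- ball_avg e f (\<psi> (Z 1 \<omega>))"]
    by (simp add: D_def power_divide)
  have [measurable]: "D \<in> borel_measurable M" unfolding D_def[abs_def] using Z_measurable[of 1] by measurable
  have D2: "integrable M (\<lambda>\<omega>. (D \<omega>)\<^sup>2)"
    by (rule Bochner_Integration.integrable_bound[of _ "\<lambda>\<omega>. ((ball_avg e g (\<phi> (Z 1 \<omega>)))\<^sup>2 + (ball_avg e f (\<psi> (Z 1 \<omega>)))\<^sup>2) / 2"])
       (use U(1) V(1) D_le in auto)
  have ED: "expectation D = center e" using smooth_mean(2) unfolding D_def .
  have "expectation (\<lambda>\<omega>. smooth_score e (Z 1 \<omega>) * smooth_score e (Z (1 + 0) \<omega>)) = variance D"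
    unfolding ED smooth_score_def D_def[symmetric] add_0_right power2_eq_square ..
  also have "\<dots> = expectation (\<lambda>\<omega>. (D \<omega>)\<^sup>2) - (expectation D)\<^sup>2"
    using D2 smooth_mean(1) by (intro variance_eq) (auto simp: D_def)
  also have "\<dots> \<le> expectation (\<lambda>\<omega>. (D \<omega>)\<^sup>2)" by simp
  also have "\<dots> \<le> expectation (\<lambda>\<omega>. ((ball_avg e g (\<phi> (Z 1 \<omega>)))\<^sup>2 + (ball_avg e f (\<psi> (Z 1 \<omega>)))\<^sup>2) / 2)"
    using D2 U(1) V(1) D_le by (intro integral_mono) auto
  also have "\<dots> \<le> score_bound" using U V by simp
  finally show ?thesis .
qed

lemma linear_part_second_moment:
  assumes n: "1 \<le> n"
  shows "linear_part e n \<in> borel_measurable M" "integrable M (\<lambda>\<omega>. (linear_part e n \<omega>)\<^sup>2)"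
    and "\<bar>expectation (\<lambda>\<omega>. (linear_part e n \<omega>)\<^sup>2) - 4 * long_run_variance (smooth_score e) / real n\<bar>
      \<le> 8 * real m ^ 2 * score_bound / (real n)\<^sup>2"
    and "\<bar>long_run_variance (smooth_score e)\<bar> \<le> (1 + 2 * real m) * score_bound"
proof -
  define S where "S \<omega> = (\<Sum>i=1..n. smooth_score e (Z i \<omega>))" for \<omega>
  note L = second_moment_sum_approx[OF smooth_score_measurable smooth_score_bound smooth_score_centred,
    folded long_run_variance_def]
  have S [measurable]: "S \<in> borel_measurable M" unfolding S_def[abs_def]
    by (intro borel_measurable_sum measurable_compose[OF Z_measurable smooth_score_measurable]) auto
  have S_le: "\<bar>S \<omega>\<bar> \<le> (\<Sum>i=1..n. 2 / vol e)" for \<omega>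
    unfolding S_def by (intro order_trans[OF sum_abs] sum_mono smooth_score_bound)
  have S2: "integrable M (\<lambda>\<omega>. (S \<omega>)\<^sup>2)"
  proof (rule K.integrable_bounded)
    show "\<bar>(S \<omega>)\<^sup>2\<bar> \<le> (\<Sum>i=1..n. 2 / vol e)\<^sup>2" for \<omega>
      using power_mono[OF S_le[of \<omega>] abs_ge_zero, of 2] by simp
  qed measurable
  have lin: "linear_part e n = (\<lambda>\<omega>. 2 / real n * S \<omega>)" by (simp add: fun_eq_iff linear_part_def S_def)
  show "linear_part e n \<in> borel_measurable M" unfolding lin by measurable
  show "integrable M (\<lambda>\<omega>. (linear_part e n \<omega>)\<^sup>2)"
    unfolding lin power_mult_distrib using S2 by simp
  have "expectation (\<lambda>\<omega>. (linear_part e n \<omega>)\<^sup>2) = 4 / (real n)\<^sup>2 * expectation (\<lambda>\<omega>. (S \<omega>)\<^sup>2)"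
    unfolding lin power_mult_distrib by (simp add: power_divide)
  moreover have "4 * long_run_variance (smooth_score e) / real n
      = 4 / (real n)\<^sup>2 * (real n * long_run_variance (smooth_score e))"
    using n by (simp add: power2_eq_square)
  ultimately have "\<bar>expectation (\<lambda>\<omega>. (linear_part e n \<omega>)\<^sup>2) - 4 * long_run_variance (smooth_score e) / real n\<bar>
      = 4 / (real n)\<^sup>2 * \<bar>expectation (\<lambda>\<omega>. (S \<omega>)\<^sup>2) - real n * long_run_variance (smooth_score e)\<bar>"
    by (simp add: right_diff_distrib[symmetric] abs_mult del: times_divide_eq_left times_divide_eq_right)
  also have "\<dots> \<le> 4 / (real n)\<^sup>2 * (2 * real m ^ 2 * score_bound)"
    using order_trans[OF L(1)[of n] mult_left_mono[OF smooth_score_second_moment]]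
    unfolding S_def by (intro mult_left_mono) auto
  finally show "\<bar>expectation (\<lambda>\<omega>. (linear_part e n \<omega>)\<^sup>2) - 4 * long_run_variance (smooth_score e) / real n\<bar>
      \<le> 8 * real m ^ 2 * score_bound / (real n)\<^sup>2" by simp
  show "\<bar>long_run_variance (smooth_score e)\<bar> \<le> (1 + 2 * real m) * score_bound"
    using order_trans[OF L(2) mult_left_mono[OF smooth_score_second_moment]] by simp
qed

end

lemma limit_score_measurable: "limit_score \<in> borel_measurable borel"
  unfolding limit_score_def[abs_def] by measurable

lemma limit_square_moments:
  "integrable M (\<lambda>\<omega>. (g (\<phi> (Z 1 \<omega>)))\<^sup>2)" "integrable M (\<lambda>\<omega>. (f (\<psi> (Z 1 \<omega>)))\<^sup>2)"
proof -
  have le: "(\<integral>\<^sup>+x. ennreal (p x * (p' x)\<^sup>2) \<partial>lborel) \<le> ennreal ((\<integral>x. p x ^ 3 \<partial>lborel) + (\<integral>x. p' x ^ 3 \<partial>lborel))"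
    if "p \<in> borel_measurable borel" "p' \<in> borel_measurable borel" "\<And>x. 0 \<le> p x" "\<And>x. 0 \<le> p' x"
      "integrable lborel (\<lambda>x. p x ^ 3)" "integrable lborel (\<lambda>x. p' x ^ 3)" for p p' :: "'a \<Rightarrow> real"
    using nn_integral_mult_square_le_cubes[of p p' 1] that by simp
  show "integrable M (\<lambda>\<omega>. (g (\<phi> (Z 1 \<omega>)))\<^sup>2)"
    by (rule density_square_moment_le(1)[OF prob_space_axioms f_density f_L3 g(3) _ le])
       (use f g in \<open>auto intro!: add_nonneg_nonneg integral_nonneg_AE\<close>)
  show "integrable M (\<lambda>\<omega>. (f (\<psi> (Z 1 \<omega>)))\<^sup>2)"
    by (rule density_square_moment_le(1)[OF prob_space_axioms g_density g_L3 f(3) _ le])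
       (use f g in \<open>auto intro!: add_nonneg_nonneg integral_nonneg_AE\<close>)
qed

lemma integrable_of_square:
  assumes "h \<in> borel_measurable M" "integrable M (\<lambda>\<omega>. (h \<omega>)\<^sup>2)"
  shows "integrable M (h :: 'w \<Rightarrow> real)"
  using Cauchy_Schwarz_integral(1)[of h M "\<lambda>_. 1"] assms by simp

lemma Z1_compose_measurable:
  "h \<in> borel_measurable borel \<Longrightarrow> (\<lambda>\<omega>. h (\<phi> (Z 1 \<omega>)) :: real) \<in> borel_measurable M"
  "h \<in> borel_measurable borel \<Longrightarrow> (\<lambda>\<omega>. h (\<psi> (Z 1 \<omega>)) :: real) \<in> borel_measurable M"
  using measurable_compose[OF measurable_compose[OF Z_measurable[OF order_refl] \<phi>]]
    measurable_compose[OF measurable_compose[OF Z_measurable[OF order_refl] \<psi>]] by auto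

lemma limit_score_square_integrable: "integrable M (\<lambda>\<omega>. (limit_score (Z 1 \<omega>))\<^sup>2)"
proof -
  have "integrable M (\<lambda>\<omega>. ((g (\<phi> (Z 1 \<omega>)) + f (\<psi> (Z 1 \<omega>))) / 2)\<^sup>2)"
    using integrable_square_add[OF Z1_compose_measurable(1)[OF g(3)] Z1_compose_measurable(2)[OF f(3)] limit_square_moments]
    by (simp add: power_divide)
  then show ?thesis unfolding limit_score_def
    by (intro integrable_square_diff borel_measurable_divide borel_measurable_add borel_measurable_const
        Z1_compose_measurable f(3) g(3)) auto
qed

text \<open>
  Up to centring, the difference of the two scores is half the sum of the smoothing errors of the two
  densities, and centring only decreases a second moment.
\<close>

lemma smooth_score_L2_convergence:
  "((\<lambda>e. expectation (\<lambda>\<omega>. (smooth_score e (Z 1 \<omega>) - limit_score (Z 1 \<omega>))\<^sup>2)) \<longlongrightarrow> 0) (at_right 0)"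
proof (rule tendstoI)
  fix \<delta> :: real assume \<delta>: "0 < \<delta>"
  obtain r1 where r1: "0 < r1" "\<And>e. 0 < e \<and> e < r1 \<Longrightarrow>
      (\<integral>\<^sup>+x. ennreal (f x * (ball_avg e g x - g x)\<^sup>2) \<partial>lborel) \<le> ennreal (\<delta> / 2)"
    using nn_integral_ball_avg_diff_square_tendsto_0[OF f(3) g(3) f(1) g(1) g(5) f(4) g(4), of "\<delta> / 2"] \<delta> by auto
  obtain r2 where r2: "0 < r2" "\<And>e. 0 < e \<and> e < r2 \<Longrightarrow>
      (\<integral>\<^sup>+x. ennreal (g x * (ball_avg e f x - f x)\<^sup>2) \<partial>lborel) \<le> ennreal (\<delta> / 2)"
    using nn_integral_ball_avg_diff_square_tendsto_0[OF g(3) f(3) g(1) f(1) f(5) g(4) f(4), of "\<delta> / 2"] \<delta> by auto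
  have "eventually (\<lambda>e. 0 < e \<and> e < min r1 r2) (at_right 0)"
    using r1(1) r2(1) by (auto simp: eventually_at_right_field intro!: exI[of _ "min r1 r2"])
  then show "\<forall>\<^sub>F e in at_right 0. dist (expectation (\<lambda>\<omega>. (smooth_score e (Z 1 \<omega>) - limit_score (Z 1 \<omega>))\<^sup>2)) 0 < \<delta>"
  proof eventually_elim
    case (elim e)
    then have e: "0 < e" "0 < e \<and> e < r1" "0 < e \<and> e < r2" by auto
    note mg = ball_avg_measurable[OF g(3) e(1)] and mf = ball_avg_measurable[OF f(3) e(1)]
    define U where "U \<omega> = ball_avg e g (\<phi> (Z 1 \<omega>)) - g (\<phi> (Z 1 \<omega>))" for \<omega>
    define T where "T \<omega> = ball_avg e f (\<psi> (Z 1 \<omega>)) - f (\<psi> (Z 1 \<omega>))" for \<omega>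
    have meas [measurable]: "U \<in> borel_measurable M" "T \<in> borel_measurable M"
      unfolding U_def[abs_def] T_def[abs_def]
      by (intro borel_measurable_diff Z1_compose_measurable mg mf f(3) g(3))+
    have U: "integrable M (\<lambda>\<omega>. (U \<omega>)\<^sup>2)" "expectation (\<lambda>\<omega>. (U \<omega>)\<^sup>2) \<le> \<delta> / 2"
      using density_square_moment_le[OF prob_space_axioms f_density f_L3 borel_measurable_diff[OF mg g(3)] _ r1(2)[OF e(2)]] \<delta>
      by (auto simp: U_def)
    have T: "integrable M (\<lambda>\<omega>. (T \<omega>)\<^sup>2)" "expectation (\<lambda>\<omega>. (T \<omega>)\<^sup>2) \<le> \<delta> / 2"
      using density_square_moment_le[OF prob_space_axioms g_density g_L3 borel_measurable_diff[OF mf f(3)] _ r2(2)[OF e(3)]] \<delta>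
      by (auto simp: T_def)
    define D where "D \<omega> = (U \<omega> + T \<omega>) / 2" for \<omega>
    have [measurable]: "D \<in> borel_measurable M" unfolding D_def[abs_def] by measurable
    have D_le: "(D \<omega>)\<^sup>2 \<le> ((U \<omega>)\<^sup>2 + (T \<omega>)\<^sup>2) / 2" for \<omega>
      using square_diff_le[of "U \<omega>" "- T \<omega>"] by (simp add: D_def power_divide)
    have D2: "integrable M (\<lambda>\<omega>. (D \<omega>)\<^sup>2)"
      by (rule Bochner_Integration.integrable_bound[of _ "\<lambda>\<omega>. ((U \<omega>)\<^sup>2 + (T \<omega>)\<^sup>2) / 2"]) (use U(1) T(1) D_le in auto)
    have D1: "integrable M D" by (rule integrable_of_square[OF _ D2]) measurable
    define P where "P \<omega> = (ball_avg e g (\<phi> (Z 1 \<omega>)) + ball_avg e f (\<psi> (Z 1 \<omega>))) / 2" for \<omega>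
    define P' where "P' \<omega> = (g (\<phi> (Z 1 \<omega>)) + f (\<psi> (Z 1 \<omega>))) / 2" for \<omega>
    have iP': "integrable M P'"
      unfolding P'_def[abs_def]
      by (intro integrable_divide_zero Bochner_Integration.integrable_add
          integrable_of_square[OF Z1_compose_measurable(1)[OF g(3)] limit_square_moments(1)]
          integrable_of_square[OF Z1_compose_measurable(2)[OF f(3)] limit_square_moments(2)])
    have iP: "integrable M P" "expectation P = center e"
      using smooth_mean[OF e(1)] unfolding P_def by auto
    have PD: "D = (\<lambda>\<omega>. P \<omega> - P' \<omega>)"
      by (simp add: fun_eq_iff D_def P_def P'_def U_def T_def field_simps)
    have ED: "expectation D = center e - expectation P'"
      unfolding PD using iP iP' by simp
    have "smooth_score e (Z 1 \<omega>) - limit_score (Z 1 \<omega>) = D \<omega> - expectation D" for \<omega>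
    proof -
      have "smooth_score e (Z 1 \<omega>) = P \<omega> - center e" unfolding smooth_score_def P_def ..
      moreover have "limit_score (Z 1 \<omega>) = P' \<omega> - expectation P'" unfolding limit_score_def P'_def ..
      ultimately show ?thesis unfolding ED unfolding PD by simp
    qed
    then have "expectation (\<lambda>\<omega>. (smooth_score e (Z 1 \<omega>) - limit_score (Z 1 \<omega>))\<^sup>2) = variance D"
      by simp
    also have "\<dots> = expectation (\<lambda>\<omega>. (D \<omega>)\<^sup>2) - (expectation D)\<^sup>2"
      using D1 D2 by (rule variance_eq)
    also have "\<dots> \<le> expectation (\<lambda>\<omega>. (D \<omega>)\<^sup>2)" by simp
    also have "\<dots> \<le> expectation (\<lambda>\<omega>. ((U \<omega>)\<^sup>2 + (T \<omega>)\<^sup>2) / 2)"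
      using D2 U(1) T(1) D_le by (intro integral_mono) auto
    also have "\<dots> = (expectation (\<lambda>\<omega>. (U \<omega>)\<^sup>2) + expectation (\<lambda>\<omega>. (T \<omega>)\<^sup>2)) / 2"
      using U(1) T(1) by simp
    also have "\<dots> \<le> (\<delta> / 2 + \<delta> / 2) / 2"
      by (intro divide_right_mono add_mono U(2) T(2)) simp
    also have "\<dots> < \<delta>" using \<delta> by simp
    finally show ?case by (simp add: abs_of_nonneg)
  qed
qed

lemma long_run_variance_tendsto:
  assumes \<epsilon>: "\<And>n. 1 \<le> n \<Longrightarrow> 0 < \<epsilon> n" "\<epsilon> \<longlonglongrightarrow> 0"
  shows "(\<lambda>n. long_run_variance (smooth_score (\<epsilon> n))) \<longlonglongrightarrow> long_run_variance limit_score"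
proof -
  \<comment> \<open>a positive version of the bandwidth, so that every member of the family is square integrable\<close>
  define \<epsilon>' where "\<epsilon>' n = \<epsilon> (max 1 n)" for n
  have \<epsilon>'_pos: "0 < \<epsilon>' n" for n using \<epsilon>(1)[of "max 1 n"] by (simp add: \<epsilon>'_def)
  have ev: "eventually (\<lambda>n. \<epsilon>' n = \<epsilon> n) sequentially"
    using eventually_ge_at_top[of 1] by eventually_elim (simp add: \<epsilon>'_def max_def)
  have "\<epsilon>' \<longlonglongrightarrow> 0" using \<epsilon>(2) by (rule Lim_transform_eventually) (use ev in \<open>auto elim: eventually_mono\<close>)
  then have right: "filterlim \<epsilon>' (at_right 0) sequentially"
    using \<epsilon>'_pos by (intro tendsto_imp_filterlim_at_right) auto
  have L2: "(\<lambda>n. expectation (\<lambda>\<omega>. (smooth_score (\<epsilon>' n) (Z j \<omega>) - limit_score (Z j \<omega>))\<^sup>2)) \<longlonglongrightarrow> 0" if "1 \<le> j" for j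
  proof -
    have "expectation (\<lambda>\<omega>. (smooth_score (\<epsilon>' n) (Z j \<omega>) - limit_score (Z j \<omega>))\<^sup>2)
        = expectation (\<lambda>\<omega>. (smooth_score (\<epsilon>' n) (Z 1 \<omega>) - limit_score (Z 1 \<omega>))\<^sup>2)" for n
      using smooth_score_measurable[OF \<epsilon>'_pos] limit_score_measurable
      by (intro expectation_shift1[OF that, of "\<lambda>z. (smooth_score (\<epsilon>' n) z - limit_score z)\<^sup>2"]) auto
    then show ?thesis using filterlim_compose[OF smooth_score_L2_convergence right] by simp
  qed
  have meas: "(\<lambda>\<omega>. smooth_score (\<epsilon>' n) (Z j \<omega>)) \<in> borel_measurable M" "(\<lambda>\<omega>. limit_score (Z j \<omega>)) \<in> borel_measurable M"
    if "1 \<le> j" for n j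
    using measurable_compose[OF Z_measurable[OF that] smooth_score_measurable[OF \<epsilon>'_pos]]
      measurable_compose[OF Z_measurable[OF that] limit_score_measurable] by auto
  have sq: "integrable M (\<lambda>\<omega>. (smooth_score (\<epsilon>' n) (Z j \<omega>))\<^sup>2)" if "1 \<le> j" for n j
  proof (rule integrable_const_bound[where B="(2 / vol (\<epsilon>' n))\<^sup>2"])
    show "AE \<omega> in M. norm ((smooth_score (\<epsilon>' n) (Z j \<omega>))\<^sup>2) \<le> (2 / vol (\<epsilon>' n))\<^sup>2"
      using power_mono[OF smooth_score_bound[OF \<epsilon>'_pos] abs_ge_zero, of n _ 2] by simp
  qed (use meas[OF that] in auto)
  have sq': "integrable M (\<lambda>\<omega>. (limit_score (Z j \<omega>))\<^sup>2)" if "1 \<le> j" for j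
  proof -
    have "distr M borel (Z j) = distr M borel (Z 1)"
    proof (rule measure_eqI)
      fix A assume "A \<in> sets (distr M borel (Z j))"
      then have A [measurable]: "A \<in> sets borel" by simp
      have "expectation (\<lambda>\<omega>. indicator A (Z j \<omega>) :: real) = expectation (\<lambda>\<omega>. indicator A (Z 1 \<omega>))"
        by (rule expectation_shift1[OF that]) measurable
      moreover have "expectation (\<lambda>\<omega>. indicator A (Z i \<omega>) :: real) = measure (distr M borel (Z i)) A" if "1 \<le> i" for i
        using that Z_measurable by (subst integral_distr[symmetric, where f="indicator A"]) auto
      ultimately show "emeasure (distr M borel (Z j)) A = emeasure (distr M borel (Z 1)) A"
        using that Z_measurable
        by (simp add: finite_measure.emeasure_eq_measure[OF prob_space.finite_measure[OF prob_space_distr]])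
    qed simp
    moreover have "integrable M (\<lambda>\<omega>. (limit_score (Z i \<omega>))\<^sup>2) \<longleftrightarrow> integrable (distr M borel (Z i)) (\<lambda>z. (limit_score z)\<^sup>2)"
      if "1 \<le> i" for i
      using that Z_measurable limit_score_measurable by (subst integrable_distr_eq) auto
    ultimately show ?thesis using limit_score_square_integrable that by simp
  qed
  have "(\<lambda>n. expectation (\<lambda>\<omega>. smooth_score (\<epsilon>' n) (Z 1 \<omega>) * smooth_score (\<epsilon>' n) (Z (1 + h) \<omega>)))
    \<longlonglongrightarrow> expectation (\<lambda>\<omega>. limit_score (Z 1 \<omega>) * limit_score (Z (1 + h) \<omega>))" for h
    by (intro integral_mult_tendsto_of_L2 meas sq sq' L2) auto
  then have "(\<lambda>n. long_run_variance (smooth_score (\<epsilon>' n))) \<longlonglongrightarrow> long_run_variance limit_score"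
    unfolding long_run_variance_def by (intro tendsto_add tendsto_mult tendsto_const tendsto_sum)
  then show ?thesis
    by (rule Lim_transform_eventually) (use ev in \<open>auto elim: eventually_mono\<close>)
qed

text \<open>
  For \<open>w\<close> the uncentred score, this is the form in which the asymptotic variance is defined.
\<close>

lemma long_run_variance_limit:
  fixes w :: "'b \<Rightarrow> real"
  assumes w: "\<And>z. w z = (g (\<phi> z) + f (\<psi> z)) / 2"
  shows "long_run_variance limit_score = variance (\<lambda>\<omega>. w (Z 1 \<omega>))
    + 2 * (\<Sum>h=1..m. covar M (\<lambda>\<omega>. w (Z 1 \<omega>)) (\<lambda>\<omega>. w (Z (1 + h) \<omega>)))"
proof -
  have [measurable]: "w \<in> borel_measurable borel" unfolding w[abs_def] by measurable
  have ls: "limit_score z = w z - expectation (\<lambda>\<omega>. w (Z 1 \<omega>))" for z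
    by (simp add: limit_score_def w)
  have mean: "expectation (\<lambda>\<omega>. w (Z (1 + h) \<omega>)) = expectation (\<lambda>\<omega>. w (Z 1 \<omega>))" for h
    by (rule expectation_shift1) auto
  show ?thesis
    unfolding long_run_variance_def covar_def ls mean add_0_right power2_eq_square by (rule refl)
qed

lemma bias_tendsto_0:
  assumes \<epsilon>: "\<And>n. 1 \<le> n \<Longrightarrow> 0 < \<epsilon> n" "\<epsilon> \<longlonglongrightarrow> 0"
  shows "(\<lambda>n. center (\<epsilon> n) - q) \<longlonglongrightarrow> 0"
proof -
  have "filterlim \<epsilon> (at_right 0) sequentially"
    using \<epsilon> by (intro tendsto_imp_filterlim_at_right) (auto simp: eventually_sequentially)
  moreover have "(center \<longlongrightarrow> q) (at_right 0)"
    unfolding center_def[abs_def] q_def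
    by (rule smoothing_bias_tendsto_0) (use f g center_swap in auto)
  ultimately have "(\<lambda>n. center (\<epsilon> n)) \<longlonglongrightarrow> q" by (rule filterlim_compose[rotated])
  then show ?thesis by (simp add: LIM_zero)
qed

lemma bias_le_of_H2:
  assumes e: "0 < e" "e \<le> 1" and \<alpha>: "0 < \<alpha>" and K: "0 < K"
    and H2: "f \<in> H2_class \<alpha> K" "g \<in> H2_class \<alpha> K"
  shows "\<bar>center e - q\<bar> \<le> K\<^sup>2 / 2 * e powr (2 * \<alpha>)"
proof -
  have le: "(\<integral>x. (p (x - h) - p x)\<^sup>2 \<partial>lborel) \<le> K\<^sup>2 * e powr (2 * \<alpha>)"
    if "p \<in> H2_class \<alpha> K" "norm h \<le> e" for p :: "'a \<Rightarrow> real" and h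
  proof -
    have "sqrt (\<integral>x. (p (x - h) - p x)\<^sup>2 \<partial>lborel) \<le> K * norm h powr \<alpha>"
      using that e by (simp add: H2_class_def)
    also have "\<dots> \<le> K * e powr \<alpha>"
      using that K \<alpha> by (intro mult_left_mono powr_mono2) auto
    finally have "(sqrt (\<integral>x. (p (x - h) - p x)\<^sup>2 \<partial>lborel))\<^sup>2 \<le> (K * e powr \<alpha>)\<^sup>2"
      by (intro power_mono) auto
    also have "\<dots> = K\<^sup>2 * e powr (2 * \<alpha>)"
      using powr_add[of e \<alpha> \<alpha>] by (simp add: power_mult_distrib power2_eq_square)
    finally show ?thesis by simp
  qed
  have "\<bar>center e - q\<bar> \<le> K\<^sup>2 * e powr (2 * \<alpha>) / 2"
    unfolding center_def q_def
    by (rule smoothing_bias_le) (use f g e center_swap le H2 in auto)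
  then show ?thesis by simp
qed

text \<open>
  Any estimator that differs from the linear part by a small remainder satisfies the numerical bounds;
  the mixed term is handled by Cauchy-Schwarz.
\<close>

lemma error_bounds_of_remainder:
  fixes T :: "nat \<Rightarrow> 'w \<Rightarrow> real"
  assumes \<epsilon>: "\<And>n. 1 \<le> n \<Longrightarrow> 0 < \<epsilon> n"
  defines "W \<equiv> \<lambda>n \<omega>. T n \<omega> - q - linear_part (\<epsilon> n) n \<omega>"
  assumes W: "\<And>n. 2 \<le> n \<Longrightarrow> W n \<in> borel_measurable M" "\<And>n. 2 \<le> n \<Longrightarrow> integrable M (\<lambda>\<omega>. (W n \<omega>)\<^sup>2)"
    and W_le: "\<And>n. 2 \<le> n \<Longrightarrow> expectation (\<lambda>\<omega>. (W n \<omega>)\<^sup>2)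
      \<le> C * ((center (\<epsilon> n) - q)\<^sup>2 + (1 / (real n * vol (\<epsilon> n)))\<^sup>2 + (1 / real n)\<^sup>2)"
    and C: "0 \<le> C"
  shows "\<exists>C'. error_bounds (\<lambda>n. expectation (\<lambda>\<omega>. (T n \<omega> - q)\<^sup>2))
    (\<lambda>n. expectation (\<lambda>\<omega>. (linear_part (\<epsilon> n) n \<omega>)\<^sup>2)) (\<lambda>n. expectation (\<lambda>\<omega>. (W n \<omega>)\<^sup>2))
    (\<lambda>n. long_run_variance (smooth_score (\<epsilon> n))) (\<lambda>n. center (\<epsilon> n) - q) \<epsilon> DIM('a) C'"
proof -
  define v where "v = vol 1"
  have v: "0 < v" by (simp add: v_def vol_pos)
  define C1 C2 C3 where "C1 = C * (1 + (1 / v)\<^sup>2)" and "C2 = 8 * real m ^ 2 * score_bound"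
    and "C3 = (1 + 2 * real m) * score_bound"
  define C' where "C' = C1 + C2 + C3"
  have nn: "0 \<le> C1" "0 \<le> C2" "0 \<le> C3" using C score_bound_nonneg by (auto simp: C1_def C2_def C3_def)
  have "error_bounds (\<lambda>n. expectation (\<lambda>\<omega>. (T n \<omega> - q)\<^sup>2))
    (\<lambda>n. expectation (\<lambda>\<omega>. (linear_part (\<epsilon> n) n \<omega>)\<^sup>2)) (\<lambda>n. expectation (\<lambda>\<omega>. (W n \<omega>)\<^sup>2))
    (\<lambda>n. long_run_variance (smooth_score (\<epsilon> n))) (\<lambda>n. center (\<epsilon> n) - q) \<epsilon> DIM('a) C'"
  proof
    fix n :: nat assume n: "2 \<le> n"
    then have n1: "1 \<le> n" and e: "0 < \<epsilon> n" using \<epsilon> by auto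
    note lin = linear_part_second_moment[OF e n1]
    show "0 < \<epsilon> n" by fact
    show "\<bar>expectation (\<lambda>\<omega>. (T n \<omega> - q)\<^sup>2) - expectation (\<lambda>\<omega>. (linear_part (\<epsilon> n) n \<omega>)\<^sup>2)
        - expectation (\<lambda>\<omega>. (W n \<omega>)\<^sup>2)\<bar>
      \<le> 2 * (sqrt (expectation (\<lambda>\<omega>. (linear_part (\<epsilon> n) n \<omega>)\<^sup>2)) * sqrt (expectation (\<lambda>\<omega>. (W n \<omega>)\<^sup>2)))"
    proof -
      note CS = Cauchy_Schwarz_integral[OF lin(1) W(1)[OF n] lin(2) W(2)[OF n]]
      have "expectation (\<lambda>\<omega>. (T n \<omega> - q)\<^sup>2) = expectation (\<lambda>\<omega>. (linear_part (\<epsilon> n) n \<omega>)\<^sup>2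
          + 2 * (linear_part (\<epsilon> n) n \<omega> * W n \<omega>) + (W n \<omega>)\<^sup>2)"
        by (intro Bochner_Integration.integral_cong) (auto simp: W_def power2_eq_square algebra_simps)
      also have "\<dots> = expectation (\<lambda>\<omega>. (linear_part (\<epsilon> n) n \<omega>)\<^sup>2)
          + 2 * expectation (\<lambda>\<omega>. linear_part (\<epsilon> n) n \<omega> * W n \<omega>) + expectation (\<lambda>\<omega>. (W n \<omega>)\<^sup>2)"
        using lin(2) W(2)[OF n] CS(1) by simp
      finally show ?thesis using CS(2) by simp
    qed
    have "(1 / (real n * vol (\<epsilon> n)))\<^sup>2 = (1 / v)\<^sup>2 * (1 / (real n * \<epsilon> n ^ DIM('a)))\<^sup>2"
      using e by (subst vol_eq) (auto simp: v_def power_divide power_mult_distrib)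
    then have "C * ((center (\<epsilon> n) - q)\<^sup>2 + (1 / (real n * vol (\<epsilon> n)))\<^sup>2 + (1 / real n)\<^sup>2)
        \<le> C1 * ((center (\<epsilon> n) - q)\<^sup>2 + (1 / (real n * \<epsilon> n ^ DIM('a)))\<^sup>2 + (1 / real n)\<^sup>2)"
      unfolding C1_def mult.assoc using C by (intro mult_left_mono) (auto simp: algebra_simps)
    also have "\<dots> \<le> C' * ((center (\<epsilon> n) - q)\<^sup>2 + (1 / (real n * \<epsilon> n ^ DIM('a)))\<^sup>2 + (1 / real n)\<^sup>2)"
      using nn by (intro mult_right_mono) (auto simp: C'_def)
    finally show "expectation (\<lambda>\<omega>. (W n \<omega>)\<^sup>2)
        \<le> C' * ((center (\<epsilon> n) - q)\<^sup>2 + (1 / (real n * \<epsilon> n ^ DIM('a)))\<^sup>2 + (1 / real n)\<^sup>2)"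
      using W_le[OF n] by linarith
    have "C2 / (real n)\<^sup>2 \<le> C' / (real n)\<^sup>2" using nn by (intro divide_right_mono) (auto simp: C'_def)
    then show "\<bar>expectation (\<lambda>\<omega>. (linear_part (\<epsilon> n) n \<omega>)\<^sup>2) - 4 * long_run_variance (smooth_score (\<epsilon> n)) / real n\<bar>
        \<le> C' / (real n)\<^sup>2"
      using lin(3) unfolding C2_def by linarith
    show "\<bar>long_run_variance (smooth_score (\<epsilon> n))\<bar> \<le> C'"
      using lin(4) nn unfolding C'_def C3_def by linarith
  qed auto
  then show ?thesis by blast
qed

lemma error_bounds_V:
  assumes \<epsilon>: "\<And>n. 1 \<le> n \<Longrightarrow> 0 < \<epsilon> n"
  shows "\<exists>a w C. error_bounds (\<lambda>n. expectation (\<lambda>\<omega>. (V (\<epsilon> n) n \<omega> - q)\<^sup>2)) a w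
    (\<lambda>n. long_run_variance (smooth_score (\<epsilon> n))) (\<lambda>n. center (\<epsilon> n) - q) \<epsilon> DIM('a) C"
proof -
  have "\<exists>C'. error_bounds (\<lambda>n. expectation (\<lambda>\<omega>. (V (\<epsilon> n) n \<omega> - q)\<^sup>2))
    (\<lambda>n. expectation (\<lambda>\<omega>. (linear_part (\<epsilon> n) n \<omega>)\<^sup>2))
    (\<lambda>n. expectation (\<lambda>\<omega>. (V (\<epsilon> n) n \<omega> - q - linear_part (\<epsilon> n) n \<omega>)\<^sup>2))
    (\<lambda>n. long_run_variance (smooth_score (\<epsilon> n))) (\<lambda>n. center (\<epsilon> n) - q) \<epsilon> DIM('a) C'"
  proof (rule error_bounds_of_remainder[OF \<epsilon>])
    fix n :: nat assume n: "2 \<le> n"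
    then have n1: "1 \<le> n" and e: "0 < \<epsilon> n" using \<epsilon> by auto
    note R = remainder_second_moment[OF e n1]
    show "(\<lambda>\<omega>. V (\<epsilon> n) n \<omega> - q - linear_part (\<epsilon> n) n \<omega>) \<in> borel_measurable M" by (rule R(1))
    show "integrable M (\<lambda>\<omega>. (V (\<epsilon> n) n \<omega> - q - linear_part (\<epsilon> n) n \<omega>)\<^sup>2)" by (rule R(2))
    show "expectation (\<lambda>\<omega>. (V (\<epsilon> n) n \<omega> - q - linear_part (\<epsilon> n) n \<omega>)\<^sup>2)
      \<le> 320 * (2 * real m + 1)\<^sup>2 * ((center (\<epsilon> n) - q)\<^sup>2 + (1 / (real n * vol (\<epsilon> n)))\<^sup>2 + (1 / real n)\<^sup>2)"
      by (rule order_trans[OF R(3)]) (intro mult_left_mono, auto)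
  qed auto
  then show ?thesis by blast
qed

text \<open>
  Removing the diagonal and renormalising changes \<open>V\<close> by \<open>V / (n - 1)\<close>, a term of order \<open>1 / n\<close> in mean
  square up to the old remainder, and by a constant of order \<open>1 / (n b)\<close>, with \<open>b\<close> the volume of the ball.
\<close>

lemma error_bounds_diagonal_free:
  assumes \<epsilon>: "\<And>n. 1 \<le> n \<Longrightarrow> 0 < \<epsilon> n"
  defines "T \<equiv> \<lambda>n \<omega>. real n / (real n - 1) * (V (\<epsilon> n) n \<omega> - 1 / (real n * vol (\<epsilon> n)))"
  shows "\<exists>a w C. error_bounds (\<lambda>n. expectation (\<lambda>\<omega>. (T n \<omega> - q)\<^sup>2)) a w
    (\<lambda>n. long_run_variance (smooth_score (\<epsilon> n))) (\<lambda>n. center (\<epsilon> n) - q) \<epsilon> DIM('a) C"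
proof -
  define C1 where "C1 = 320 * (2 * real m + 1)\<^sup>2"
  define C2 where "C2 = 4 * ((1 + 2 * real m) * score_bound) + 8 * real m ^ 2 * score_bound"
  have C1: "1 \<le> C1"
  proof -
    have "1 \<le> (2 * real m + 1)\<^sup>2" by (simp add: power2_eq_square algebra_simps)
    then show ?thesis unfolding C1_def by linarith
  qed
  have C2: "0 \<le> C2" using score_bound_nonneg by (simp add: C2_def)
  define C where "C = 16 * (C1 + C2 + q\<^sup>2 + 1)"
  have "\<exists>C'. error_bounds (\<lambda>n. expectation (\<lambda>\<omega>. (T n \<omega> - q)\<^sup>2))
    (\<lambda>n. expectation (\<lambda>\<omega>. (linear_part (\<epsilon> n) n \<omega>)\<^sup>2))
    (\<lambda>n. expectation (\<lambda>\<omega>. (T n \<omega> - q - linear_part (\<epsilon> n) n \<omega>)\<^sup>2))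
    (\<lambda>n. long_run_variance (smooth_score (\<epsilon> n))) (\<lambda>n. center (\<epsilon> n) - q) \<epsilon> DIM('a) C'"
  proof (rule error_bounds_of_remainder[OF \<epsilon>, where C=C])
    show "0 \<le> C" using C1 C2 by (simp add: C_def)
    fix n :: nat assume n: "2 \<le> n"
    then have n1: "1 \<le> n" and e: "0 < \<epsilon> n" and rn: "2 \<le> real n" using \<epsilon> by auto
    define W where "W \<omega> = V (\<epsilon> n) n \<omega> - q - linear_part (\<epsilon> n) n \<omega>" for \<omega>
    define A where "A = linear_part (\<epsilon> n) n"
    note R = remainder_second_moment[OF e n1, folded W_def C1_def]
    note lin = linear_part_second_moment[OF e n1, folded A_def]
    have [measurable]: "W \<in> borel_measurable M" "A \<in> borel_measurable M" using R(1) lin(1) by auto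
    define b where "b = 1 / (real n * vol (\<epsilon> n))"
    \<comment> \<open>the renormalising factor is \<open>1 + k\<close>\<close>
    define k where "k = 1 / (real n - 1)"
    have k: "real n / (real n - 1) = 1 + k" using rn by (simp add: k_def field_simps)
    have eq: "T n \<omega> - q - linear_part (\<epsilon> n) n \<omega> = k * A \<omega> + (1 + k) * W \<omega> + (k * q - (1 + k) * b)" for \<omega>
    proof -
      have "V (\<epsilon> n) n \<omega> = W \<omega> + q + A \<omega>" by (simp add: W_def A_def)
      then have "T n \<omega> = (1 + k) * (W \<omega> + q + A \<omega> - b)" unfolding T_def k b_def by simp
      then show ?thesis by (simp add: A_def algebra_simps)
    qed
    have i1: "0 \<le> k" "k \<le> 2 / real n" and i2: "0 \<le> 1 + k" "1 + k \<le> 2"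
      using rn by (auto simp: k_def field_simps)
    have pointwise: "(T n \<omega> - q - linear_part (\<epsilon> n) n \<omega>)\<^sup>2
        \<le> 16 * ((A \<omega>)\<^sup>2 * (1 / real n)\<^sup>2) + 16 * (W \<omega>)\<^sup>2 + 16 * (q\<^sup>2 * (1 / real n)\<^sup>2 + b\<^sup>2)" for \<omega>
    proof -
      have four: "(w + x + (y - z))\<^sup>2 \<le> 4 * w\<^sup>2 + 4 * x\<^sup>2 + 4 * y\<^sup>2 + 4 * z\<^sup>2" for w x y z :: real
        using square_diff_le[of "w + x" "z - y"] square_diff_le[of w "- x"] square_diff_le[of z y] by (simp add: algebra_simps)
      have s1: "(k * x)\<^sup>2 \<le> 4 * (x\<^sup>2 * (1 / real n)\<^sup>2)" for x
        using mult_right_mono[OF power_mono[OF i1(2,1), of 2], of "x\<^sup>2"]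
        by (simp add: power_mult_distrib power_divide)
      have s2: "((1 + k) * x)\<^sup>2 \<le> 4 * x\<^sup>2" for x
        using mult_right_mono[OF power_mono[OF i2(2,1), of 2], of "x\<^sup>2"]
        by (simp add: power_mult_distrib power_divide)
      have comb: "x \<le> 16 * a' + 16 * b' + 16 * (c' + d')"
        if "x \<le> 4 * a + 4 * b + 4 * c + 4 * d" "a \<le> 4 * a'" "b \<le> 4 * b'" "c \<le> 4 * c'" "d \<le> 4 * d'"
        for x a b c d a' b' c' d' :: real
      proof -
        have "4 * a \<le> 16 * a'" "4 * b \<le> 16 * b'" "4 * c \<le> 16 * c'" "4 * d \<le> 16 * d'"
          using that(2-5) by simp_all
        from order_trans[OF that(1) add_mono[OF add_mono[OF add_mono[OF this(1,2)] this(3)] this(4)]]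
        show ?thesis by (simp add: distrib_left add.assoc)
      qed
      show ?thesis unfolding eq by (rule comb[OF four s1 s2 s1 s2])
    qed
    have meas: "(\<lambda>\<omega>. T n \<omega> - q - linear_part (\<epsilon> n) n \<omega>) \<in> borel_measurable M" unfolding eq by measurable
    show "(\<lambda>\<omega>. T n \<omega> - q - linear_part (\<epsilon> n) n \<omega>) \<in> borel_measurable M" by (rule meas)
    have int_bound: "integrable M (\<lambda>\<omega>. 16 * ((A \<omega>)\<^sup>2 * (1 / real n)\<^sup>2) + 16 * (W \<omega>)\<^sup>2 + 16 * (q\<^sup>2 * (1 / real n)\<^sup>2 + b\<^sup>2))"
      using lin(2) R(2) by (intro Bochner_Integration.integrable_add integrable_mult_right integrable_mult_left) auto
    show int: "integrable M (\<lambda>\<omega>. (T n \<omega> - q - linear_part (\<epsilon> n) n \<omega>)\<^sup>2)"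
      by (rule Bochner_Integration.integrable_bound[OF int_bound])
         (use meas pointwise in \<open>auto intro!: AE_I2 order_trans[OF pointwise] borel_measurable_power\<close>)
    have A_le: "expectation (\<lambda>\<omega>. (A \<omega>)\<^sup>2) \<le> C2"
    proof -
      have "4 * long_run_variance (smooth_score (\<epsilon> n)) / real n \<le> 4 * ((1 + 2 * real m) * score_bound)"
      proof -
        have "4 * long_run_variance (smooth_score (\<epsilon> n)) / real n \<le> \<bar>4 * long_run_variance (smooth_score (\<epsilon> n))\<bar> / real n"
          by (intro divide_right_mono) auto
        also have "\<dots> \<le> \<bar>4 * long_run_variance (smooth_score (\<epsilon> n))\<bar> / 1"
          using rn by (intro divide_left_mono) auto
        finally show ?thesis using lin(4) by simp
      qed
      moreover have "8 * real m ^ 2 * score_bound / (real n)\<^sup>2 \<le> 8 * real m ^ 2 * score_bound / 1"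
        using rn score_bound_nonneg by (intro divide_left_mono) auto
      ultimately show ?thesis using lin(3) unfolding C2_def by linarith
    qed
    have "expectation (\<lambda>\<omega>. (T n \<omega> - q - linear_part (\<epsilon> n) n \<omega>)\<^sup>2)
        \<le> expectation (\<lambda>\<omega>. 16 * ((A \<omega>)\<^sup>2 * (1 / real n)\<^sup>2) + 16 * (W \<omega>)\<^sup>2 + 16 * (q\<^sup>2 * (1 / real n)\<^sup>2 + b\<^sup>2))"
      by (rule integral_mono[OF int int_bound pointwise])
    also have "\<dots> = 16 * (expectation (\<lambda>\<omega>. (A \<omega>)\<^sup>2) * (1 / real n)\<^sup>2) + 16 * expectation (\<lambda>\<omega>. (W \<omega>)\<^sup>2)
        + 16 * (q\<^sup>2 * (1 / real n)\<^sup>2 + b\<^sup>2)"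
      using lin(2) R(2) by (simp add: prob_space)
    also have "\<dots> \<le> 16 * (C2 * (1 / real n)\<^sup>2) + 16 * (C1 * ((center (\<epsilon> n) - q)\<^sup>2 + b\<^sup>2))
        + 16 * (q\<^sup>2 * (1 / real n)\<^sup>2 + b\<^sup>2)"
      using mult_right_mono[OF A_le, of "(1 / real n)\<^sup>2"] R(3) unfolding b_def by simp
    also have "\<dots> \<le> C * ((center (\<epsilon> n) - q)\<^sup>2 + b\<^sup>2 + (1 / real n)\<^sup>2)"
    proof -
      have nn: "0 \<le> C2 * x\<^sup>2" "0 \<le> C1 * x\<^sup>2" "0 \<le> q\<^sup>2 * x\<^sup>2" for x using C1 C2 by auto
      show ?thesis unfolding C_def
        using nn[of "center (\<epsilon> n) - q"] nn[of b] nn[of "1 / real n"]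
        by (simp add: distrib_left distrib_right)
    qed
    finally show "expectation (\<lambda>\<omega>. (T n \<omega> - q - linear_part (\<epsilon> n) n \<omega>)\<^sup>2)
      \<le> C * ((center (\<epsilon> n) - q)\<^sup>2 + (1 / (real n * vol (\<epsilon> n)))\<^sup>2 + (1 / real n)\<^sup>2)" unfolding b_def .
  qed
  then show ?thesis by blast
qed

lemma three_rates:
  assumes \<epsilon>: "\<And>n. 1 \<le> n \<Longrightarrow> 0 < \<epsilon> n" "\<epsilon> \<longlonglongrightarrow> 0"
    and eb: "\<exists>a w C. error_bounds err a w
      (\<lambda>n. long_run_variance (smooth_score (\<epsilon> n))) (\<lambda>n. center (\<epsilon> n) - q) \<epsilon> DIM('a) C"
  shows "filterlim (\<lambda>n. real n * \<epsilon> n ^ DIM('a)) at_top sequentially \<Longrightarrow> err \<longlonglongrightarrow> 0"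
    and "\<lbrakk>0 < \<alpha>; 0 < K; f \<in> H2_class \<alpha> K; g \<in> H2_class \<alpha> K; \<alpha> \<le> real DIM('a) / 2; 0 < c;
        \<epsilon> \<sim>[at_top] (\<lambda>n. c * real n powr (- 1 / (2 * \<alpha> + real DIM('a))))\<rbrakk>
      \<Longrightarrow> err \<in> O(\<lambda>n. real n powr (- 4 * \<alpha> / (2 * \<alpha> + real DIM('a))))"
    and "\<lbrakk>DIM('a) = 1; 1 / 2 < \<alpha>; 0 < K; f \<in> H2_class \<alpha> K; g \<in> H2_class \<alpha> K; slowly_varying L;
        filterlim L at_top sequentially; \<epsilon> \<sim>[at_top] (\<lambda>n. L n * real n powr (- 1 / 2))\<rbrakk>
      \<Longrightarrow> (\<lambda>n. err n - 4 * long_run_variance limit_score / real n) \<in> o(\<lambda>n. 1 / real n)"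
proof -
  obtain a w C where "error_bounds err a w
      (\<lambda>n. long_run_variance (smooth_score (\<epsilon> n))) (\<lambda>n. center (\<epsilon> n) - q) \<epsilon> DIM('a) C"
    using eb by blast
  then interpret error_bounds err a w
      "\<lambda>n. long_run_variance (smooth_score (\<epsilon> n))" "\<lambda>n. center (\<epsilon> n) - q" \<epsilon> "DIM('a)" C .
  have small: "eventually (\<lambda>n. \<epsilon> n < 1) sequentially" using \<epsilon>(2) by (rule order_tendstoD) simp
  have bias: "eventually (\<lambda>n. \<bar>center (\<epsilon> n) - q\<bar> \<le> K\<^sup>2 / 2 * \<epsilon> n powr (2 * \<alpha>)) sequentially"
    if "0 < \<alpha>" "0 < K" "f \<in> H2_class \<alpha> K" "g \<in> H2_class \<alpha> K" for \<alpha> K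
    using small eventually_ge_at_top[of 1]
    by eventually_elim (rule bias_le_of_H2[OF \<epsilon>(1) less_imp_le], use that in auto)
  show "filterlim (\<lambda>n. real n * \<epsilon> n ^ DIM('a)) at_top sequentially \<Longrightarrow> err \<longlonglongrightarrow> 0"
    by (rule consistency[OF bias_tendsto_0[OF \<epsilon>]])
  show "\<lbrakk>0 < \<alpha>; 0 < K; f \<in> H2_class \<alpha> K; g \<in> H2_class \<alpha> K; \<alpha> \<le> real DIM('a) / 2; 0 < c;
        \<epsilon> \<sim>[at_top] (\<lambda>n. c * real n powr (- 1 / (2 * \<alpha> + real DIM('a))))\<rbrakk>
      \<Longrightarrow> err \<in> O(\<lambda>n. real n powr (- 4 * \<alpha> / (2 * \<alpha> + real DIM('a))))"
    by (rule smooth_rate[OF _ _ _ _ bias])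
  show "\<lbrakk>DIM('a) = 1; 1 / 2 < \<alpha>; 0 < K; f \<in> H2_class \<alpha> K; g \<in> H2_class \<alpha> K; slowly_varying L;
        filterlim L at_top sequentially; \<epsilon> \<sim>[at_top] (\<lambda>n. L n * real n powr (- 1 / 2))\<rbrakk>
      \<Longrightarrow> (\<lambda>n. err n - 4 * long_run_variance limit_score / real n) \<in> o(\<lambda>n. 1 / real n)"
    by (rule parametric_rate[OF _ _ _ _ _ bias long_run_variance_tendsto[OF \<epsilon>]]) auto
qed

end

text \<open>
  Relates the full double sum to the sum over \<open>i < j\<close> in the estimator of the quadratic functional.
\<close>

lemma sum_pairs_symmetric:
  fixes F :: "nat \<Rightarrow> nat \<Rightarrow> real"
  assumes sym: "\<And>i j. F i j = F j i"
  shows "(\<Sum>i=1..n. \<Sum>j=1..n. F i j)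
    = (\<Sum>i=1..n. F i i) + 2 * (\<Sum>(i, j)\<in>{(i, j). 1 \<le> i \<and> i < j \<and> j \<le> n}. F i j)"
proof -
  let ?L = "{(i, j). 1 \<le> i \<and> i < j \<and> j \<le> n}" and ?U = "{(i, j). 1 \<le> j \<and> j < i \<and> i \<le> n}"
  let ?D = "(\<lambda>i. (i, i)) ` {1..n}"
  have fin: "finite ?L" "finite ?U" "finite ?D"
    by (rule finite_subset[of _ "{1..n} \<times> {1..n}"]; auto)+
  have split: "{1..n} \<times> {1..n} = ?D \<union> (?L \<union> ?U)" by auto
  have "(\<Sum>i=1..n. \<Sum>j=1..n. F i j) = (\<Sum>(i, j)\<in>?D \<union> (?L \<union> ?U). F i j)"
    unfolding sum.cartesian_product split ..
  also have "\<dots> = (\<Sum>(i, j)\<in>?D. F i j) + ((\<Sum>(i, j)\<in>?L. F i j) + (\<Sum>(i, j)\<in>?U. F i j))"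
    using fin by (subst sum.union_disjoint, (auto)[3], subst sum.union_disjoint) auto
  also have "(\<Sum>(i, j)\<in>?D. F i j) = (\<Sum>i=1..n. F i i)"
    by (subst sum.reindex) (auto simp: inj_on_def)
  also have "(\<Sum>(i, j)\<in>?U. F i j) = (\<Sum>(i, j)\<in>?L. F i j)"
    by (rule sum.reindex_bij_witness[of _ prod.swap prod.swap]) (use sym in auto)
  finally show ?thesis by simp
qed

theorem theorem2:
  fixes M :: "'w measure"
    and X Y :: "nat \<Rightarrow> 'w \<Rightarrow> 'a::euclidean_space"
    and pX pY :: "'a \<Rightarrow> real"
    and m :: nat
    and kl :: "nat \<times> nat"
    and eps :: "nat \<Rightarrow> real"
  assumes prob: "prob_space M"
    and measX: "\<And>i. 1 \<le> i \<Longrightarrow> X i \<in> borel_measurable M"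
    and measY: "\<And>i. 1 \<le> i \<Longrightarrow> Y i \<in> borel_measurable M"
    and statX: "strictly_stationary M X" and depX: "m_dependent M m X"
    and statY: "strictly_stationary M Y" and depY: "m_dependent M m Y"
    and densX: "is_density M (X 1) pX"
    and densY: "is_density M (Y 1) pY"
    and kl: "kl \<in> {(2, 0), (1, 1)}"
    and L3: "pX \<in> Lp_fun 3" "pY \<in> Lp_fun 3"
    and statXY: "strictly_stationary M (\<lambda>i \<omega>. (X i \<omega>, Y i \<omega>))"
    and depXY: "m_dependent M m (\<lambda>i \<omega>. (X i \<omega>, Y i \<omega>))"
    and eps_pos: "\<And>n. 1 \<le> n \<Longrightarrow> 0 < eps n"
    and eps_lim: "eps \<longlonglongrightarrow> 0"
  shows
    "(filterlim (\<lambda>n. real n * eps n ^ DIM('a)) at_top sequentially \<longrightarrow>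
        (\<lambda>n. mean_sq_error kl M X Y pX pY (eps n) n) \<longlonglongrightarrow> 0)
     \<and>
     (\<forall>\<alpha> K c. 0 < \<alpha> \<and> \<alpha> \<le> 1 \<and> 0 < K \<and> pX \<in> H2_class \<alpha> K \<and> pY \<in> H2_class \<alpha> K \<and>
        \<alpha> \<le> real DIM('a) / 2 \<and> 0 < c \<and>
        eps \<sim>[at_top] (\<lambda>n. c * real n powr (- 1 / (2 * \<alpha> + real DIM('a)))) \<longrightarrow>
        (\<lambda>n. mean_sq_error kl M X Y pX pY (eps n) n)
          \<in> O[at_top](\<lambda>n. real n powr (- 4 * \<alpha> / (2 * \<alpha> + real DIM('a)))))
     \<and>
     (\<forall>\<alpha> K L. DIM('a) = 1 \<and> 1 / 2 < \<alpha> \<and> \<alpha> \<le> 1 \<and> 0 < K \<and>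
        pX \<in> H2_class \<alpha> K \<and> pY \<in> H2_class \<alpha> K \<and>
        slowly_varying L \<and> filterlim L at_top sequentially \<and>
        eps \<sim>[at_top] (\<lambda>n. L n * real n powr (- 1 / 2)) \<longrightarrow>
        (\<lambda>n. mean_sq_error kl M X Y pX pY (eps n) n - 4 * sigma_sq kl M m X Y pX pY / real n)
          \<in> o[at_top](\<lambda>n. 1 / real n))"
proof -
  let ?Z = "\<lambda>i \<omega>. (X i \<omega>, Y i \<omega>)"
  interpret Z: stationary_m_dependent M ?Z m
    by (intro stationary_m_dependent.intro stationary_m_dependent_axioms.intro prob statXY depXY)
       (use measX measY in measurable)
  have meas: "fst \<in> borel_measurable borel" "snd \<in> borel_measurable borel"
    by (auto intro!: borel_measurable_continuous_onI continuous_intros)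
  show ?thesis
  proof (cases "kl = (2, 0)")
    case True
    interpret S: smoothed_pairs M ?Z m fst fst pX pX
      by unfold_locales (use meas densX L3 in auto)
    define T where "T n \<omega> = real n / (real n - 1) * (S.V (eps n) n \<omega> - 1 / (real n * S.vol (eps n)))" for n \<omega>
    have T: "T n \<omega> = Q_tilde kl X Y (eps n) n \<omega>" if n: "2 \<le> n" for n \<omega>
    proof -
      define b where "b = S.vol (eps n)"
      define P where "P = (\<Sum>(i, j)\<in>{(i, j). 1 \<le> i \<and> i < j \<and> j \<le> n}. of_bool (dist (X i \<omega>) (X j \<omega>) \<le> eps n) :: real)"
      have e: "0 < eps n" using eps_pos n by simp
      have b: "0 < b" using S.vol_pos[OF e] by (simp add: b_def)
      have "(\<Sum>i=1..n. \<Sum>j=1..n. of_bool (dist (X i \<omega>) (X j \<omega>) \<le> eps n) :: real) = real n + 2 * P"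
        unfolding P_def using sum_pairs_symmetric[of "\<lambda>i j. of_bool (dist (X i \<omega>) (X j \<omega>) \<le> eps n)" n] e
        by (simp add: dist_commute)
      then have "S.V (eps n) n \<omega> = 1 / (real n)\<^sup>2 * ((real n + 2 * P) / b)"
        by (simp add: S.V_def S.ind_def b_def sum_divide_distrib[symmetric])
      then have T_eq: "T n \<omega> = 2 * P / (real n * (real n - 1)) / b"
        using n b by (simp add: T_def b_def[symmetric] field_simps power2_eq_square)
      have choose: "real (n choose 2) = real n * (real n - 1) / 2"
        using n by (simp add: choose_two real_of_nat_div of_nat_diff)
      have "T n \<omega> = 1 / real (n choose 2) * P / b" unfolding T_eq choose by simp
      also have "1 / real (n choose 2) * P = Q20 X (eps n) n \<omega>" unfolding Q20_def P_def ..
      finally show ?thesis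
        using True by (simp add: Q_tilde_def Q_kl_def b_def S.vol_def)
    qed
    have err: "error_bounds (\<lambda>n. mean_sq_error kl M X Y pX pY (eps n) n) a w s \<beta> eps DIM('a) C"
      if "error_bounds (\<lambda>n. Z.expectation (\<lambda>\<omega>. (T n \<omega> - S.q)\<^sup>2)) a w s \<beta> eps DIM('a) C" for a w s \<beta> C
    proof -
      have "Z.expectation (\<lambda>\<omega>. (T n \<omega> - S.q)\<^sup>2) = mean_sq_error kl M X Y pX pY (eps n) n" if "2 \<le> n" for n
        using T[OF that] True by (simp add: mean_sq_error_def q_kl_def q20_def S.q_def power2_eq_square)
      then show ?thesis using that by (simp add: error_bounds_def)
    qed
    have sigma: "S.long_run_variance S.limit_score = sigma_sq kl M m X Y pX pY"
      using S.long_run_variance_limit[of "\<lambda>z. pX (fst z)"] True by (simp add: sigma_sq_def sigma20_sq_def)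
    note rates = S.three_rates[where \<epsilon>=eps, OF eps_pos eps_lim, where err="\<lambda>n. mean_sq_error kl M X Y pX pY (eps n) n", unfolded sigma]
    have eb: "\<exists>a w C. error_bounds (\<lambda>n. mean_sq_error kl M X Y pX pY (eps n) n) a w
      (\<lambda>n. S.long_run_variance (S.smooth_score (eps n))) (\<lambda>n. S.center (eps n) - S.q) eps DIM('a) C"
      using S.error_bounds_diagonal_free[where \<epsilon>=eps, OF eps_pos] err unfolding T_def by blast
    show ?thesis using rates[OF _ eb] by blast
  next
    case False
    interpret S: smoothed_pairs M ?Z m fst snd pX pY
      by unfold_locales (use meas densX densY L3 in auto)
    have V: "S.V (eps n) n \<omega> = Q_tilde kl X Y (eps n) n \<omega>" for n \<omega>
      using False by (simp add: S.V_def S.ind_def S.vol_def Q_tilde_def Q_kl_def Q11_def sum_divide_distrib[symmetric])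
    have err: "Z.expectation (\<lambda>\<omega>. (S.V (eps n) n \<omega> - S.q)\<^sup>2) = mean_sq_error kl M X Y pX pY (eps n) n" for n
      using False by (simp add: V mean_sq_error_def q_kl_def q11_def S.q_def)
    have sigma: "S.long_run_variance S.limit_score = sigma_sq kl M m X Y pX pY"
      using S.long_run_variance_limit[of "\<lambda>z. g_fun pX pY (fst z) (snd z)"] False
      by (simp add: sigma_sq_def sigma11_sq_def g_fun_def)
    note rates = S.three_rates[where \<epsilon>=eps, OF eps_pos eps_lim, where err="\<lambda>n. mean_sq_error kl M X Y pX pY (eps n) n", unfolded sigma]
    have eb: "\<exists>a w C. error_bounds (\<lambda>n. mean_sq_error kl M X Y pX pY (eps n) n) a w
      (\<lambda>n. S.long_run_variance (S.smooth_score (eps n))) (\<lambda>n. S.center (eps n) - S.q) eps DIM('a) C"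
      using S.error_bounds_V[where \<epsilon>=eps, OF eps_pos, unfolded err] by blast
    show ?thesis using rates[OF _ eb] by blast
  qed
qed

end
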